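(* Let $H_i$ ($i\in\mathbb{N}$) and $H$ be functions $[0,T]\times\mathbb{R}^n\times\mathbb{R}^n\to\mathbb{R}$ satisfying (H1)–(H4) and (HLC) with the same integrable functions $c(\cdot)$ and $k_R(\cdot)$ ($R>0$). Let $g_i$, $g:\mathbb{R}^n\to\mathbb{R}\cup\{+\infty\}$ be proper, lower semicontinuous, with $g_i$ epi-converging to $g$. Assume $\max\{|H_i(t,0,0)|,|H(t,0,0)|\}\le\mu(t)$ for all $t\in[0,T]$, $i\in\mathbb{N}$, for some integrable $\mu$. Let $(\mathbb{R}^{n+1},f_i,l_i)$ and $(\mathbb{R}^{n+1},f,l)$ be the Steiner representations of $H_i$ and $H$, and let $$V_i(t_0,x_0)=\inf_{(x,a)\in S_{f_i}(t_0,x_0)}\Big\{g_i(x(T))+\int_{t_0}^T l_i(t,x,a)\,dt\Big\},\quad V(t_0,x_0)=\inf_{(x,a)\in S_{f}(t_0,x_0)}\Big\{g(x(T))+\int_{t_0}^T l(t,x,a)\,dt\Big\}.$$ If $H_i(t,\cdot,\cdot)\to H(t,\cdot,\cdot)$ uniformly on compact sets for every $t\in[0,T]$, then $V_i$ epi-converge to $V$.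
   Context: Hypotheses: (H1) $H(\cdot,x,p)$ Lebesgue measurable; (H2) $H(t,\cdot,\cdot)$ continuous; (H3) $H(t,x,\cdot)$ convex; (H4) there is measurable $c\ge0$ with $|H(t,x,p)-H(t,x,q)|\le c(t)(1+|x|)|p-q|$; (HLC) for each $R>0$ there is measurable $k_R\ge0$ with $|H(t,x,p)-H(t,y,p)|\le k_R(t)(1+|p|)|x-y|$ for $x,y\in\bar B_R$, all $p$. $H^*(t,x,v)=\sup_p\{\langle v,p\rangle-H(t,x,p)\}$. Proper: never $-\infty$, not identically $+\infty$. A sequence $\varphi_i$ epi-converges to $\varphi$ if for every $z$: $\liminf_i\varphi_i(z_i)\ge\varphi(z)$ for every sequence $z_i\to z$, and $\limsup_i\varphi_i(z_i)\le\varphi(z)$ for some sequence $z_i\to z$. $S_f(t_0,x_0)$: pairs $x(\cdot)$ absolutely continuous on $[t_0,T]$, $a(\cdot)\in L^1([t_0,T],\mathbb{R}^{n+1})$, $\dot x=f(t,x,a)$ a.e., $x(t_0)=x_0$. Steiner representation of $H$: $E(t,x)=\mathrm{epi}\,H^*(t,x,\cdot)\subset\mathbb{R}^{n+1}$; $\Phi(t,x,a)=E(t,x)\cap\bar B(a,2d(a,E(t,x)))$; Steiner point $s_m(K)=m\int_{S^{m-1}}p\max_{y\in K}\langle p,y\rangle\,\mu(dp)$ ($\mu$ normalized rotation-invariant measure on the unit sphere); $(f,l)(t,x,a)=s_{n+1}(\Phi(t,x,a))$ with $f\in\mathbb{R}^n$, $l\in\mathbb{R}$. *)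

theory Defs
  imports "HOL-Analysis.Analysis"
begin

definition lsc :: "('a::topological_space \<Rightarrow> ereal) \<Rightarrow> bool" where
  "lsc g \<longleftrightarrow> (\<forall>x. g x \<le> Liminf (at x) g)"

definition proper_fun :: "('a \<Rightarrow> ereal) \<Rightarrow> bool" where
  "proper_fun g \<longleftrightarrow> (\<forall>x. g x \<noteq> -\<infinity>) \<and> (\<exists>x. g x \<noteq> \<infinity>)"

definition epi_converges_on ::
  "'a::topological_space set \<Rightarrow> (nat \<Rightarrow> 'a \<Rightarrow> ereal) \<Rightarrow> ('a \<Rightarrow> ereal) \<Rightarrow> bool" where
  "epi_converges_on D \<phi>s \<phi> \<longleftrightarrow>
     (\<forall>z\<in>D.
        (\<forall>zs. (\<forall>i. zs i \<in> D) \<longrightarrow> zs \<longlonglongrightarrow> z \<longrightarrow> \<phi> z \<le> liminf (\<lambda>i. \<phi>s i (zs i))) \<and>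
        (\<exists>zs. (\<forall>i. zs i \<in> D) \<and> zs \<longlonglongrightarrow> z \<and> limsup (\<lambda>i. \<phi>s i (zs i)) \<le> \<phi> z))"

definition abs_continuous_on :: "real set \<Rightarrow> (real \<Rightarrow> 'b::real_normed_vector) \<Rightarrow> bool" where
  "abs_continuous_on S x \<longleftrightarrow>
     (\<forall>\<epsilon>>0. \<exists>\<delta>>0. \<forall>(m::nat) (a::nat \<Rightarrow> real) b.
        (\<forall>k<m. a k \<le> b k \<and> {a k..b k} \<subseteq> S) \<longrightarrow>
        (\<forall>j<m. \<forall>k<m. j \<noteq> k \<longrightarrow> b j \<le> a k \<or> b k \<le> a j) \<longrightarrow>
        (\<Sum>k<m. b k - a k) < \<delta> \<longrightarrow>
        (\<Sum>k<m. norm (x (b k) - x (a k))) < \<epsilon>)"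

text \<open>The normalized rotation-invariant measure on the unit sphere, realised as the
  image of the normalized Lebesgue measure on the unit ball under radial projection.\<close>
definition sphere_measure :: "'a::euclidean_space measure" where
  "sphere_measure = distr (uniform_measure lborel (ball 0 1)) borel (\<lambda>y. y /\<^sub>R norm y)"

definition steiner_point :: "'a::euclidean_space set \<Rightarrow> 'a" where
  "steiner_point K = real DIM('a) *\<^sub>R
     (\<integral>p. (SUP y\<in>K. p \<bullet> y) *\<^sub>R p \<partial>sphere_measure)"

definition ham_conj :: "(real \<Rightarrow> 'a::euclidean_space \<Rightarrow> 'a \<Rightarrow> real) \<Rightarrow> real \<Rightarrow> 'a \<Rightarrow> 'a \<Rightarrow> ereal" where
  "ham_conj H t x v = (SUP p. ereal (v \<bullet> p - H t x p))"

definition ham_epi :: "(real \<Rightarrow> 'a::euclidean_space \<Rightarrow> 'a \<Rightarrow> real) \<Rightarrow> real \<Rightarrow> 'a \<Rightarrow> ('a \<times> real) set" where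
  "ham_epi H t x = {(v, r). ham_conj H t x v \<le> ereal r}"

definition steiner_Phi :: "(real \<Rightarrow> 'a::euclidean_space \<Rightarrow> 'a \<Rightarrow> real) \<Rightarrow> real \<Rightarrow> 'a \<Rightarrow> 'a \<times> real \<Rightarrow> ('a \<times> real) set" where
  "steiner_Phi H t x a = ham_epi H t x \<inter> cball a (2 * infdist a (ham_epi H t x))"

definition steiner_f :: "(real \<Rightarrow> 'a::euclidean_space \<Rightarrow> 'a \<Rightarrow> real) \<Rightarrow> real \<Rightarrow> 'a \<Rightarrow> 'a \<times> real \<Rightarrow> 'a" where
  "steiner_f H t x a = fst (steiner_point (steiner_Phi H t x a))"

definition steiner_l :: "(real \<Rightarrow> 'a::euclidean_space \<Rightarrow> 'a \<Rightarrow> real) \<Rightarrow> real \<Rightarrow> 'a \<Rightarrow> 'a \<times> real \<Rightarrow> real" where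
  "steiner_l H t x a = snd (steiner_point (steiner_Phi H t x a))"

definition ham_hyps ::
  "real \<Rightarrow> (real \<Rightarrow> real) \<Rightarrow> (real \<Rightarrow> real \<Rightarrow> real) \<Rightarrow> (real \<Rightarrow> 'a::euclidean_space \<Rightarrow> 'a \<Rightarrow> real) \<Rightarrow> bool" where
  "ham_hyps T c k H \<longleftrightarrow>
     \<comment> \<open>(H1)\<close>
     (\<forall>x p. (\<lambda>t. H t x p) \<in> borel_measurable (lebesgue_on {0..T})) \<and>
     \<comment> \<open>(H2)\<close>
     (\<forall>t\<in>{0..T}. continuous_on UNIV (\<lambda>(x, p). H t x p)) \<and>
     \<comment> \<open>(H3)\<close>
     (\<forall>t\<in>{0..T}. \<forall>x. convex_on UNIV (H t x)) \<and>
     \<comment> \<open>(H4)\<close>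
     (\<forall>t\<in>{0..T}. \<forall>x p q. \<bar>H t x p - H t x q\<bar> \<le> c t * (1 + norm x) * norm (p - q)) \<and>
     \<comment> \<open>(HLC)\<close>
     (\<forall>R>0. \<forall>t\<in>{0..T}. \<forall>x\<in>cball 0 R. \<forall>y\<in>cball 0 R. \<forall>p.
        \<bar>H t x p - H t y p\<bar> \<le> k R t * (1 + norm p) * norm (x - y))"

definition admissible ::
  "real \<Rightarrow> (real \<Rightarrow> 'a::euclidean_space \<Rightarrow> 'a \<times> real \<Rightarrow> 'a) \<Rightarrow> real \<Rightarrow> 'a
     \<Rightarrow> ((real \<Rightarrow> 'a) \<times> (real \<Rightarrow> 'a \<times> real)) set" where
  "admissible T f t0 x0 =
     {(x, a). abs_continuous_on {t0..T} x \<and>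
              integrable (lebesgue_on {t0..T}) a \<and>
              (AE t in lebesgue_on {t0..T}. (x has_vector_derivative f t (x t) (a t)) (at t)) \<and>
              x t0 = x0}"

definition run_cost ::
  "real \<Rightarrow> (real \<Rightarrow> 'a::euclidean_space \<Rightarrow> 'a \<times> real \<Rightarrow> real) \<Rightarrow> real
     \<Rightarrow> (real \<Rightarrow> 'a) \<Rightarrow> (real \<Rightarrow> 'a \<times> real) \<Rightarrow> ereal" where
  "run_cost T l t0 x a =
     (if integrable (lebesgue_on {t0..T}) (\<lambda>t. l t (x t) (a t))
      then ereal (integral\<^sup>L (lebesgue_on {t0..T}) (\<lambda>t. l t (x t) (a t)))
      else \<infinity>)"

definition value_fun ::
  "real \<Rightarrow> ('a::euclidean_space \<Rightarrow> ereal) \<Rightarrow> (real \<Rightarrow> 'a \<Rightarrow> 'a \<times> real \<Rightarrow> 'a)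
     \<Rightarrow> (real \<Rightarrow> 'a \<Rightarrow> 'a \<times> real \<Rightarrow> real) \<Rightarrow> real \<times> 'a \<Rightarrow> ereal" where
  "value_fun T g f l z =
     (INF xa\<in>admissible T f (fst z) (snd z).
        g (fst xa T) + run_cost T l (fst z) (fst xa) (snd xa))"

end

(* The Steiner selection (f, l) takes values in the epigraph E(t, x) of the conjugate Hamiltonian and
   fixes its points, so the value function is the infimum of g(x(T)) + integral of r over all solutions
   of the inclusion (x', r) : E(t, x); no regularity of (f, l) is needed.

   Lower limit: near-optimal trajectories have dominated velocities, so Arzela-Ascoli gives a uniform
   limit of the states. Convex combinations of the pairs (x', r) converge almost everywhere, the
   epigraph constraints, being linear in (x', r), pass to the limit, and Fatou's lemma bounds the cost.

   Recovery: along a near-optimal trajectory of H the distance of (x', r) to the epigraph of H_i tends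
   to 0 in L^1, so a Filippov construction run backwards from points z_i -> x(T) with
   limsup g_i(z_i) <= g(x(T)) yields trajectories of H_i that converge with their costs. *)

theory Submission
  imports Defs "HOL-Probability.Probability_Measure" "HOL-Complex_Analysis.Great_Picard"
begin

section \<open>Steiner points of convex bodies\<close>

text \<open>Approximate membership in an epigraph is expressed by
  \<open>v \<bullet> p - r \<le> H t x p + e * (1 + norm p)\<close> for all \<open>p\<close>. The
  weight \<open>1 + norm p\<close> is the growth that (HLC) allows, and it splits: the part
  \<open>e\<close> is paid by raising the cost \<open>r\<close>, the part \<open>e * norm p\<close>
  by moving the velocity by at most \<open>e\<close>, which \<open>convex_sandwich\<close> makes
  possible. In the lower limit the two components behave differently. (H4) dominates the velocities
  by one integrable function, so their integrals converge. The costs have only an integrable lower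
  bound and bounded integrals, so they may concentrate, and only an inequality survives. The
  Filippov curves start at the end time because \<open>g\<close> may be infinite or discontinuous:
  the end point has to be exactly a point where \<open>gs i\<close> is under control, whereas a
  recovery sequence leaves the initial point free to move. Initial times vary in the lower limit,
  which is why all trajectories are prolonged to the common interval [0, T]. The Steiner point stays
  in its set because the dimension factor normalizes the second moments of the sphere measure, as
  reflections show.\<close>

lemma emeasure_lborel_isometry_le:
  fixes \<sigma> :: "'a::euclidean_space \<Rightarrow> 'a"
  assumes lin: "linear \<sigma>" and iso: "\<And>x. norm (\<sigma> x) = norm x" and inv: "\<And>x. \<sigma> (\<sigma> x) = x"
    and S: "open S"
  shows "emeasure lborel S \<le> emeasure lborel (\<sigma> -` S)"
proof -
  \<comment> \<open>By Vitali, \<open>S\<close> is a countable disjoint union of balls up to a null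
    set. Preimages of balls under \<open>\<sigma>\<close> are balls of the same radius, and the
    volume of a ball depends only on the radius.\<close>
  define K where "K = {(x::'a, r::real). 0 < r \<and> ball x r \<subseteq> S}"
  have "\<exists>i. i \<in> K \<and> x \<in> ball (fst i) (snd i) \<and> snd i < d" if "x \<in> S" "0 < d" for x d
  proof -
    obtain e where e: "0 < e" "ball x e \<subseteq> S" using S \<open>x \<in> S\<close> openE by blast
    have "(x, min e (d/2)) \<in> K" using e that by (auto simp: K_def)
    then show ?thesis using e that by (intro exI[of _ "(x, min e (d/2))"]) auto
  qed
  then obtain C where C: "countable C" "C \<subseteq> K"
     "pairwise (\<lambda>i j. disjnt (ball (fst i) (snd i)) (ball (fst j) (snd j))) C"
     "negligible (S - (\<Union>i \<in> C. ball (fst i) (snd i)))"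
    using Vitali_covering_theorem_balls[of S K fst snd] by blast
  let ?U = "\<Union>i\<in>C. ball (fst i) (snd i)"
  let ?V = "\<Union>i\<in>C. ball (\<sigma> (fst i)) (snd i)"
  have iso2: "dist (\<sigma> x) y = dist x (\<sigma> y)" for x y
  proof -
    have "dist (\<sigma> x) y = norm (\<sigma> (x - \<sigma> y))" by (simp add: linear_diff[OF lin] inv dist_norm)
    then show ?thesis by (simp add: iso dist_norm)
  qed
  have vim: "\<sigma> -` ball x r = ball (\<sigma> x) r" for x r by (auto simp: iso2)
  have pos: "snd i \<ge> 0" if "i \<in> C" for i using C(2) that by (auto simp: K_def)
  have d1: "disjoint_family_on (\<lambda>i. ball (fst i) (snd i)) C"
    using C(3) by (auto simp: disjoint_family_on_def pairwise_def disjnt_def)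
  have d2: "disjoint_family_on (\<lambda>i. ball (\<sigma> (fst i)) (snd i)) C"
    unfolding disjoint_family_on_def
  proof (intro ballI impI)
    fix i j assume "i \<in> C" "j \<in> C" "i \<noteq> j"
    then have "ball (fst i) (snd i) \<inter> ball (fst j) (snd j) = {}"
      using d1 by (auto simp: disjoint_family_on_def)
    then have "\<sigma> -` (ball (fst i) (snd i) \<inter> ball (fst j) (snd j)) = {}" by simp
    then show "ball (\<sigma> (fst i)) (snd i) \<inter> ball (\<sigma> (fst j)) (snd j) = {}"
      by (simp only: vimage_Int vim)
  qed
  have US: "?U \<subseteq> S"
  proof (rule UN_least)
    fix i assume "i \<in> C"
    then have "i \<in> K" using C(2) by blast
    then show "ball (fst i) (snd i) \<subseteq> S" by (auto simp: K_def)
  qed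
  have "emeasure lborel S = emeasure lborel ?U"
  proof -
    have m: "S - ?U \<in> sets borel" by (intro sets.Diff borel_open S open_UN ballI open_ball)
    have "S - ?U \<in> null_sets lborel"
      using C(4) m by (simp add: negligible_iff_null_sets null_sets_completion_iff)
    then have "emeasure lborel (?U \<union> (S - ?U)) = emeasure lborel ?U"
      by (rule emeasure_Un_null_set[rotated]) (simp add: borel_open open_UN)
    moreover have "?U \<union> (S - ?U) = S" using US by blast
    ultimately show ?thesis by simp
  qed
  also have "\<dots> = (\<integral>\<^sup>+i. emeasure lborel (ball (fst i) (snd i)) \<partial>count_space C)"
    by (rule emeasure_UN_countable[OF _ C(1) d1]) auto
  also have "\<dots> = (\<integral>\<^sup>+i. emeasure lborel (ball (\<sigma> (fst i)) (snd i)) \<partial>count_space C)"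
    by (rule nn_integral_cong) (simp add: emeasure_ball pos)
  also have "\<dots> = emeasure lborel ?V"
    by (rule emeasure_UN_countable[OF _ C(1) d2, symmetric]) auto
  also have "\<dots> \<le> emeasure lborel (\<sigma> -` S)"
  proof (rule emeasure_mono)
    have "?V = \<sigma> -` ?U" by (simp add: vimage_UN vim)
    also have "\<dots> \<subseteq> \<sigma> -` S" using US by (rule vimage_mono)
    finally show "?V \<subseteq> \<sigma> -` S" .
    have "continuous_on UNIV \<sigma>" using lin by (rule linear_continuous_on[OF linear_linear[THEN iffD2]])
    then show "\<sigma> -` S \<in> sets lborel" using S by (simp add: open_vimage)
  qed
  finally show ?thesis .
qed

text \<open>Boxes determine Lebesgue measure. Since \<open>\<sigma>\<close> is an involution, the
  one-sided estimate applied to a box and to its preimage gives equality.\<close>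

lemma distr_lborel_isometry:
  fixes \<sigma> :: "'a::euclidean_space \<Rightarrow> 'a"
  assumes lin: "linear \<sigma>" and iso: "\<And>x. norm (\<sigma> x) = norm x" and inv: "\<And>x. \<sigma> (\<sigma> x) = x"
  shows "distr lborel borel \<sigma> = lborel"
proof (rule lborel_eqI[symmetric])
  have cont: "continuous_on UNIV \<sigma>" using lin by (rule linear_continuous_on[OF linear_linear[THEN iffD2]])
  then have meas: "\<sigma> \<in> borel_measurable borel" by (rule borel_measurable_continuous_onI)
  fix l u :: 'a assume lu: "\<And>b. b \<in> Basis \<Longrightarrow> l \<bullet> b \<le> u \<bullet> b"
  have "emeasure (distr lborel borel \<sigma>) (box l u) = emeasure lborel (\<sigma> -` box l u)"
    using meas by (simp add: emeasure_distr)
  also have "\<dots> = emeasure lborel (box l u)"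
  proof (rule antisym)
    show "emeasure lborel (box l u) \<le> emeasure lborel (\<sigma> -` box l u)"
      by (rule emeasure_lborel_isometry_le[OF assms]) auto
    have "emeasure lborel (\<sigma> -` box l u) \<le> emeasure lborel (\<sigma> -` \<sigma> -` box l u)"
      by (rule emeasure_lborel_isometry_le[OF assms]) (rule open_vimage[OF open_box cont])
    moreover have "\<sigma> -` \<sigma> -` box l u = box l u" using inv by auto
    ultimately show "emeasure lborel (\<sigma> -` box l u) \<le> emeasure lborel (box l u)" by simp
  qed
  also have "\<dots> = (\<Prod>b\<in>Basis. (u - l) \<bullet> b)" using lu by (subst emeasure_lborel_box) auto
  finally show "emeasure (distr lborel borel \<sigma>) (box l u) = (\<Prod>b\<in>Basis. (u - l) \<bullet> b)" .
qed simp

section \<open>Invariance and second moments of the sphere measure\<close>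

lemma sets_sphere_measure [measurable_cong, simp]: "sets sphere_measure = sets borel"
  by (simp add: sphere_measure_def)

lemma prob_space_sphere_measure: "prob_space (sphere_measure :: 'a::euclidean_space measure)"
proof -
  have "prob_space (uniform_measure lborel (ball (0::'a) 1))"
    by (rule prob_space_uniform_measure) (auto simp: emeasure_ball ennreal_eq_0_iff not_le unit_ball_vol_pos)
  then show ?thesis unfolding sphere_measure_def
    by (rule prob_space.prob_space_distr) measurable
qed

text \<open>The origin is the only point of the ball that radial projection does not send to the
  sphere, and it is a null set.\<close>

lemma AE_sphere_measure_norm: "AE p in (sphere_measure :: 'a::euclidean_space measure). norm p = 1"
proof -
  have "AE y in lborel. y \<noteq> (0::'a)" by (rule AE_lborel_singleton)
  then have "AE y in uniform_measure lborel (ball (0::'a) 1). y \<noteq> 0"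
    by (intro AE_uniform_measureI) auto
  then show ?thesis unfolding sphere_measure_def
    by (subst AE_distr_iff) (simp_all add: eventually_mono)
qed

text \<open>An isometry preserves the unit ball, hence its uniform measure, and by linearity it
  commutes with radial projection, which carries the invariance over to the sphere.\<close>

lemma distr_sphere_measure_isometry:
  fixes \<sigma> :: "'a::euclidean_space \<Rightarrow> 'a"
  assumes lin: "linear \<sigma>" and iso: "\<And>x. norm (\<sigma> x) = norm x" and inv: "\<And>x. \<sigma> (\<sigma> x) = x"
  shows "distr sphere_measure borel \<sigma> = sphere_measure"
proof -
  have cont: "continuous_on UNIV \<sigma>" using lin by (rule linear_continuous_on[OF linear_linear[THEN iffD2]])
  then have meas[measurable]: "\<sigma> \<in> borel_measurable borel" by (rule borel_measurable_continuous_onI)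
  let ?U = "uniform_measure lborel (ball (0::'a) 1)"
  have U: "distr ?U borel \<sigma> = ?U"
  proof (rule measure_eqI)
    fix A assume "A \<in> sets (distr ?U borel \<sigma>)"
    then have A[measurable]: "A \<in> sets borel" by simp
    have eq: "ball 0 1 \<inter> \<sigma> -` A = \<sigma> -` (ball 0 1 \<inter> A)" by (auto simp: iso)
    have "emeasure (distr ?U borel \<sigma>) A = emeasure ?U (\<sigma> -` A)"
      by (simp add: emeasure_distr)
    also have "\<dots> = emeasure lborel (ball 0 1 \<inter> \<sigma> -` A) / emeasure lborel (ball (0::'a) 1)"
      by (rule emeasure_uniform_measure) (auto intro!: measurable_sets_borel[OF meas])
    also have "emeasure lborel (ball 0 1 \<inter> \<sigma> -` A) = emeasure (distr lborel borel \<sigma>) (ball 0 1 \<inter> A)"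
      by (simp add: eq emeasure_distr)
    also have "\<dots> = emeasure lborel (ball 0 1 \<inter> A)" by (simp add: distr_lborel_isometry[OF assms])
    also have "\<dots> / emeasure lborel (ball (0::'a) 1) = emeasure ?U A"
      by (rule emeasure_uniform_measure[symmetric]) auto
    finally show "emeasure (distr ?U borel \<sigma>) A = emeasure ?U A" .
  qed simp
  have "distr sphere_measure borel \<sigma> = distr ?U borel (\<sigma> \<circ> (\<lambda>y. y /\<^sub>R norm y))"
    unfolding sphere_measure_def by (rule distr_distr) measurable
  also have "\<sigma> \<circ> (\<lambda>y. y /\<^sub>R norm y) = (\<lambda>y. y /\<^sub>R norm y) \<circ> \<sigma>"
    by (auto simp: fun_eq_iff linear_scale[OF lin] iso)
  also have "distr ?U borel ((\<lambda>y. y /\<^sub>R norm y) \<circ> \<sigma>) = distr (distr ?U borel \<sigma>) borel (\<lambda>y. y /\<^sub>R norm y)"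
    by (rule distr_distr[symmetric]) measurable
  also have "\<dots> = sphere_measure" by (simp add: U sphere_measure_def)
  finally show ?thesis .
qed

lemma integral_sphere_measure_isometry:
  fixes \<sigma> :: "'a::euclidean_space \<Rightarrow> 'a" and f :: "'a \<Rightarrow> real"
  assumes "linear \<sigma>" and "\<And>x. norm (\<sigma> x) = norm x" and "\<And>x. \<sigma> (\<sigma> x) = x"
    and f: "f \<in> borel_measurable borel"
  shows "(\<integral>p. f (\<sigma> p) \<partial>sphere_measure) = (\<integral>p. f p \<partial>sphere_measure)"
proof -
  have "continuous_on UNIV \<sigma>" using assms(1) by (rule linear_continuous_on[OF linear_linear[THEN iffD2]])
  then have meas[measurable]: "\<sigma> \<in> borel_measurable borel" by (rule borel_measurable_continuous_onI)
  have "(\<integral>p. f p \<partial>distr sphere_measure borel \<sigma>) = (\<integral>p. f (\<sigma> p) \<partial>sphere_measure)"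
    by (rule integral_distr) (use f in measurable)
  then show ?thesis using distr_sphere_measure_isometry[OF assms(1-3)] by simp
qed

text \<open>For a unit vector \<open>q\<close> this is the Householder reflection. These maps are
  involutions, and one of them exchanges any two given unit vectors, so they can stand in for
  rotations.\<close>

definition reflect :: "'a::euclidean_space \<Rightarrow> 'a \<Rightarrow> 'a" where
  "reflect q p = p - (2 * (p \<bullet> q)) *\<^sub>R q"

lemma reflect_isometry:
  assumes "norm q = 1"
  shows "linear (reflect q)" and "norm (reflect q x) = norm x" and "reflect q (reflect q x) = x"
proof -
  have qq: "q \<bullet> q = 1" using assms by (simp add: dot_square_norm)
  show "linear (reflect q)"
    by (rule linearI) (auto simp: reflect_def inner_add_left algebra_simps)
  have "(norm (reflect q x))\<^sup>2 = (norm x)\<^sup>2"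
    by (simp add: reflect_def power2_norm_eq_inner inner_diff_left inner_diff_right qq inner_commute
        algebra_simps)
  then show "norm (reflect q x) = norm x" by simp
  show "reflect q (reflect q x) = x"
    by (simp add: reflect_def inner_diff_left qq algebra_simps)
qed

lemma integrable_sphere_measure_bounded:
  fixes f :: "'a::euclidean_space \<Rightarrow> 'b::{banach, second_countable_topology}"
  assumes "f \<in> borel_measurable borel" and "\<And>p. norm p = 1 \<Longrightarrow> norm (f p) \<le> B"
  shows "integrable sphere_measure f"
proof -
  interpret prob_space "sphere_measure :: 'a measure" by (rule prob_space_sphere_measure)
  have "AE p in sphere_measure. norm (f p) \<le> B"
    using AE_sphere_measure_norm by eventually_elim (rule assms(2))
  then show ?thesis by (rule integrable_const_bound) (use assms(1) in simp)
qed

text \<open>Reflections make the second moment the same in every unit direction, and over an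
  orthonormal basis the moments add up to the integral of the squared norm, which is 1. This is the
  origin of the dimension factor in \<open>steiner_point\<close>.\<close>

lemma sphere_measure_second_moment:
  fixes q :: "'a::euclidean_space"
  assumes q: "norm q = 1"
  shows "real DIM('a) * (\<integral>p. (q \<bullet> p)\<^sup>2 \<partial>sphere_measure) = 1"
proof -
  interpret prob_space "sphere_measure :: 'a measure" by (rule prob_space_sphere_measure)
  have int: "integrable sphere_measure (\<lambda>p. (b \<bullet> p)\<^sup>2)" for b :: 'a
  proof (rule integrable_sphere_measure_bounded[of _ "(norm b)\<^sup>2"])
    fix p :: 'a assume "norm p = 1"
    then have "\<bar>b \<bullet> p\<bar> \<le> norm b" using Cauchy_Schwarz_ineq2[of b p] by simp
    then show "norm ((b \<bullet> p)\<^sup>2) \<le> (norm b)\<^sup>2" by (simp add: abs_le_square_iff[symmetric])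
  qed measurable
  have same: "(\<integral>p. (b \<bullet> p)\<^sup>2 \<partial>sphere_measure) = (\<integral>p. (q \<bullet> p)\<^sup>2 \<partial>sphere_measure)"
    if b: "b \<in> Basis" for b :: 'a
  proof (cases "b = q")
    case False
    \<comment> \<open>The unit normal of the mirror that exchanges \<open>b\<close> and
      \<open>q\<close>.\<close>
    define w where "w = (b - q) /\<^sub>R norm (b - q)"
    have w: "norm w = 1" using False by (simp add: w_def)
    have bq: "b \<bullet> b = 1" "q \<bullet> q = 1" using b q by (auto simp: dot_square_norm)
    have n2: "(norm (b - q))\<^sup>2 = 2 - 2 * (b \<bullet> q)"
      by (simp add: power2_norm_eq_inner inner_diff_left inner_diff_right bq inner_commute)
    have wb: "w \<bullet> b = (1 - b \<bullet> q) / norm (b - q)"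
      by (simp add: w_def inner_diff_left bq inner_commute[of q b] divide_inverse mult.commute)
    have "reflect w b = b - (2 * (b \<bullet> w) / norm (b - q)) *\<^sub>R (b - q)"
      by (simp add: reflect_def w_def divide_inverse)
    also have "2 * (b \<bullet> w) / norm (b - q) = (2 - 2 * (b \<bullet> q)) / (norm (b - q))\<^sup>2"
      by (simp add: inner_commute[of b w] wb power2_eq_square field_simps)
    also have "\<dots> = 1" unfolding n2[symmetric] using False by simp
    finally have rb: "reflect w b = q" by simp
    have adj: "reflect w x \<bullet> y = x \<bullet> reflect w y" for x y
      by (simp add: reflect_def inner_diff_left inner_diff_right inner_commute)
    have "(\<integral>p. (b \<bullet> p)\<^sup>2 \<partial>sphere_measure) = (\<integral>p. (b \<bullet> reflect w p)\<^sup>2 \<partial>sphere_measure)"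
      by (rule integral_sphere_measure_isometry[OF reflect_isometry[OF w], symmetric]) measurable
    then show ?thesis by (simp add: adj[symmetric] rb)
  qed simp
  have "(\<integral>p. (\<Sum>b\<in>(Basis::'a set). (b \<bullet> p)\<^sup>2) \<partial>sphere_measure) = (\<Sum>b\<in>(Basis::'a set). \<integral>p. (b \<bullet> p)\<^sup>2 \<partial>sphere_measure)"
    by (rule Bochner_Integration.integral_sum) (rule int)
  also have "\<dots> = real DIM('a) * (\<integral>p. (q \<bullet> p)\<^sup>2 \<partial>sphere_measure)"
    by (simp add: same)
  also have "(\<integral>p. (\<Sum>b\<in>(Basis::'a set). (b \<bullet> p)\<^sup>2) \<partial>sphere_measure) = (\<integral>p. 1 \<partial>(sphere_measure :: 'a measure))"
  proof (rule integral_cong_AE)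
    show "AE p in sphere_measure. (\<Sum>b\<in>(Basis::'a set). (b \<bullet> p)\<^sup>2) = 1"
      using AE_sphere_measure_norm
    proof eventually_elim
      case (elim p)
      have "(\<Sum>b\<in>(Basis::'a set). (b \<bullet> p)\<^sup>2) = p \<bullet> p"
        by (subst euclidean_inner) (simp add: power2_eq_square inner_commute)
      then show ?case using elim by (simp add: dot_square_norm)
    qed
  qed measurable
  finally show ?thesis using prob_space by simp
qed

section \<open>Support functions and Steiner points\<close>

definition support_fun :: "'a::euclidean_space set \<Rightarrow> 'a \<Rightarrow> real" where
  "support_fun K p = (SUP y\<in>K. p \<bullet> y)"

lemma support_fun_props:
  fixes K :: "'a::euclidean_space set"
  assumes K: "bounded K" "K \<noteq> {}"
  defines "h \<equiv> support_fun K"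
  shows "\<And>p y. y \<in> K \<Longrightarrow> p \<bullet> y \<le> h p"
    and "\<And>p B. (\<And>y. y \<in> K \<Longrightarrow> p \<bullet> y \<le> B) \<Longrightarrow> h p \<le> B"
    and "\<And>p q. h (p + q) \<le> h p + h q"
    and "\<And>c p. 0 \<le> c \<Longrightarrow> h (c *\<^sub>R p) \<le> c * h p"
    and "h \<in> borel_measurable borel"
    and "\<exists>B. \<forall>p. norm p = 1 \<longrightarrow> \<bar>h p\<bar> \<le> B"
proof -
  obtain B where B: "\<And>y. y \<in> K \<Longrightarrow> norm y \<le> B" using K(1) bounded_iff by blast
  obtain y0 where y0: "y0 \<in> K" using K(2) by blast
  have le: "p \<bullet> y \<le> norm p * B" if "y \<in> K" for p y
    using norm_cauchy_schwarz[of p y] mult_left_mono[OF B[OF that], of "norm p"] by simp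
  have bdd: "bdd_above ((\<bullet>) p ` K)" for p
    using le by (intro bdd_aboveI[of _ "norm p * B"]) auto
  show 1: "p \<bullet> y \<le> h p" if "y \<in> K" for p y unfolding h_def support_fun_def by (rule cSUP_upper[OF that bdd])
  show 2: "h p \<le> C" if "\<And>y. y \<in> K \<Longrightarrow> p \<bullet> y \<le> C" for p C unfolding h_def support_fun_def
    by (rule cSUP_least[OF K(2) that])
  show 3: "h (p + q) \<le> h p + h q" for p q
    by (rule 2) (simp add: inner_add_left 1 add_mono)
  show "h (c *\<^sub>R p) \<le> c * h p" if "0 \<le> c" for c p
    by (rule 2) (simp add: mult_left_mono[OF 1 that])
  have B0: "0 \<le> B" using B[OF y0] norm_ge_zero order_trans by blast
  have hb: "h p \<le> norm p * B" for p by (rule 2) (rule le)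
  \<comment> \<open>Subadditivity turns the growth bound \<open>hb\<close> into a Lipschitz bound,
    from which measurability follows.\<close>
  have lip: "h p - h q \<le> B * norm (p - q)" for p q
    using 3[of "p - q" q] hb[of "p - q"] by (simp add: mult.commute)
  have "B-lipschitz_on UNIV h"
  proof (rule lipschitz_onI[OF _ B0])
    fix p q show "dist (h p) (h q) \<le> B * dist p q"
      using lip[of p q] lip[of q p] by (simp add: dist_norm norm_minus_commute abs_le_iff)
  qed
  then have "continuous_on UNIV h" by (rule lipschitz_on_continuous_on)
  then show "h \<in> borel_measurable borel" by (rule borel_measurable_continuous_onI)
  have "h 0 = 0" using hb[of 0] 1[OF y0, of 0] by simp
  then have "\<bar>h p\<bar> \<le> B" if "norm p = 1" for p
    using hb[of p] lip[of 0 p] that by simp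
  then show "\<exists>B. \<forall>p. norm p = 1 \<longrightarrow> \<bar>h p\<bar> \<le> B" by blast
qed

text \<open>Averaging \<open>h\<^sub>K(p) (q \<bullet> p)\<close> over the reflection of \<open>p\<close> in the hyperplane orthogonal to \<open>q\<close>
  replaces \<open>h\<^sub>K(p)\<close> by a difference that subadditivity bounds by \<open>2 (q \<bullet> p) h\<^sub>K(q)\<close>.\<close>

lemma steiner_point_le_support:
  fixes K :: "'a::euclidean_space set"
  assumes K: "bounded K" "K \<noteq> {}" and q: "norm q = 1"
  shows "q \<bullet> steiner_point K \<le> support_fun K q"
proof -
  define h where "h = support_fun K"
  note h = support_fun_props[OF K, folded h_def]
  note [measurable] = h(5)
  obtain B where B: "\<And>p. norm p = 1 \<Longrightarrow> \<bar>h p\<bar> \<le> B" using h(6) by blast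
  have intv: "integrable sphere_measure (\<lambda>p. h p *\<^sub>R p)"
    by (rule integrable_sphere_measure_bounded[of _ B]) (auto simp: B)
  let ?r = "reflect q"
  note r = reflect_isometry[OF q]
  have rm[measurable]: "?r \<in> borel_measurable borel" unfolding reflect_def by measurable
  have qr: "q \<bullet> ?r p = - (q \<bullet> p)" for p
    using q by (simp add: reflect_def inner_diff_right inner_commute dot_square_norm)
  have qp: "\<bar>q \<bullet> p\<bar> \<le> 1" if "norm p = 1" for p using Cauchy_Schwarz_ineq2[of q p] q that by simp
  have hq: "\<bar>h p1\<bar> * \<bar>q \<bullet> p\<bar> \<le> B" if "norm p1 = 1" "norm p = 1" for p p1
    using mult_mono[OF B[OF that(1)] qp[OF that(2)]] order_trans[OF abs_ge_zero B[OF that(1)]] by simp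
  have i1: "integrable sphere_measure (\<lambda>p. h p * (q \<bullet> p))"
    by (rule integrable_sphere_measure_bounded[of _ B]) (simp_all add: abs_mult hq)
  have i2: "integrable sphere_measure (\<lambda>p. h (?r p) * (q \<bullet> p))"
    by (rule integrable_sphere_measure_bounded[of _ B]) (simp_all add: abs_mult r hq)
  have "\<bar>2 * h q\<bar> * (q \<bullet> p)\<^sup>2 \<le> \<bar>2 * h q\<bar> * 1" if "norm p = 1" for p
    by (rule mult_left_mono) (simp_all add: abs_square_le_1 qp that)
  then have i3: "integrable sphere_measure (\<lambda>p. 2 * h q * (q \<bullet> p)\<^sup>2)"
    by (intro integrable_sphere_measure_bounded[of _ "\<bar>2 * h q\<bar> * 1"]) (simp_all add: abs_mult)
  let ?I = "\<integral>p. h p * (q \<bullet> p) \<partial>sphere_measure"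
  have "?I = (\<integral>p. h (?r p) * (q \<bullet> ?r p) \<partial>sphere_measure)"
    by (rule integral_sphere_measure_isometry[OF r, symmetric]) measurable
  also have "\<dots> = - (\<integral>p. h (?r p) * (q \<bullet> p) \<partial>sphere_measure)" by (simp add: qr)
  finally have "2 * ?I = ?I - (\<integral>p. h (?r p) * (q \<bullet> p) \<partial>sphere_measure)" by simp
  also have "\<dots> = (\<integral>p. h p * (q \<bullet> p) - h (?r p) * (q \<bullet> p) \<partial>sphere_measure)"
    by (simp add: i1 i2)
  also have "\<dots> \<le> (\<integral>p. 2 * h q * (q \<bullet> p)\<^sup>2 \<partial>sphere_measure)"
  proof (rule integral_mono[OF _ i3])
    show "integrable sphere_measure (\<lambda>p. h p * (q \<bullet> p) - h (?r p) * (q \<bullet> p))" using i1 i2 by auto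
    fix p
    \<comment> \<open>Positive homogeneity needs \<open>0 \<le> c\<close>. For
      \<open>q \<bullet> p < 0\<close> the point and its mirror image therefore change roles
      below.\<close>
    have key: "(h p1 - h p2) * c \<le> 2 * h q * c\<^sup>2"
      if "p1 = p2 + (2 * c) *\<^sub>R q" "0 \<le> c" for p1 p2 c
    proof -
      have "h p1 - h p2 \<le> 2 * c * h q" using h(3)[of p2 "(2 * c) *\<^sub>R q"] h(4)[of "2 * c" q] that by simp
      then have "(h p1 - h p2) * c \<le> (2 * c * h q) * c" using that(2) by (rule mult_right_mono)
      then show ?thesis by (simp add: power2_eq_square algebra_simps)
    qed
    show "h p * (q \<bullet> p) - h (?r p) * (q \<bullet> p) \<le> 2 * h q * (q \<bullet> p)\<^sup>2"
    proof (cases "0 \<le> q \<bullet> p")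
      case True
      then show ?thesis using key[of p "?r p" "q \<bullet> p"]
        by (simp add: reflect_def inner_commute algebra_simps)
    next
      case False
      then show ?thesis using key[of "?r p" p "- (q \<bullet> p)"]
        by (simp add: reflect_def inner_commute algebra_simps)
    qed
  qed
  also have "\<dots> = 2 * h q * (\<integral>p. (q \<bullet> p)\<^sup>2 \<partial>sphere_measure)" by simp
  finally have "?I \<le> h q * (\<integral>p. (q \<bullet> p)\<^sup>2 \<partial>sphere_measure)" by simp
  then have "real DIM('a) * ?I \<le> real DIM('a) * (h q * (\<integral>p. (q \<bullet> p)\<^sup>2 \<partial>sphere_measure))"
    by (rule mult_left_mono) simp
  \<comment> \<open>Here the dimension factor cancels the second moment exactly.\<close>
  also have "\<dots> = h q" using sphere_measure_second_moment[OF q] by (simp add: mult.left_commute)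
  also have "real DIM('a) * ?I = q \<bullet> steiner_point K"
    using integral_inner_right[of q sphere_measure "\<lambda>p. h p *\<^sub>R p"] intv
    by (simp add: steiner_point_def h_def support_fun_def)
  finally show ?thesis by (simp add: h_def)
qed

text \<open>A compact convex set is the intersection of its supporting half-spaces, and the support
  inequality puts the Steiner point into each of them.\<close>

lemma steiner_point_mem:
  fixes K :: "'a::euclidean_space set"
  assumes K: "compact K" "convex K" "K \<noteq> {}"
  shows "steiner_point K \<in> K"
proof (rule ccontr)
  assume "steiner_point K \<notin> K"
  then obtain a b where ab: "a \<bullet> steiner_point K < b" "\<And>x. x \<in> K \<Longrightarrow> b < a \<bullet> x"
    using separating_hyperplane_closed_point[OF K(2) compact_imp_closed[OF K(1)]] by blast
  have a: "a \<noteq> 0" using ab K(3) by force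
  \<comment> \<open>The separation bounds \<open>K\<close> from below in direction \<open>a\<close>,
    whereas support functions bound from above; hence the sign.\<close>
  define q where "q = - (a /\<^sub>R norm a)"
  have q: "norm q = 1" using a by (simp add: q_def)
  have bd: "bounded K" using K(1) by (rule compact_imp_bounded)
  have "q \<bullet> steiner_point K \<le> support_fun K q" by (rule steiner_point_le_support[OF bd K(3) q])
  also have "\<dots> \<le> - b / norm a"
  proof (rule support_fun_props(2)[OF bd K(3)])
    fix y assume "y \<in> K"
    then show "q \<bullet> y \<le> - b / norm a" using ab(2)[of y] a by (simp add: q_def field_simps)
  qed
  finally show False using ab(1) a by (simp add: q_def field_simps)
qed

section \<open>Epigraphs of conjugate Hamiltonians\<close>

text \<open>Separating the strict hypograph of the concave minorant from the epigraph of
  \<open>h\<close> gives an affine function between them, and \<open>u\<close> is its slope. Read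
  geometrically, the distance from \<open>q\<close> to the set of linear minorants of
  \<open>h\<close> is decided by inequalities in \<open>p\<close> alone; the later selection and
  measurability arguments rest on this.\<close>

lemma convex_sandwich:
  fixes h :: "'a::euclidean_space \<Rightarrow> real"
  assumes h: "convex_on UNIV h" and d: "0 \<le> d"
    and le: "\<And>p. q \<bullet> p - d * norm p \<le> h p"
  shows "\<exists>u. norm (u - q) \<le> d \<and> (\<forall>p. u \<bullet> p \<le> h p)"
proof -
  let ?S = "{z::'a \<times> real. snd z < q \<bullet> fst z - d * norm (fst z)}"
  let ?T = "{z::'a \<times> real. h (fst z) \<le> snd z}"
  have cS: "convex ?S"
  proof (rule convexI)
    fix x y :: "'a \<times> real" and u v :: real
    assume xy: "x \<in> ?S" "y \<in> ?S" and uv: "0 \<le> u" "0 \<le> v" "u + v = 1"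
    have "norm (u *\<^sub>R fst x + v *\<^sub>R fst y) \<le> u * norm (fst x) + v * norm (fst y)"
      using norm_triangle_ineq[of "u *\<^sub>R fst x" "v *\<^sub>R fst y"] uv by simp
    then have 1: "d * norm (u *\<^sub>R fst x + v *\<^sub>R fst y) \<le> d * (u * norm (fst x) + v * norm (fst y))"
      by (rule mult_left_mono[OF _ d])
    have "u * snd x + v * snd y < u * (q \<bullet> fst x - d * norm (fst x)) + v * (q \<bullet> fst y - d * norm (fst y))"
    proof (cases "u = 0")
      case True then show ?thesis using uv xy by auto
    next
      case False
      then have "u * snd x < u * (q \<bullet> fst x - d * norm (fst x))" using uv xy by auto
      moreover have "v * snd y \<le> v * (q \<bullet> fst y - d * norm (fst y))" using uv xy by (auto intro!: mult_left_mono)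
      ultimately show ?thesis by linarith
    qed
    then show "u *\<^sub>R x + v *\<^sub>R y \<in> ?S" using 1 by (simp add: inner_add_right algebra_simps)
  qed
  have cT: "convex ?T"
  proof (rule convexI)
    fix x y :: "'a \<times> real" and u v :: real
    assume xy: "x \<in> ?T" "y \<in> ?T" and uv: "0 \<le> u" "0 \<le> v" "u + v = 1"
    have "h (u *\<^sub>R fst x + v *\<^sub>R fst y) \<le> u * h (fst x) + v * h (fst y)"
      using h uv unfolding convex_on_def by auto
    also have "\<dots> \<le> u * snd x + v * snd y" using xy uv by (auto intro!: add_mono mult_left_mono)
    finally show "u *\<^sub>R x + v *\<^sub>R y \<in> ?T" by simp
  qed
  have "(0, -1) \<in> ?S" "(0, h 0) \<in> ?T" by auto
  then have ne: "?S \<noteq> {}" "?T \<noteq> {}" by blast+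
  have disj: "?S \<inter> ?T = {}" 
  proof -
    have False if "z \<in> ?S" "z \<in> ?T" for z using that le[of "fst z"] by simp
    then show ?thesis by blast
  qed
  obtain a b where ab: "a \<noteq> 0" "\<And>x. x \<in> ?S \<Longrightarrow> a \<bullet> x \<le> b" "\<And>x. x \<in> ?T \<Longrightarrow> b \<le> a \<bullet> x"
    using separating_hyperplane_sets[OF cS cT ne disj] by blast
  define w where "w = fst a"
  define s where "s = snd a"
  have S: "w \<bullet> p + s * r \<le> b" if "r < q \<bullet> p - d * norm p" for p r
    using ab(2)[of "(p, r)"] that by (simp add: w_def s_def inner_prod_def)
  have T: "b \<le> w \<bullet> p + s * r" if "h p \<le> r" for p r
    using ab(3)[of "(p, r)"] that by (simp add: w_def s_def inner_prod_def)
  \<comment> \<open>The hyperplane is not vertical: \<open>s < 0\<close> is impossible since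
    \<open>?S\<close> is unbounded downwards, and \<open>s = 0\<close> since both sets project onto
    the whole space of momenta.\<close>
  have s0: "s > 0"
  proof (rule ccontr)
    assume "\<not> s > 0"
    then consider "s < 0" | "s = 0" by linarith
    then show False
    proof cases
      case 1
      have "w \<bullet> 0 + s * (- 1 - \<bar>b\<bar> / (- s)) \<le> b" using 1 by (intro S) (auto simp: divide_nonneg_neg intro: less_le_trans[of _ 0])
      moreover have "s * (- 1 - \<bar>b\<bar> / (- s)) = - s + \<bar>b\<bar>" using 1 by (simp add: right_diff_distrib)
      ultimately have "- s + \<bar>b\<bar> \<le> b" by simp
      then show False using 1 by linarith
    next
      case 2
      have "w \<bullet> w \<le> b" using S[of "q \<bullet> w - d * norm w - 1" w] 2 by simp
      moreover have "b \<le> 0" using T[of 0 "h 0"] 2 by simp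
      ultimately have "w = 0" by (meson inner_ge_zero inner_eq_zero_iff order_trans antisym)
      then show False using ab(1) 2 by (simp add: w_def s_def prod_eq_iff)
    qed
  qed
  define u where "u = - (w /\<^sub>R s)"
  define \<beta> where "\<beta> = b / s"
  have S': "q \<bullet> p - d * norm p - u \<bullet> p \<le> \<beta>" for p
  proof (rule dense_le)
    fix y assume y: "y < q \<bullet> p - d * norm p - u \<bullet> p"
    have "w \<bullet> p + s * (y + u \<bullet> p) \<le> b" by (rule S) (use y in simp)
    then show "y \<le> \<beta>" using s0 by (simp add: u_def \<beta>_def field_simps)
  qed
  have T': "\<beta> \<le> h p - u \<bullet> p" for p
    using T[of p "h p"] s0 by (simp add: u_def \<beta>_def field_simps)
  have b0: "0 \<le> \<beta>" using S'[of 0] by simp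
  have "norm (u - q) \<le> d"
  proof (rule ccontr)
    assume "\<not> norm (u - q) \<le> d"
    then have gt: "d < norm (u - q)" by simp
    define n where "n = norm (u - q)"
    have n0: "0 < n" "0 < n - d" using gt d by (auto simp: n_def intro: le_less_trans)
    then have n: "0 < n * (n - d)" by (rule mult_pos_pos)
    \<comment> \<open>If \<open>u\<close> were farther than \<open>d\<close> from \<open>q\<close>,
      the left-hand side of \<open>S'\<close> at \<open>l *\<^sub>R (q - u)\<close> would be
      \<open>l * n * (n - d)\<close>. This \<open>l\<close> makes it
      \<open>\<beta> + 1\<close>.\<close>
    define l where "l = (\<beta> + 1) / (n * (n - d))"
    have l: "0 < l" using b0 n by (simp add: l_def)
    have nn: "(q - u) \<bullet> (q - u) = n * n" by (simp add: n_def norm_minus_commute dot_square_norm power2_eq_square)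
    have 1: "(q - u) \<bullet> (l *\<^sub>R (q - u)) - d * norm (l *\<^sub>R (q - u)) \<le> \<beta>"
      using S'[of "l *\<^sub>R (q - u)"] by (simp only: inner_diff_left)
    have 2: "norm (l *\<^sub>R (q - u)) = l * n" using l by (simp add: n_def norm_minus_commute)
    have 3: "(q - u) \<bullet> (l *\<^sub>R (q - u)) = l * (n * n)" using nn by simp
    have "l * (n * n) - d * (l * n) \<le> \<beta>" using 1 unfolding 2 3 .
    then have "l * (n * (n - d)) \<le> \<beta>" by (simp add: algebra_simps)
    moreover have "l * (n * (n - d)) = \<beta> + 1" unfolding l_def using n by (metis less_irrefl nonzero_eq_divide_eq)
    ultimately show False by simp
  qed
  moreover have "u \<bullet> p \<le> h p" for p using T'[of p] b0 by linarith
  ultimately show ?thesis by blast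
qed

lemma mem_ham_epi: "(v, r) \<in> ham_epi H t x \<longleftrightarrow> (\<forall>p. v \<bullet> p - H t x p \<le> r)"
  by (auto simp: ham_epi_def ham_conj_def SUP_le_iff)

lemma closed_ham_epi: "closed (ham_epi H t x)"
proof -
  have "ham_epi H t x = (\<Inter>p. {z. fst z \<bullet> p - H t x p \<le> snd z})"
    by (auto simp: mem_ham_epi)
  also have "closed \<dots>" by (intro closed_INT ballI closed_Collect_le continuous_intros)
  finally show ?thesis .
qed

lemma convex_ham_epi: "convex (ham_epi H t x)"
proof (rule convexI)
  fix y z and u v :: real
  assume yz: "y \<in> ham_epi H t x" "z \<in> ham_epi H t x" and uv: "0 \<le> u" "0 \<le> v" "u + v = 1"
  obtain y1 y2 z1 z2 where eq: "y = (y1, y2)" "z = (z1, z2)" by fastforce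
  have "(u *\<^sub>R y1 + v *\<^sub>R z1) \<bullet> p - H t x p \<le> u * y2 + v * z2" for p
  proof -
    have "u * (y1 \<bullet> p - H t x p) \<le> u * y2" "v * (z1 \<bullet> p - H t x p) \<le> v * z2"
      using yz uv by (auto simp: eq mem_ham_epi intro!: mult_left_mono)
    moreover have "H t x p = u * H t x p + v * H t x p" using uv by (simp flip: distrib_right)
    ultimately show ?thesis by (simp add: inner_add_left algebra_simps)
  qed
  then show "u *\<^sub>R y + v *\<^sub>R z \<in> ham_epi H t x" by (simp add: eq mem_ham_epi)
qed

text \<open>The sandwich around slope 0 with width \<open>L\<close> gives a subgradient of
  \<open>H t x\<close> at 0, where the conjugate is at most \<open>- H t x 0\<close>.\<close>

lemma ham_epi_nonempty:
  assumes cv: "convex_on UNIV (H t x)" and lip: "\<And>p q. \<bar>H t x p - H t x q\<bar> \<le> L * norm (p - q)" and L: "0 \<le> L"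
  shows "ham_epi H t x \<noteq> {}"
proof -
  have "convex_on UNIV (\<lambda>p. H t x p - H t x 0)"
    using convex_on_add[OF cv, of "\<lambda>_. - H t x 0"] by (simp add: convex_on_const)
  moreover have "0 \<bullet> p - L * norm p \<le> H t x p - H t x 0" for p using lip[of p 0] by simp
  ultimately obtain u where "\<forall>p. u \<bullet> p \<le> H t x p - H t x 0" using convex_sandwich L by blast
  then have "(u, - H t x 0) \<in> ham_epi H t x" by (auto simp: mem_ham_epi algebra_simps)
  then show ?thesis by blast
qed

text \<open>The enlarged ball contains a nearest point of the epigraph, so
  \<open>steiner_Phi\<close> is nonempty, convex and compact and therefore contains its Steiner
  point.\<close>

lemma steiner_representation_mem:
  assumes "convex_on UNIV (H t x)" and "\<And>p q. \<bar>H t x p - H t x q\<bar> \<le> L * norm (p - q)" and "0 \<le> L"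
  shows "(steiner_f H t x a, steiner_l H t x a) \<in> ham_epi H t x"
proof -
  let ?E = "ham_epi H t x"
  have ne: "?E \<noteq> {}" by (rule ham_epi_nonempty[of H t x L]) (use assms in auto)
  obtain z where z: "z \<in> ?E" "infdist a ?E = dist a z"
    using infdist_attains_inf[OF closed_ham_epi ne] by blast
  have "z \<in> steiner_Phi H t x a" using z by (simp add: steiner_Phi_def)
  moreover have "compact (steiner_Phi H t x a)" unfolding steiner_Phi_def
    by (simp add: closed_Int_compact closed_ham_epi)
  moreover have "convex (steiner_Phi H t x a)" unfolding steiner_Phi_def
    by (simp add: convex_Int convex_ham_epi)
  ultimately have "steiner_point (steiner_Phi H t x a) \<in> steiner_Phi H t x a"
    by (intro steiner_point_mem) auto
  then show ?thesis by (simp add: steiner_f_def steiner_l_def steiner_Phi_def)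
qed

text \<open>At distance zero the ball shrinks to a point. Hence every pair of velocity and cost rate
  in the epigraph can serve as its own control.\<close>

lemma steiner_representation_fixed:
  assumes "a \<in> ham_epi H t x"
  shows "steiner_f H t x a = fst a" "steiner_l H t x a = snd a"
proof -
  have "steiner_Phi H t x a = {a}" using assms by (auto simp: steiner_Phi_def)
  then have "steiner_point (steiner_Phi H t x a) = a" using steiner_point_mem[of "{a}"] by auto
  then show "steiner_f H t x a = fst a" "steiner_l H t x a = snd a"
    by (auto simp: steiner_f_def steiner_l_def)
qed

section \<open>Absolutely continuous functions\<close>

text \<open>Translates the indexed families of intervals in \<open>abs_continuous_on\<close> into
  the tagged partial divisions of gauge integration.\<close>

lemma abs_continuous_on_tagged_sum:
  assumes AC: "\<forall>(m::nat) (a'::nat \<Rightarrow> real) b'.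
        (\<forall>k<m. a' k \<le> b' k \<and> {a' k..b' k} \<subseteq> {a..b}) \<longrightarrow>
        (\<forall>j<m. \<forall>k<m. j \<noteq> k \<longrightarrow> b' j \<le> a' k \<or> b' k \<le> a' j) \<longrightarrow>
        (\<Sum>k<m. b' k - a' k) < \<delta> \<longrightarrow>
        (\<Sum>k<m. norm (x (b' k) - x (a' k))) < \<epsilon>"
    and D: "D tagged_partial_division_of {a..b}" and small: "(\<Sum>(t,K)\<in>D. measure lborel K) < \<delta>"
  shows "(\<Sum>(t,K)\<in>D. norm (x (Sup K) - x (Inf K))) < \<epsilon>"
proof -
  have fD: "finite D" using D by (rule tagged_partial_division_ofD)
  have int: "\<exists>c d. K = {c..d} \<and> c \<le> d \<and> {c..d} \<subseteq> {a..b}" if tK: "(t,K) \<in> D" for t K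
  proof -
    obtain c d where "K = cbox c d" using tagged_partial_division_ofD(4)[OF D tK] by blast
    moreover have "t \<in> K" "K \<subseteq> {a..b}" using tagged_partial_division_ofD(2,3)[OF D tK] by auto
    ultimately show ?thesis by (intro exI[of _ c] exI[of _ d]) auto
  qed
  \<comment> \<open>Degenerate intervals are dropped: a single point may lie inside another interval
    of \<open>D\<close>, which violates the order condition of \<open>abs_continuous_on\<close>.
    Their increments vanish anyway.\<close>
  define D' where "D' = {z\<in>D. Inf (snd z) < Sup (snd z)}"
  have fD': "finite D'" "D' \<subseteq> D" using fD by (auto simp: D'_def)
  obtain h where h: "bij_betw h {0..<card D'} D'" using ex_bij_betw_nat_finite[OF fD'(1)] by blast
  define m where "m = card D'"
  define a' where "a' k = Inf (snd (h k))" for k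
  define b' where "b' k = Sup (snd (h k))" for k
  have hD: "h k \<in> D'" if "k < m" for k using h that by (auto simp: m_def bij_betw_def)
  have K: "snd (h k) = {a' k..b' k}" "a' k < b' k" "{a' k..b' k} \<subseteq> {a..b}" if k: "k < m" for k
  proof -
    have "(fst (h k), snd (h k)) \<in> D" using hD[OF k] fD'(2) by auto
    then obtain c d where cd: "snd (h k) = {c..d}" "c \<le> d" "{c..d} \<subseteq> {a..b}" using int by blast
    then have "a' k = c" "b' k = d" by (simp_all add: a'_def b'_def)
    then show "snd (h k) = {a' k..b' k}" "{a' k..b' k} \<subseteq> {a..b}" using cd by auto
    show "a' k < b' k" using hD[OF k] by (simp add: D'_def a'_def b'_def)
  qed
  have "b' j \<le> a' k \<or> b' k \<le> a' j" if jk: "j < m" "k < m" "j \<noteq> k" for j k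
  proof (rule ccontr)
    assume "\<not> (b' j \<le> a' k \<or> b' k \<le> a' j)"
    then have "max (a' j) (a' k) < min (b' j) (b' k)" using K(2) jk by auto
    then obtain y where "max (a' j) (a' k) < y" "y < min (b' j) (b' k)" using dense by blast
    then have y: "y \<in> interior (snd (h j)) \<inter> interior (snd (h k))"
      using K(1) jk by (auto simp: interior_atLeastAtMost_real)
    have "h j \<noteq> h k" using h jk by (auto simp: bij_betw_def m_def inj_on_def)
    then have "interior (snd (h j)) \<inter> interior (snd (h k)) = {}"
      using tagged_partial_division_ofD(5)[OF D, of "fst (h j)" "snd (h j)" "fst (h k)" "snd (h k)"]
        hD jk fD'(2) by (auto simp: prod_eq_iff)
    then show False using y by blast
  qed
  then have nov: "\<forall>j<m. \<forall>k<m. j \<noteq> k \<longrightarrow> b' j \<le> a' k \<or> b' k \<le> a' j" by blast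
  have sum: "(\<Sum>k<m. f (snd (h k))) = (\<Sum>(t,K)\<in>D'. f K)" for f :: "real set \<Rightarrow> real"
    using sum.reindex_bij_betw[OF h, of "\<lambda>(t,K). f K"] by (simp add: m_def lessThan_atLeast0 case_prod_beta)
  have "(\<Sum>k<m. b' k - a' k) = (\<Sum>k<m. measure lborel (snd (h k)))"
    using K(1,2) by (intro sum.cong) (auto simp: less_imp_le)
  also have "\<dots> = (\<Sum>(t,K)\<in>D'. measure lborel K)" by (rule sum)
  also have "\<dots> \<le> (\<Sum>(t,K)\<in>D. measure lborel K)" using fD fD' by (intro sum_mono2) auto
  also have "\<dots> < \<delta>" by (rule small)
  finally have "(\<Sum>k<m. norm (x (b' k) - x (a' k))) < \<epsilon>"
    using K(2,3) by (intro AC[THEN spec, THEN spec, THEN spec, THEN mp, THEN mp, THEN mp] nov) (simp_all add: less_imp_le)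
  then have "(\<Sum>(t,K)\<in>D'. norm (x (Sup K) - x (Inf K))) < \<epsilon>"
    using sum[of "\<lambda>K. norm (x (Sup K) - x (Inf K))"] by (simp add: a'_def b'_def)
  moreover have "(\<Sum>(t,K)\<in>D. norm (x (Sup K) - x (Inf K))) = (\<Sum>(t,K)\<in>D'. norm (x (Sup K) - x (Inf K)))"
  proof (rule sum.mono_neutral_right[OF fD fD'(2)], clarify)
    fix t K assume tK: "(t,K) \<in> D" and n: "(t,K) \<notin> D'"
    obtain c d where "K = {c..d}" "c \<le> d" using int[OF tK] by blast
    then show "norm (x (Sup K) - x (Inf K)) = 0" using n tK by (auto simp: D'_def)
  qed
  ultimately show ?thesis by simp
qed

text \<open>The tags in the exceptional null set \<open>N\<close> are forced into an open set of small measure, where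
  absolute continuity controls the increments; the remaining tags are handled by the straddle lemma.\<close>

lemma fundamental_theorem_of_calculus_abs_continuous:
  fixes x :: "real \<Rightarrow> 'b::euclidean_space"
  assumes AC: "abs_continuous_on {a..b} x" and ab: "a \<le> b" and N: "negligible N"
    and der: "\<And>t. t \<in> {a..b} - N \<Longrightarrow> (x has_vector_derivative v t) (at t within {a..b})"
  shows "(v has_integral (x b - x a)) {a..b}"
proof -
  \<comment> \<open>With \<open>v\<close> replaced by 0 on \<open>N\<close>, the terms tagged in
    \<open>N\<close> consist of increments of \<open>x\<close> only.\<close>
  define w where "w t = (if t \<in> N then 0 else v t)" for t
  have "(w has_integral (x b - x a)) {a..b}" unfolding has_integral_real
  proof (intro allI impI)
    fix e :: real assume e: "0 < e"
    obtain \<delta> where \<delta>: "0 < \<delta>" and ACd: "\<forall>(m::nat) (a'::nat \<Rightarrow> real) b'.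
        (\<forall>k<m. a' k \<le> b' k \<and> {a' k..b' k} \<subseteq> {a..b}) \<longrightarrow>
        (\<forall>j<m. \<forall>k<m. j \<noteq> k \<longrightarrow> b' j \<le> a' k \<or> b' k \<le> a' j) \<longrightarrow>
        (\<Sum>k<m. b' k - a' k) < \<delta> \<longrightarrow>
        (\<Sum>k<m. norm (x (b' k) - x (a' k))) < e / 2"
      using AC[unfolded abs_continuous_on_def, THEN spec, THEN mp, OF half_gt_zero[OF e]]
      by (elim exE conjE) (rule that)
    have Nl: "N \<in> sets lebesgue" "emeasure lebesgue N = 0" using N by (auto simp: negligible_iff_null_sets)
    obtain U where U: "open U" "N \<subseteq> U" "U - N \<in> lmeasurable" "emeasure lebesgue (U - N) < ennreal \<delta>"
      using sets_lebesgue_outer_open[OF Nl(1) \<delta>] by blast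
    have Uem: "emeasure lebesgue U < ennreal \<delta>"
    proof -
      have "U = (U - N) \<union> N" using U(2) by blast
      moreover have "emeasure lebesgue ((U - N) \<union> N) = emeasure lebesgue (U - N)"
        using U(3) N by (intro emeasure_Un_null_set) (auto simp: negligible_iff_null_sets)
      ultimately show ?thesis using U(4) by simp
    qed
    \<comment> \<open>Slope error for which the remaining tags contribute less than
      \<open>e / 2\<close> in total; the \<open>+ 1\<close> covers \<open>a = b\<close>.\<close>
    define \<eta> where "\<eta> = e / (2 * (b - a + 1))"
    have \<eta>: "0 < \<eta>" "\<eta> * (b - a) < e / 2" using e ab by (auto simp: \<eta>_def field_simps)
    have "\<exists>r>0. (t \<in> N \<longrightarrow> ball t r \<subseteq> U) \<and>
        (t \<in> {a..b} - N \<longrightarrow> (\<forall>y\<in>{a..b}. \<bar>y - t\<bar> < r \<longrightarrow> norm (x y - x t - (y - t) *\<^sub>R v t) \<le> \<eta> * \<bar>y - t\<bar>))" for t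
    proof (cases "t \<in> N")
      case True
      then show ?thesis using U by (meson DiffD2 openE subsetD)
    next
      case False
      show ?thesis
      proof (cases "t \<in> {a..b}")
        case True
        have "(x has_derivative (\<lambda>h. h *\<^sub>R v t)) (at t within {a..b})"
          using der[of t] True False by (simp add: has_vector_derivative_def)
        then obtain r where "0 < r" "\<forall>y\<in>{a..b}. norm (y - t) < r \<longrightarrow> norm (x y - x t - (y - t) *\<^sub>R v t) \<le> \<eta> * norm (y - t)"
          unfolding has_derivative_within_alt using \<eta>(1) by meson
        then show ?thesis using False by auto
      qed (use False in \<open>auto intro: exI[of _ 1]\<close>)
    qed
    then obtain r where r: "\<And>t. 0 < r t" "\<And>t. t \<in> N \<Longrightarrow> ball t (r t) \<subseteq> U"
      "\<And>t y. \<lbrakk>t \<in> {a..b} - N; y \<in> {a..b}; \<bar>y - t\<bar> < r t\<rbrakk> \<Longrightarrow> norm (x y - x t - (y - t) *\<^sub>R v t) \<le> \<eta> * \<bar>y - t\<bar>"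
      by metis
    show "\<exists>\<gamma>. gauge \<gamma> \<and> (\<forall>\<D>. \<D> tagged_division_of {a..b} \<and> \<gamma> fine \<D> \<longrightarrow>
        norm ((\<Sum>(t,K)\<in>\<D>. measure lborel K *\<^sub>R w t) - (x b - x a)) < e)"
    proof (intro exI[of _ "\<lambda>t. ball t (r t)"] conjI allI impI)
      show "gauge (\<lambda>t. ball t (r t))" using r(1) by (auto simp: gauge_def)
      fix D assume "D tagged_division_of {a..b} \<and> (\<lambda>t. ball t (r t)) fine D"
      then have D: "D tagged_division_of {a..b}" and fine: "\<And>t K. (t,K) \<in> D \<Longrightarrow> K \<subseteq> ball t (r t)"
        by (auto simp: fine_def)
      have fD: "finite D" using D by auto
      have Dp: "D tagged_partial_division_of {a..b}" using D by (simp add: tagged_division_of_def)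
      define DN where "DN = {z\<in>D. fst z \<in> N}"
      define DM where "DM = {z\<in>D. fst z \<notin> N}"
      have DNM: "D = DN \<union> DM" "DN \<inter> DM = {}" "finite DN" "finite DM" using fD by (auto simp: DN_def DM_def)
      have DNp: "DN tagged_partial_division_of {a..b}"
        using Dp by (rule tagged_partial_division_subset) (auto simp: DN_def)
      have "(\<Sum>(t,K)\<in>DN. measure lborel K) = (\<Sum>K\<in>snd ` DN. measure lborel K)"
        by (rule sum.over_tagged_division_lemma[OF tagged_partial_division_of_Union_self[OF DNp]])
           (simp add: content_eq_0_interior)
      also have "\<dots> = (\<Sum>K\<in>snd ` DN. measure lebesgue K)"
      proof (rule sum.cong)
        fix K assume "K \<in> snd ` DN"
        then obtain t where "(t,K) \<in> DN" by force
        then obtain c d where "K = cbox c d" using tagged_partial_division_ofD(4)[OF DNp] by blast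
        then show "measure lborel K = measure lebesgue K" by simp
      qed simp
      also have "\<dots> = measure lebesgue (\<Union>(snd ` DN))"
        by (rule content_division[OF partial_division_of_tagged_division[OF DNp]])
      also have "\<dots> < \<delta>"
      proof -
        have sub: "\<Union>(snd ` DN) \<subseteq> U"
        proof -
          have "K \<subseteq> U" if "(t,K) \<in> DN" for t K using that fine[of t K] r(2)[of t] by (force simp: DN_def)
          then show ?thesis
            by (intro Union_least) force
        qed
        have "emeasure lebesgue (\<Union>(snd ` DN)) \<le> emeasure lebesgue U"
          by (rule emeasure_mono[OF sub]) (use U(1) in \<open>simp add: borel_open\<close>)
        also note Uem
        finally have "emeasure lebesgue (\<Union>(snd ` DN)) < ennreal \<delta>" .
        moreover have "\<Union>(snd ` DN) \<in> lmeasurable"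
          by (rule lmeasurable_division[OF partial_division_of_tagged_division[OF DNp]])
        ultimately show ?thesis using \<delta> by (simp add: emeasure_eq_measure2 ennreal_less_iff)
      qed
      finally have "(\<Sum>(t,K)\<in>DN. norm (x (Sup K) - x (Inf K))) < e / 2"
        by (rule abs_continuous_on_tagged_sum[OF ACd DNp])
      moreover have "norm (measure lborel K *\<^sub>R w t - (x (Sup K) - x (Inf K))) = norm (x (Sup K) - x (Inf K))"
        if "(t,K) \<in> DN" for t K
        using that by (simp add: w_def DN_def norm_minus_commute)
      ultimately have 1: "(\<Sum>(t,K)\<in>DN. norm (measure lborel K *\<^sub>R w t - (x (Sup K) - x (Inf K)))) < e / 2"
        by (simp add: case_prod_beta)
      have "norm (measure lborel K *\<^sub>R w t - (x (Sup K) - x (Inf K))) \<le> \<eta> * measure lborel K" if tK: "(t,K) \<in> DM" for t K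
      proof -
        have tKD: "(t,K) \<in> D" "t \<notin> N" using tK by (auto simp: DM_def)
        obtain c d where cd: "K = cbox c d" using tagged_division_ofD(4)[OF D tKD(1)] by blast
        have t: "t \<in> K" "K \<subseteq> {a..b}" using tagged_division_ofD(2,3)[OF D tKD(1)] by auto
        have le: "c \<le> t" "t \<le> d" "c \<in> K" "d \<in> K" using t cd by auto
        have tab: "t \<in> {a..b} - N" using t tKD by blast
        have c: "norm (x c - x t - (c - t) *\<^sub>R v t) \<le> \<eta> * \<bar>c - t\<bar>"
          using fine[OF tKD(1)] le t by (intro r(3)[OF tab]) (auto simp: dist_real_def subset_iff abs_minus_commute)
        have d: "norm (x d - x t - (d - t) *\<^sub>R v t) \<le> \<eta> * \<bar>d - t\<bar>"
          using fine[OF tKD(1)] le t by (intro r(3)[OF tab]) (auto simp: dist_real_def subset_iff abs_minus_commute)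
        \<comment> \<open>The tag cuts \<open>K\<close> into two pieces, and differentiability at
          the tag controls the increment over each.\<close>
        have "measure lborel K *\<^sub>R w t - (x (Sup K) - x (Inf K)) =
            (x c - x t - (c - t) *\<^sub>R v t) - (x d - x t - (d - t) *\<^sub>R v t)"
          using le tKD by (simp add: cd w_def algebra_simps)
        also have "norm \<dots> \<le> \<eta> * \<bar>c - t\<bar> + \<eta> * \<bar>d - t\<bar>" by (rule order_trans[OF norm_triangle_ineq4 add_mono[OF c d]])
        also have "\<dots> = \<eta> * measure lborel K" using le by (simp add: cd algebra_simps)
        finally show ?thesis .
      qed
      then have "(\<Sum>(t,K)\<in>DM. norm (measure lborel K *\<^sub>R w t - (x (Sup K) - x (Inf K)))) \<le> (\<Sum>(t,K)\<in>DM. \<eta> * measure lborel K)"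
        by (intro sum_mono) auto
      also have "\<dots> \<le> (\<Sum>(t,K)\<in>D. \<eta> * measure lborel K)"
        using fD \<eta>(1) by (intro sum_mono2) (auto simp: DM_def)
      also have "\<dots> = \<eta> * (\<Sum>(t,K)\<in>D. measure lborel K)" by (simp add: sum_distrib_left case_prod_beta)
      also have "(\<Sum>(t,K)\<in>D. measure lborel K) = b - a"
        using additive_content_tagged_division[of D a b] D ab by simp
      also note \<eta>(2)
      finally have 2: "(\<Sum>(t,K)\<in>DM. norm (measure lborel K *\<^sub>R w t - (x (Sup K) - x (Inf K)))) < e / 2" .
      have "(\<Sum>(t,K)\<in>D. measure lborel K *\<^sub>R w t) - (x b - x a)
          = (\<Sum>(t,K)\<in>D. measure lborel K *\<^sub>R w t - (x (Sup K) - x (Inf K)))"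
        unfolding additive_tagged_division_1[OF ab D, symmetric] by (simp add: sum_subtractf case_prod_beta)
      also have "norm \<dots> \<le> (\<Sum>(t,K)\<in>D. norm (measure lborel K *\<^sub>R w t - (x (Sup K) - x (Inf K))))"
        by (rule order_trans[OF norm_sum]) (simp add: case_prod_beta)
      also have "\<dots> = (\<Sum>(t,K)\<in>DN. norm (measure lborel K *\<^sub>R w t - (x (Sup K) - x (Inf K)))) +
          (\<Sum>(t,K)\<in>DM. norm (measure lborel K *\<^sub>R w t - (x (Sup K) - x (Inf K))))"
        by (subst DNM(1), rule sum.union_disjoint) (use DNM in auto)
      also have "\<dots> < e" using 1 2 by linarith
      finally show "norm ((\<Sum>(t,K)\<in>D. measure lborel K *\<^sub>R w t) - (x b - x a)) < e" .
    qed
  qed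
  then show ?thesis by (rule has_integral_spike[OF N, rotated]) (simp add: w_def)
qed

lemma sum_integral_nonoverlapping_le:
  fixes G :: "real \<Rightarrow> real"
  assumes G: "G integrable_on {a..b}" and G0: "\<And>t. t \<in> {a..b} \<Longrightarrow> 0 \<le> G t"
    and I: "\<And>k. k < m \<Longrightarrow> {a' k..b' k} \<subseteq> {a..b}"
    and dis: "\<And>j k. \<lbrakk>j < m; k < m; j \<noteq> k\<rbrakk> \<Longrightarrow> b' j \<le> a' k \<or> b' k \<le> a' j"
  shows "(\<Sum>k<m::nat. integral {a' k..b' k} G) \<le> integral {a..b} G"
proof -
  \<comment> \<open>Open intervals, so that a shared end point is not counted twice and at most one
    interval contains a given \<open>t\<close>.\<close>
  let ?g = "\<lambda>k t. if t \<in> {a' k<..<b' k} then G t else 0"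
  have sub: "{a' k<..<b' k} \<subseteq> {a..b}" if "k < m" for k using I[OF that] greaterThanLessThan_subseteq_atLeastAtMost_iff by fastforce
  have gi: "G integrable_on {a' k<..<b' k}" if "k < m" for k
    using integrable_subinterval_real[OF G I[OF that]] integrable_on_Icc_iff_Ioo by blast
  have gI: "?g k integrable_on {a..b}" "integral {a..b} (?g k) = integral {a' k..b' k} G" if "k < m" for k
    using sub[OF that] gi[OF that]
    by (simp_all only: Henstock_Kurzweil_Integration.integrable_restrict_Int
        Henstock_Kurzweil_Integration.integral_restrict_Int inf_absorb1 integral_open_interval_real)
  have "(\<Sum>k<m. integral {a' k..b' k} G) = (\<Sum>k<m. integral {a..b} (?g k))"
    using gI(2) by (intro sum.cong) auto
  also have "\<dots> = integral {a..b} (\<lambda>t. \<Sum>k<m. ?g k t)"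
    by (rule Henstock_Kurzweil_Integration.integral_sum[symmetric]) (use gI(1) in auto)
  also have "\<dots> \<le> integral {a..b} G"
  proof (rule integral_le[OF _ G])
    show "(\<lambda>t. \<Sum>k<m. ?g k t) integrable_on {a..b}"
      by (rule Henstock_Kurzweil_Integration.integrable_sum) (use gI(1) in auto)
    fix t assume t: "t \<in> {a..b}"
    let ?A = "{k\<in>{..<m}. t \<in> {a' k<..<b' k}}"
    have "card ?A \<le> Suc 0" using dis by (subst card_le_Suc0_iff_eq) force+
    then have "real (card ?A) * G t \<le> 1 * G t" using G0[OF t] by (intro mult_right_mono) auto
    then show "(\<Sum>k<m. ?g k t) \<le> G t" by (simp add: sum.inter_filter[symmetric])
  qed
  finally show ?thesis .
qed

text \<open>Cut \<open>norm (v t)\<close> at height \<open>n\<close>. By dominated convergence the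
  excess has integral below \<open>\<epsilon> / 2\<close> for some \<open>n\<close>, while the
  bounded part contributes at most \<open>n\<close> times the total length of the intervals.\<close>

lemma abs_continuous_on_indefinite_integral:
  fixes v :: "real \<Rightarrow> 'b::euclidean_space"
  assumes v: "v absolutely_integrable_on {a..b}"
  shows "abs_continuous_on {a..b} (\<lambda>t. integral {a..t} v)"
  unfolding abs_continuous_on_def
proof (intro allI impI)
  fix \<epsilon> :: real assume e: "0 < \<epsilon>"
  define g where "g t = norm (v t)" for t
  have g: "g absolutely_integrable_on {a..b}" unfolding g_def using v by (rule absolutely_integrable_norm[unfolded comp_def])
  have gi: "g integrable_on {a..b}" using g by (rule set_lebesgue_integral_eq_integral)
  have mi: "(\<lambda>t. min (g t) (real n)) integrable_on {a..b}" for n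
    using absolutely_integrable_min_1[OF g, of "\<lambda>_. real n"] by (auto intro: set_lebesgue_integral_eq_integral(1))
  define G where "G n t = g t - min (g t) (real n)" for n t
  have Gi: "G n integrable_on {a..b}" for n unfolding G_def using gi mi by (rule Henstock_Kurzweil_Integration.integrable_diff)
  have "(\<lambda>n. integral {a..b} (G n)) \<longlonglongrightarrow> integral {a..b} (\<lambda>_. 0)"
  proof (rule dominated_convergence(2)[OF Gi gi])
    show "norm (G n t) \<le> g t" for n t by (auto simp: G_def g_def)
    show "(\<lambda>n. G n t) \<longlonglongrightarrow> 0" for t
    proof (rule tendsto_eventually)
      show "\<forall>\<^sub>F n in sequentially. G n t = 0"
        using eventually_ge_at_top[of "nat \<lceil>g t\<rceil>"] by eventually_elim (simp add: G_def nat_le_iff ceiling_le_iff)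
    qed
  qed
  then have "\<forall>\<^sub>F n in sequentially. integral {a..b} (G n) < \<epsilon> / 2" by (rule order_tendstoD) (use e in simp)
  then obtain n where n: "integral {a..b} (G n) < \<epsilon> / 2" by (auto simp: eventually_sequentially)
  show "\<exists>\<delta>>0. \<forall>(m::nat) a' b'. (\<forall>k<m. a' k \<le> b' k \<and> {a' k..b' k} \<subseteq> {a..b}) \<longrightarrow>
          (\<forall>j<m. \<forall>k<m. j \<noteq> k \<longrightarrow> b' j \<le> a' k \<or> b' k \<le> a' j) \<longrightarrow>
          (\<Sum>k<m. b' k - a' k) < \<delta> \<longrightarrow>
          (\<Sum>k<m. norm (integral {a..b' k} v - integral {a..a' k} v)) < \<epsilon>"
  proof (intro exI[of _ "\<epsilon> / (2 * (real n + 1))"] conjI allI impI)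
    show "0 < \<epsilon> / (2 * (real n + 1))" using e by simp
    fix m :: nat and a' b' :: "nat \<Rightarrow> real"
    assume I: "\<forall>k<m. a' k \<le> b' k \<and> {a' k..b' k} \<subseteq> {a..b}"
      and dis: "\<forall>j<m. \<forall>k<m. j \<noteq> k \<longrightarrow> b' j \<le> a' k \<or> b' k \<le> a' j"
      and small: "(\<Sum>k<m. b' k - a' k) < \<epsilon> / (2 * (real n + 1))"
    have le: "norm (integral {a..b' k} v - integral {a..a' k} v) \<le> integral {a' k..b' k} (G n) + real n * (b' k - a' k)"
      if k: "k < m" for k
    proof -
      have sub: "{a' k..b' k} \<subseteq> {a..b}" "a' k \<le> b' k" using I k by auto
      then have o: "a \<le> a' k" "b' k \<le> b" by auto
      have vi: "v integrable_on {a..b' k}"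
        by (rule integrable_subinterval_real[of _ a b]) (use v o in \<open>auto intro: set_lebesgue_integral_eq_integral(1)\<close>)
      have "integral {a..b' k} v - integral {a..a' k} v = integral {a' k..b' k} v"
        using Henstock_Kurzweil_Integration.integral_combine[OF o(1) sub(2) vi] by (simp add: algebra_simps)
      also have "norm \<dots> \<le> integral {a' k..b' k} g"
        using absolutely_integrable_on_subinterval[OF v sub(1)] integrable_subinterval_real[OF gi sub(1)]
        by (intro integral_norm_bound_integral) (auto simp: g_def intro: set_lebesgue_integral_eq_integral(1))
      also have "\<dots> = integral {a' k..b' k} (\<lambda>t. G n t + min (g t) (real n))" by (simp add: G_def)
      also have "\<dots> = integral {a' k..b' k} (G n) + integral {a' k..b' k} (\<lambda>t. min (g t) (real n))"
        using integrable_subinterval_real[OF Gi sub(1)] integrable_subinterval_real[OF mi sub(1)]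
        by (rule Henstock_Kurzweil_Integration.integral_add)
      also have "integral {a' k..b' k} (\<lambda>t. min (g t) (real n)) \<le> integral {a' k..b' k} (\<lambda>t. real n)"
        by (rule integral_le) (auto intro: integrable_subinterval_real[OF mi sub(1)])
      finally show ?thesis using sub by (simp add: mult.commute)
    qed
    have "(\<Sum>k<m. norm (integral {a..b' k} v - integral {a..a' k} v)) \<le> (\<Sum>k<m. integral {a' k..b' k} (G n) + real n * (b' k - a' k))"
      by (intro sum_mono le) auto
    also have "\<dots> = (\<Sum>k<m. integral {a' k..b' k} (G n)) + real n * (\<Sum>k<m. b' k - a' k)"
      by (simp add: sum.distrib sum_distrib_left)
    also have "(\<Sum>k<m. integral {a' k..b' k} (G n)) \<le> integral {a..b} (G n)"
      using I dis by (intro sum_integral_nonoverlapping_le Gi) (auto simp: G_def)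
    also have "real n * (\<Sum>k<m. b' k - a' k) \<le> real n * (\<epsilon> / (2 * (real n + 1)))"
      using small by (intro mult_left_mono) auto
    also have "\<dots> \<le> \<epsilon> / 2" using e by (simp add: field_simps)
    finally show "(\<Sum>k<m. norm (integral {a..b' k} v - integral {a..a' k} v)) < \<epsilon>" using n by simp
  qed
qed

lemma abs_continuous_on_subset: "abs_continuous_on S x \<Longrightarrow> T \<subseteq> S \<Longrightarrow> abs_continuous_on T x"
  unfolding abs_continuous_on_def
  by (elim all_forward imp_forward ex_forward conj_forward) (assumption | erule (1) subset_trans)+

lemma abs_continuous_on_lipschitz_compose:
  fixes f :: "'a::real_normed_vector \<Rightarrow> 'b::real_normed_vector"
  assumes AC: "abs_continuous_on S x" and f: "L-lipschitz_on (x ` S) f"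
  shows "abs_continuous_on S (\<lambda>t. f (x t))"
  unfolding abs_continuous_on_def
proof (intro allI impI)
  fix \<epsilon> :: real assume e: "0 < \<epsilon>"
  have L: "0 \<le> L" using f by (rule lipschitz_on_nonneg)
  then have "0 < \<epsilon> / (L + 1)" using e by simp
  then obtain \<delta> where d: "0 < \<delta>" "\<forall>(m::nat) a b. (\<forall>k<m. a k \<le> b k \<and> {a k..b k} \<subseteq> S) \<longrightarrow>
        (\<forall>j<m. \<forall>k<m. j \<noteq> k \<longrightarrow> b j \<le> a k \<or> b k \<le> a j) \<longrightarrow> (\<Sum>k<m. b k - a k) < \<delta> \<longrightarrow>
        (\<Sum>k<m. norm (x (b k) - x (a k))) < \<epsilon> / (L + 1)"
    using AC[unfolded abs_continuous_on_def, THEN spec[of _ "\<epsilon> / (L + 1)"]]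
    by (elim impE exE conjE) (assumption, rule that)
  show "\<exists>\<delta>>0. \<forall>(m::nat) a b. (\<forall>k<m. a k \<le> b k \<and> {a k..b k} \<subseteq> S) \<longrightarrow>
          (\<forall>j<m. \<forall>k<m. j \<noteq> k \<longrightarrow> b j \<le> a k \<or> b k \<le> a j) \<longrightarrow>
          (\<Sum>k<m. b k - a k) < \<delta> \<longrightarrow> (\<Sum>k<m. norm (f (x (b k)) - f (x (a k)))) < \<epsilon>"
  proof (intro exI[of _ \<delta>] conjI allI impI d(1))
    fix m :: nat and a b :: "nat \<Rightarrow> real"
    assume *: "\<forall>k<m. a k \<le> b k \<and> {a k..b k} \<subseteq> S"
        "\<forall>j<m. \<forall>k<m. j \<noteq> k \<longrightarrow> b j \<le> a k \<or> b k \<le> a j" "(\<Sum>k<m. b k - a k) < \<delta>"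
    have "norm (f (x (b k)) - f (x (a k))) \<le> (L + 1) * norm (x (b k) - x (a k))" if "k < m" for k
    proof -
      have "{a k..b k} \<subseteq> S" "a k \<le> b k" using * that by auto
      then have "norm (f (x (b k)) - f (x (a k))) \<le> L * norm (x (b k) - x (a k))"
        using lipschitz_onD[OF f, of "x (b k)" "x (a k)"] by (auto simp: dist_norm subset_iff)
      then show ?thesis by (simp add: algebra_simps add_increasing)
    qed
    then have "(\<Sum>k<m. norm (f (x (b k)) - f (x (a k)))) \<le> (L + 1) * (\<Sum>k<m. norm (x (b k) - x (a k)))"
      unfolding sum_distrib_left by (intro sum_mono) auto
    also have "\<dots> < (L + 1) * (\<epsilon> / (L + 1))" using d(2)[rule_format, of m a b] * L by (intro mult_strict_left_mono) auto
    finally show "(\<Sum>k<m. norm (f (x (b k)) - f (x (a k)))) < \<epsilon>" using L by simp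
  qed
qed

text \<open>Averages to the right of almost every point converge, both for \<open>V\<close> and for
  its reflection. The first gives the right derivative, the second the left one. The end points join
  the null set because the derivative is two-sided.\<close>

lemma indefinite_integral_has_vector_derivative_AE:
  fixes v :: "real \<Rightarrow> 'b::euclidean_space"
  assumes v: "v integrable_on {a..b}"
  shows "\<exists>N. negligible N \<and> (\<forall>t\<in>{a..b} - N. ((\<lambda>t. integral {a..t} v) has_vector_derivative v t) (at t))"
proof -
  define V where "V t = (if t \<in> {a..b} then v t else 0)" for t
  have V_eq: "V = (\<lambda>t. if t \<in> {a..b} then v t else 0)" by (rule ext) (rule V_def)
  have VU: "V integrable_on UNIV"
    unfolding V_eq Henstock_Kurzweil_Integration.integrable_restrict_UNIV by (rule v)
  have Vi: "V integrable_on {c..d}" for c d using integrable_on_subcbox[OF VU, of c d] by simp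
  have Wi: "(\<lambda>t. V (- t)) integrable_on {c..d}" for c d
    using Vi[of "-d" "-c"] Henstock_Kurzweil_Integration.integrable_reflect_real[of V "-c" "-d"] by simp
  obtain N1 where N1: "negligible N1" "\<And>x e. \<lbrakk>x \<notin> N1; 0 < e\<rbrakk> \<Longrightarrow> \<exists>d>0. \<forall>h. 0 < h \<and> h < d \<longrightarrow>
       norm(integral {x..x+h} V /\<^sub>R h - V x) < e"
    using integrable_ccontinuous_explicit[of V] Vi by auto
  obtain N2 where N2: "negligible N2" "\<And>x e. \<lbrakk>x \<notin> N2; 0 < e\<rbrakk> \<Longrightarrow> \<exists>d>0. \<forall>h. 0 < h \<and> h < d \<longrightarrow>
       norm(integral {x..x+h} (\<lambda>t. V (- t)) /\<^sub>R h - V (- x)) < e"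
    using integrable_ccontinuous_explicit[of "\<lambda>t. V (- t)"] Wi by auto
  have refl: "integral {-x..-x+h} (\<lambda>t. V (- t)) = integral {x-h..x} V" for x h :: real
    using Henstock_Kurzweil_Integration.integral_reflect_real[of x "x-h" V] by simp
  define N where "N = N1 \<union> uminus ` N2 \<union> {a, b}"
  have "negligible N" unfolding N_def
    using N1(1) negligible_differentiable_image_negligible[OF _ N2(1), of uminus]
    by (auto simp: differentiable_on_def intro!: derivative_intros negligible_Un)
  moreover have "((\<lambda>t. integral {a..t} v) has_vector_derivative v t) (at t)" if t: "t \<in> {a..b} - N" for t
  proof -
    have ab: "a < t" "t < b" using t by (auto simp: N_def)
    have tN: "t \<notin> N1" "- t \<notin> N2" using t by (auto simp: N_def image_iff)
    have Vt: "V t = v t" using ab by (simp add: V_def)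
    have comb: "integral {a..s} v - integral {a..r} v = integral {r..s} V" if "a \<le> r" "r \<le> s" "s \<le> b" for r s
    proof -
      have "v integrable_on {a..s}" using that by (intro integrable_subinterval_real[OF v]) auto
      then have "integral {a..s} v - integral {a..r} v = integral {r..s} v"
        using Henstock_Kurzweil_Integration.integral_combine[of a r s v] that by (simp add: algebra_simps)
      also have "\<dots> = integral {r..s} V"
        by (rule Henstock_Kurzweil_Integration.integral_cong) (use that in \<open>auto simp: V_def\<close>)
      finally show ?thesis .
    qed
    show ?thesis unfolding has_vector_derivative_def has_derivative_at_alt
    proof (intro conjI allI impI)
      show "bounded_linear (\<lambda>h. h *\<^sub>R v t)" by (rule bounded_linear_scaleR_left)
      fix e :: real assume e: "0 < e"
      obtain d1 where d1: "0 < d1" "\<And>h. \<lbrakk>0 < h; h < d1\<rbrakk> \<Longrightarrow> norm(integral {t..t+h} V /\<^sub>R h - V t) < e"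
        using N1(2)[OF tN(1) e] by auto
      obtain d2 where d2: "0 < d2" "\<And>h. \<lbrakk>0 < h; h < d2\<rbrakk> \<Longrightarrow> norm(integral {t-h..t} V /\<^sub>R h - V t) < e"
        using N2(2)[OF tN(2) e] unfolding refl minus_minus by blast
      have scale: "norm (I - h *\<^sub>R V t) \<le> e * h" if "0 < h" "norm (I /\<^sub>R h - V t) < e" for h and I :: 'b
      proof -
        have "I - h *\<^sub>R V t = h *\<^sub>R (I /\<^sub>R h - V t)" using that by (simp add: scaleR_diff_right)
        then have "norm (I - h *\<^sub>R V t) = h * norm (I /\<^sub>R h - V t)" using that by simp
        then show ?thesis using that by simp
      qed
      show "\<exists>d>0. \<forall>y. norm (y - t) < d \<longrightarrow> norm (integral {a..y} v - integral {a..t} v - (y - t) *\<^sub>R v t) \<le> e * norm (y - t)"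
      proof (intro exI[of _ "min (min d1 d2) (min (t - a) (b - t))"] conjI allI impI)
        show "0 < min (min d1 d2) (min (t - a) (b - t))" using d1 d2 ab by simp
        fix y assume y: "norm (y - t) < min (min d1 d2) (min (t - a) (b - t))"
        consider "y = t" | "t < y" | "y < t" by linarith
        then show "norm (integral {a..y} v - integral {a..t} v - (y - t) *\<^sub>R v t) \<le> e * norm (y - t)"
        proof cases
          case 1 then show ?thesis by simp
        next
          case 2
          have "norm (integral {t..t + (y - t)} V - (y - t) *\<^sub>R V t) \<le> e * (y - t)"
            by (rule scale, use 2 in simp, rule d1(2)) (use 2 y in auto)
          moreover have "integral {a..y} v - integral {a..t} v = integral {t..y} V"
            by (rule comb) (use 2 y ab in auto)
          ultimately show ?thesis using 2 by (simp add: Vt)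
        next
          case 3
          have "norm (integral {t - (t - y)..t} V - (t - y) *\<^sub>R V t) \<le> e * (t - y)"
            by (rule scale, use 3 in simp, rule d2(2)) (use 3 y in auto)
          moreover have "integral {a..t} v - integral {a..y} v = integral {y..t} V"
            by (rule comb) (use 3 y ab in auto)
          then have "integral {a..y} v - integral {a..t} v - (y - t) *\<^sub>R v t = - (integral {y..t} V - (t - y) *\<^sub>R V t)"
            by (simp add: Vt algebra_simps)
          ultimately show ?thesis using 3 by (simp add: norm_minus_commute[of "integral {y..t} V"])
        qed
      qed
    qed
  qed
  ultimately show ?thesis by blast
qed

text \<open>The exponential is Lipschitz on the bounded range of \<open>C\<close>, so
  \<open>exp (l * C \<tau>)\<close> is absolutely continuous and is recovered from its derivative
  almost everywhere.\<close>

lemma integral_exp_indefinite_integral: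
  fixes c :: "real \<Rightarrow> real"
  assumes c: "c absolutely_integrable_on {a..b}" and st: "a \<le> s" "s \<le> t" "t \<le> b" and l: "l \<noteq> 0"
  defines "C \<equiv> \<lambda>t. integral {a..t} c"
  shows "((\<lambda>\<tau>. c \<tau> * exp (l * C \<tau>)) has_integral (exp (l * C t) - exp (l * C s)) / l) {s..t}"
proof -
  have ci: "c integrable_on {a..b}" using c by (rule set_lebesgue_integral_eq_integral)
  have AC: "abs_continuous_on {a..b} C" unfolding C_def using c by (rule abs_continuous_on_indefinite_integral)
  have "continuous_on {a..b} C" unfolding C_def using ci by (rule indefinite_integral_continuous_1)
  then have "bounded (C ` {a..b})" by (intro compact_imp_bounded compact_continuous_image) auto
  then obtain B where B: "\<And>y. y \<in> C ` {a..b} \<Longrightarrow> \<bar>y\<bar> \<le> B" by (metis bounded_real)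
  have "(\<bar>l\<bar> * exp (\<bar>l\<bar> * B))-lipschitz_on {-B..B} (\<lambda>y. exp (l * y))"
  proof (rule bounded_derivative_imp_lipschitz)
    fix y assume y: "y \<in> {-B..B}"
    show "((\<lambda>y. exp (l * y)) has_derivative (\<lambda>h. h * (l * exp (l * y)))) (at y within {-B..B})"
      by (auto intro!: derivative_eq_intros simp: fun_eq_iff)
    have "l * y \<le> \<bar>l\<bar> * \<bar>y\<bar>" by (metis abs_ge_self abs_mult)
    also have "\<dots> \<le> \<bar>l\<bar> * B" using y by (intro mult_left_mono) auto
    finally have "exp (l * y) \<le> exp (\<bar>l\<bar> * B)" by simp
    moreover have "onorm (\<lambda>h. h * (l * exp (l * y))) = \<bar>l * exp (l * y)\<bar>"
      using onorm_scaleR_left[of "\<lambda>x::real. x" "l * exp (l * y)"] by (simp add: bounded_linear_ident onorm_id)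
    ultimately show "onorm (\<lambda>h. h * (l * exp (l * y))) \<le> \<bar>l\<bar> * exp (\<bar>l\<bar> * B)"
      by (simp add: abs_mult mult_left_mono)
  qed auto
  then have "(\<bar>l\<bar> * exp (\<bar>l\<bar> * B))-lipschitz_on (C ` {a..b}) (\<lambda>y. exp (l * y))"
    by (rule lipschitz_on_subset) (use B in \<open>simp add: subset_eq abs_le_iff minus_le_iff\<close>)
  then have AC': "abs_continuous_on {s..t} (\<lambda>\<tau>. exp (l * C \<tau>))"
    by (intro abs_continuous_on_subset[OF abs_continuous_on_lipschitz_compose[OF AC]]) (use st in auto)
  obtain N where N: "negligible N" "\<And>\<tau>. \<tau> \<in> {a..b} - N \<Longrightarrow> (C has_vector_derivative c \<tau>) (at \<tau>)"
    using indefinite_integral_has_vector_derivative_AE[OF ci] unfolding C_def by blast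
  have "((\<lambda>\<tau>. l * (c \<tau> * exp (l * C \<tau>))) has_integral (exp (l * C t) - exp (l * C s))) {s..t}"
  proof (rule fundamental_theorem_of_calculus_abs_continuous[OF AC' st(2) N(1)])
    fix \<tau> assume "\<tau> \<in> {s..t} - N"
    then have "(C has_real_derivative c \<tau>) (at \<tau>)" using N(2)[of \<tau>] st by (simp add: has_real_derivative_iff_has_vector_derivative)
    then have "((\<lambda>\<tau>. exp (l * C \<tau>)) has_real_derivative l * (c \<tau> * exp (l * C \<tau>))) (at \<tau>)"
      by (auto intro!: derivative_eq_intros)
    then show "((\<lambda>\<tau>. exp (l * C \<tau>)) has_vector_derivative l * (c \<tau> * exp (l * C \<tau>))) (at \<tau> within {s..t})"
      by (simp add: has_real_derivative_iff_has_vector_derivative has_vector_derivative_at_within)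
  qed
  from has_integral_mult_right[OF this, of "1 / l"] show ?thesis using l by simp
qed

section \<open>Trajectories of the epigraph inclusion\<close>

lemma AE_lebesgue_on_iff_negligible:
  assumes "S \<in> sets lebesgue"
  shows "(AE t in lebesgue_on S. P t) \<longleftrightarrow> (\<exists>N. negligible N \<and> (\<forall>t\<in>S - N. P t))"
proof -
  have "(AE t in lebesgue_on S. P t) \<longleftrightarrow> (AE t in lebesgue. t \<in> S \<longrightarrow> P t)"
    using assms by (subst AE_restrict_space_iff) auto
  also have "\<dots> \<longleftrightarrow> (\<exists>N\<in>null_sets lebesgue. {t. \<not> (t \<in> S \<longrightarrow> P t)} \<subseteq> N)"
    by (simp add: eventually_ae_filter)
  also have "\<dots> \<longleftrightarrow> (\<exists>N. negligible N \<and> (\<forall>t\<in>S - N. P t))"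
    by (auto simp: negligible_iff_null_sets subset_eq)
  finally show ?thesis .
qed

lemma absolutely_integrable_on_iff_integrable:
  fixes f :: "'a::euclidean_space \<Rightarrow> 'b::euclidean_space"
  assumes "S \<in> sets lebesgue"
  shows "f absolutely_integrable_on S \<longleftrightarrow> integrable (lebesgue_on S) f"
  using assms by (simp add: set_integrable_def integrable_restrict_space)

lemma abs_continuous_on_cong_diff:
  assumes AC: "abs_continuous_on S y" and eq: "\<And>s t. s \<in> S \<Longrightarrow> t \<in> S \<Longrightarrow> x s - x t = y s - y t"
  shows "abs_continuous_on S x"
  unfolding abs_continuous_on_def
proof (intro allI impI)
  fix \<epsilon> :: real assume e: "0 < \<epsilon>"
  obtain \<delta> where d: "0 < \<delta>" "\<forall>(m::nat) a b. (\<forall>k<m. a k \<le> b k \<and> {a k..b k} \<subseteq> S) \<longrightarrow>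
        (\<forall>j<m. \<forall>k<m. j \<noteq> k \<longrightarrow> b j \<le> a k \<or> b k \<le> a j) \<longrightarrow> (\<Sum>k<m. b k - a k) < \<delta> \<longrightarrow>
        (\<Sum>k<m. norm (y (b k) - y (a k))) < \<epsilon>"
    using AC[unfolded abs_continuous_on_def, THEN spec, THEN mp, OF e] by (elim exE conjE) (rule that)
  show "\<exists>\<delta>>0. \<forall>(m::nat) a b. (\<forall>k<m. a k \<le> b k \<and> {a k..b k} \<subseteq> S) \<longrightarrow>
          (\<forall>j<m. \<forall>k<m. j \<noteq> k \<longrightarrow> b j \<le> a k \<or> b k \<le> a j) \<longrightarrow>
          (\<Sum>k<m. b k - a k) < \<delta> \<longrightarrow> (\<Sum>k<m. norm (x (b k) - x (a k))) < \<epsilon>"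
  proof (intro exI[of _ \<delta>] conjI allI impI d(1))
    fix m :: nat and a b :: "nat \<Rightarrow> real"
    assume *: "\<forall>k<m. a k \<le> b k \<and> {a k..b k} \<subseteq> S"
        "\<forall>j<m. \<forall>k<m. j \<noteq> k \<longrightarrow> b j \<le> a k \<or> b k \<le> a j" "(\<Sum>k<m. b k - a k) < \<delta>"
    have "x (b k) - x (a k) = y (b k) - y (a k)" if "k < m" for k
      using *(1) that by (intro eq) (auto simp: subset_iff)
    then show "(\<Sum>k<m. norm (x (b k) - x (a k))) < \<epsilon>"
      using d(2)[THEN spec, THEN spec, THEN spec, THEN mp, THEN mp, THEN mp, OF *] by simp
  qed
qed

text \<open>The conjugate of a function of growth rate \<open>L\<close> is infinite outside the ball
  of radius \<open>L\<close>: large multiples of \<open>v\<close> as momenta would push the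
  left-hand side of \<open>epi\<close> beyond \<open>r\<close>.\<close>

lemma ham_epi_norm_le:
  fixes h :: "'a::euclidean_space \<Rightarrow> real"
  assumes epi: "\<And>p. v \<bullet> p - h p \<le> r" and lip: "\<And>p. h p \<le> h 0 + L * norm p" and L: "0 \<le> L"
  shows "norm v \<le> L"
proof (rule ccontr)
  assume "\<not> norm v \<le> L"
  then have n: "0 < norm v" "0 < norm v - L" using L by auto
  define s where "s = (\<bar>r + h 0\<bar> + 1) / (norm v * (norm v - L))"
  have s: "0 < s" "s * (norm v * (norm v - L)) = \<bar>r + h 0\<bar> + 1" using n by (auto simp: s_def)
  have "s * (norm v * norm v) - h (s *\<^sub>R v) \<le> r"
    using epi[of "s *\<^sub>R v"] by (simp add: dot_square_norm power2_eq_square)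
  moreover have "h (s *\<^sub>R v) \<le> h 0 + L * (s * norm v)" using lip[of "s *\<^sub>R v"] s(1) by simp
  ultimately have "s * (norm v * (norm v - L)) \<le> r + h 0" by (simp add: algebra_simps)
  then show False using s(2) by linarith
qed

text \<open>Trajectories of the differential inclusion \<open>(x', r) \<in> E(t, x)\<close> on \<open>[t\<^sub>0, T]\<close>, extended to
  \<open>[0, T]\<close> by a constant state and zero cost before \<open>t\<^sub>0\<close>.\<close>

definition traj :: "real \<Rightarrow> (real \<Rightarrow> 'a::euclidean_space \<Rightarrow> 'a \<Rightarrow> real) \<Rightarrow> real \<Rightarrow>
    (real \<Rightarrow> 'a) \<Rightarrow> (real \<Rightarrow> 'a) \<Rightarrow> (real \<Rightarrow> real) \<Rightarrow> bool" where
  "traj T H t0 x v r \<longleftrightarrow>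
     v absolutely_integrable_on {0..T} \<and> r absolutely_integrable_on {0..T} \<and>
     (\<forall>t<t0. v t = 0 \<and> r t = 0) \<and>
     (\<forall>t\<in>{0..T}. x t = x 0 + integral {0..t} v) \<and>
     (\<forall>t\<in>{t0..T}. \<forall>p. v t \<bullet> p - H t (x t) p \<le> r t)"

lemma integral_vanish_before:
  fixes r :: "real \<Rightarrow> 'b::euclidean_space"
  assumes "\<And>t. t < t0 \<Longrightarrow> r t = 0" and "0 \<le> t0"
  shows "integral {0..T} r = integral {t0..T} r"
proof -
  have "integral {t0..T} r = integral ({t0..T} \<inter> {0..T}) r" using assms(2) by (simp add: Int_absorb2)
  also have "\<dots> = integral {0..T} (\<lambda>t. if t \<in> {t0..T} then r t else 0)"
    by (rule Henstock_Kurzweil_Integration.integral_restrict_Int[symmetric])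
  also have "\<dots> = integral {0..T} r"
    by (rule Henstock_Kurzweil_Integration.integral_cong) (use assms in auto)
  finally show ?thesis by simp
qed

text \<open>The pair \<open>(v, r)\<close> is its own control, since the Steiner maps fix points of
  the epigraph. The constraint is asked only off a null set because limits of trajectories are known
  to satisfy it only there.\<close>

lemma value_fun_le_traj:
  fixes H :: "real \<Rightarrow> 'a::euclidean_space \<Rightarrow> 'a \<Rightarrow> real"
  assumes t0: "t0 \<in> {0..T}"
    and v: "v absolutely_integrable_on {0..T}" and r: "r absolutely_integrable_on {0..T}"
    and z: "\<And>t. t < t0 \<Longrightarrow> v t = 0" "\<And>t. t < t0 \<Longrightarrow> r t = 0"
    and x: "\<And>t. t \<in> {0..T} \<Longrightarrow> x t = x 0 + integral {0..t} v"
    and N: "negligible N" "\<And>t p. t \<in> {t0..T} - N \<Longrightarrow> v t \<bullet> p - H t (x t) p \<le> r t"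
  shows "value_fun T g (steiner_f H) (steiner_l H) (t0, x 0) \<le> g (x T) + ereal (integral {0..T} r)"
proof -
  have vi: "v integrable_on {0..T}" using v by (rule set_lebesgue_integral_eq_integral)
  obtain N' where N': "negligible N'"
    "\<And>t. t \<in> {0..T} - N' \<Longrightarrow> ((\<lambda>t. integral {0..t} v) has_vector_derivative v t) (at t)"
    using indefinite_integral_has_vector_derivative_AE[OF vi] by blast
  define a where "a t = (v t, r t)" for t
  have aE: "a t \<in> ham_epi H t (x t)" if "t \<in> {t0..T} - N" for t
    using N(2)[OF that] by (simp add: a_def mem_ham_epi)
  have sub: "{t0..T} \<subseteq> {0..T}" using t0 by auto
  have leb: "{t0..T} \<in> sets lebesgue" by simp
  have 1: "abs_continuous_on {t0..T} x"
  proof (rule abs_continuous_on_cong_diff[OF abs_continuous_on_subset[OF abs_continuous_on_indefinite_integral[OF v] sub]])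
    fix s t assume "s \<in> {t0..T}" "t \<in> {t0..T}"
    then have "x s = x 0 + integral {0..s} v" "x t = x 0 + integral {0..t} v" using x sub by blast+
    then show "x s - x t = integral {0..s} v - integral {0..t} v" by (metis add_diff_cancel_left)
  qed
  have vr: "integrable (lebesgue_on {t0..T}) v" "integrable (lebesgue_on {t0..T}) r"
    using absolutely_integrable_on_subinterval[OF v sub] absolutely_integrable_on_subinterval[OF r sub]
    by (simp_all add: absolutely_integrable_on_iff_integrable)
  have 2: "integrable (lebesgue_on {t0..T}) a"
    using Bochner_Integration.integrable_add[OF integrable_bounded_linear[of "\<lambda>y. (y, 0::real)", OF _ vr(1)]
      integrable_bounded_linear[of "\<lambda>y. (0::'a, y)", OF _ vr(2)]]
    by (simp add: a_def[abs_def] bounded_linear_Pair bounded_linear_ident bounded_linear_zero)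
  have 3: "AE t in lebesgue_on {t0..T}. (x has_vector_derivative steiner_f H t (x t) (a t)) (at t)"
    unfolding AE_lebesgue_on_iff_negligible[OF leb]
  \<comment> \<open>The points 0 and \<open>T\<close> are discarded because the derivative is
    two-sided while the integral formula for \<open>x\<close> is known only on [0, T].\<close>
  proof (intro exI[of _ "N \<union> N' \<union> {0, T}"] conjI ballI)
    show "negligible (N \<union> N' \<union> {0, T})" using N(1) N'(1) by (simp add: negligible_Un)
    fix t assume t: "t \<in> {t0..T} - (N \<union> N' \<union> {0, T})"
    then have t': "t \<in> {0<..<T}" "t \<in> {0..T} - N'" "t \<in> {t0..T} - N" using t0 by auto
    have "((\<lambda>t. x 0 + integral {0..t} v) has_vector_derivative v t) (at t)"
      using has_vector_derivative_add[OF has_vector_derivative_const N'(2)[OF t'(2)]] by simp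
    then have "(x has_vector_derivative v t) (at t)"
      by (rule has_vector_derivative_transform_within_open[OF _ _ t'(1)]) (auto simp: x[symmetric])
    then show "(x has_vector_derivative steiner_f H t (x t) (a t)) (at t)"
      by (simp add: steiner_representation_fixed[OF aE[OF t'(3)]]) (simp add: a_def)
  qed
  have 4: "x t0 = x 0"
  proof -
    have "integral {0..t0} v = integral {t0..t0} v"
      by (rule integral_vanish_before) (use z t0 in auto)
    then have "integral {0..t0} v = 0" by simp
    then show ?thesis using x[OF t0] by (metis add.right_neutral)
  qed
  have mem: "(x, a) \<in> admissible T (steiner_f H) t0 (x 0)"
    using 1 2 3 4 by (simp add: admissible_def)
  have l: "t \<in> {t0..T} - N \<Longrightarrow> steiner_l H t (x t) (a t) = r t" for t
    by (simp add: steiner_representation_fixed[OF aE]) (simp add: a_def)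
  have "(\<lambda>t. steiner_l H t (x t) (a t)) absolutely_integrable_on {t0..T}"
    by (rule absolutely_integrable_spike[OF absolutely_integrable_on_subinterval[OF r sub] N(1) l])
  then have li: "integrable (lebesgue_on {t0..T}) (\<lambda>t. steiner_l H t (x t) (a t))"
    by (simp add: absolutely_integrable_on_iff_integrable)
  have "integral\<^sup>L (lebesgue_on {t0..T}) (\<lambda>t. steiner_l H t (x t) (a t)) = integral {t0..T} (\<lambda>t. steiner_l H t (x t) (a t))"
    by (rule lebesgue_integral_eq_integral[OF li leb])
  also have "\<dots> = integral {t0..T} r" by (rule integral_spike[OF N(1)]) (simp add: l)
  also have "\<dots> = integral {0..T} r" by (rule integral_vanish_before[symmetric]) (use z t0 in auto)
  finally have "run_cost T (steiner_l H) t0 x a = ereal (integral {0..T} r)"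
    using li by (simp add: run_cost_def)
  then show ?thesis unfolding value_fun_def using INF_lower[OF mem, of "\<lambda>xa. g (fst xa T) + run_cost T (steiner_l H) t0 (fst xa) (snd xa)"]
    by simp
qed

text \<open>The converse reduction: for any control, the values of the Steiner maps lie in the
  epigraph at every time, so a competitor for the value function is a trajectory of the inclusion
  after prolongation to [0, T].\<close>

lemma traj_of_value_fun_less:
  fixes H :: "real \<Rightarrow> 'a::euclidean_space \<Rightarrow> 'a \<Rightarrow> real"
  assumes H: "ham_hyps T c k H" and c: "c absolutely_integrable_on {0..T}" and c0: "\<And>t. 0 \<le> c t"
    and t0: "t0 \<in> {0..T}"
    and V: "value_fun T g (steiner_f H) (steiner_l H) (t0, x0) < M"
  obtains x v r where "traj T H t0 x v r" "x 0 = x0" "g (x T) + ereal (integral {0..T} r) < M"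
proof -
  obtain x a where xa: "(x, a) \<in> admissible T (steiner_f H) t0 x0"
    and M: "g (x T) + run_cost T (steiner_l H) t0 x a < M"
    using V unfolding value_fun_def INF_less_iff by auto
  define f where "f t = steiner_f H t (x t) (a t)" for t
  define l where "l = (\<lambda>t. steiner_l H t (x t) (a t))"
  have leb: "{t0..T} \<in> sets lebesgue" by simp
  \<comment> \<open>A nonintegrable cost would make the sum infinite, even for a terminal value
    \<open>-\<infinity>\<close>, by the convention for \<open>ereal\<close> addition.\<close>
  have li: "integrable (lebesgue_on {t0..T}) l"
    using M unfolding run_cost_def l_def by (auto split: if_splits)
  have rc: "run_cost T (steiner_l H) t0 x a = ereal (integral {t0..T} l)"
    using li lebesgue_integral_eq_integral[OF li leb] by (simp add: run_cost_def flip: l_def)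
  have AC: "abs_continuous_on {t0..T} x" and x0: "x t0 = x0" using xa by (auto simp: admissible_def)
  have "AE t in lebesgue_on {t0..T}. (x has_vector_derivative f t) (at t)"
    using xa by (simp add: admissible_def f_def)
  then obtain N where N: "negligible N" "\<And>t. t \<in> {t0..T} - N \<Longrightarrow> (x has_vector_derivative f t) (at t)"
    unfolding AE_lebesgue_on_iff_negligible[OF leb] by blast
  have ftc: "(f has_integral x t - x t0) {t0..t}" if "t \<in> {t0..T}" for t
    by (rule fundamental_theorem_of_calculus_abs_continuous[OF abs_continuous_on_subset[OF AC] _ N(1)])
       (use that in \<open>auto intro!: has_vector_derivative_at_within N(2)\<close>)
  have fi: "f integrable_on {t0..T}" using ftc[of T] t0 by (auto simp: integrable_on_def)
  have lip: "\<bar>H t y p - H t y q\<bar> \<le> c t * (1 + norm y) * norm (p - q)" if "t \<in> {0..T}" for t y p q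
    using H that by (simp add: ham_hyps_def)
  have E: "f t \<bullet> p - H t (x t) p \<le> l t" if "t \<in> {t0..T}" for t p
  proof -
    have "(f t, l t) \<in> ham_epi H t (x t)" unfolding f_def l_def
      by (rule steiner_representation_mem[of _ _ _ "c t * (1 + norm (x t))"])
         (use H that t0 c0 in \<open>auto simp: ham_hyps_def\<close>)
    then show ?thesis by (simp add: mem_ham_epi)
  qed
  have contx: "continuous_on {t0..T} x"
  proof -
    have "continuous_on {t0..T} (\<lambda>t. x t0 + integral {t0..t} f)"
      by (intro continuous_intros indefinite_integral_continuous_1 fi)
    then show ?thesis
      by (rule continuous_on_eq) (simp add: integral_unique[OF ftc])
  qed
  have "bounded (x ` {t0..T})"
    by (intro compact_imp_bounded compact_continuous_image contx) auto
  then obtain B where B: "\<And>t. t \<in> {t0..T} \<Longrightarrow> norm (x t) \<le> B" unfolding bounded_iff by blast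
  \<comment> \<open>The fundamental theorem gives only a gauge integral of \<open>f\<close>; this
    domination makes it absolute.\<close>
  have fc: "norm (f t) \<le> c t * (1 + B)" if t: "t \<in> {t0..T}" for t
  proof -
    have "norm (f t) \<le> c t * (1 + norm (x t))"
    proof (rule ham_epi_norm_le[OF E[OF t]])
      show "H t (x t) p \<le> H t (x t) 0 + c t * (1 + norm (x t)) * norm p" for p
        using lip[of t "x t" p 0] t t0 by auto
    qed (simp add: c0)
    also have "\<dots> \<le> c t * (1 + B)" using B[OF t] c0 by (intro mult_left_mono) auto
    finally show ?thesis .
  qed
  have sub: "{t0..T} \<subseteq> {0..T}" using t0 by auto
  have ci: "(\<lambda>t. c t * (1 + B)) integrable_on {t0..T}"
    using absolutely_integrable_on_subinterval[OF c sub] by (intro integrable_on_mult_left) (rule set_lebesgue_integral_eq_integral)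
  have fa: "f absolutely_integrable_on {t0..T}"
    by (rule absolutely_integrable_integrable_bound[OF fc fi ci])
  have la: "l absolutely_integrable_on {t0..T}" using li by (simp add: absolutely_integrable_on_iff_integrable)
  define v where "v = (\<lambda>t. if t \<in> {t0..T} then f t else 0)"
  define r where "r = (\<lambda>t. if t \<in> {t0..T} then l t else 0)"
  define y where "y t = (if t < t0 then x0 else x t)" for t
  have va: "v absolutely_integrable_on {0..T}"
    using fa unfolding v_def by (intro absolutely_integrable_on_subinterval[where S=UNIV]) (simp_all only: absolutely_integrable_restrict_UNIV subset_UNIV)
  have ra: "r absolutely_integrable_on {0..T}"
    using la unfolding r_def by (intro absolutely_integrable_on_subinterval[where S=UNIV]) (simp_all only: absolutely_integrable_restrict_UNIV subset_UNIV)
  have vint: "integral {0..t} v = integral ({t0..T} \<inter> {0..t}) f" for t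
    unfolding v_def by (rule Henstock_Kurzweil_Integration.integral_restrict_Int)
  have y0: "y 0 = x0" using x0 t0 by (auto simp: y_def)
  have yv: "y t = y 0 + integral {0..t} v" if t: "t \<in> {0..T}" for t
  proof (cases "t < t0")
    case True
    then have "{t0..T} \<inter> {0..t} = {}" by auto
    then show ?thesis using True y0 by (simp add: vint y_def)
  next
    case False
    then have "{t0..T} \<inter> {0..t} = {t0..t}" using t t0 by auto
    then have "integral {0..t} v = x t - x t0" using vint[of t] ftc[of t] False t by (simp add: integral_unique)
    then show ?thesis using False x0 by (simp add: y0) (simp add: y_def)
  qed
  have "traj T H t0 y v r" unfolding traj_def
  proof (intro conjI va ra)
    show "\<forall>t<t0. v t = 0 \<and> r t = 0" by (auto simp: v_def r_def)
    show "\<forall>t\<in>{0..T}. y t = y 0 + integral {0..t} v" using yv by blast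
    show "\<forall>t\<in>{t0..T}. \<forall>p. v t \<bullet> p - H t (y t) p \<le> r t"
      using E by (auto simp: v_def r_def y_def)
  qed
  moreover have "integral {0..T} r = integral {t0..T} l"
    unfolding r_def Henstock_Kurzweil_Integration.integral_restrict_Int using t0 by (simp add: Int_absorb2)
  then have "g (y T) + ereal (integral {0..T} r) < M" using M rc t0 by (simp add: y_def)
  ultimately show thesis using that y0 by blast
qed

section \<open>Gronwall estimates and measurable selections\<close>

lemma absolutely_integrable_mult_continuous:
  fixes c u :: "real \<Rightarrow> real"
  assumes c: "c absolutely_integrable_on {a..b}" and u: "continuous_on {a..b} u"
  shows "(\<lambda>t. c t * u t) absolutely_integrable_on {a..b}"
proof -
  have leb: "{a..b} \<in> sets lebesgue" by simp
  have "bounded (u ` {a..b})" by (intro compact_imp_bounded compact_continuous_image u) auto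
  then obtain B where B: "\<And>t. t \<in> {a..b} \<Longrightarrow> norm (u t) \<le> B" unfolding bounded_iff by blast
  have "c \<in> borel_measurable (lebesgue_on {a..b})"
    using c by (simp add: absolutely_integrable_on_iff_integrable borel_measurable_integrable)
  moreover have "u \<in> borel_measurable (lebesgue_on {a..b})"
    by (rule continuous_imp_measurable_on_sets_lebesgue[OF u leb])
  ultimately have m: "(\<lambda>t. c t * u t) \<in> borel_measurable (lebesgue_on {a..b})" by simp
  have "(\<lambda>t. norm (c t)) integrable_on {a..b}"
    using c absolutely_integrable_on_def by blast
  then have i: "(\<lambda>t. norm (c t) * B) integrable_on {a..b}" by (rule integrable_on_mult_left)
  show ?thesis
    by (rule measurable_bounded_by_integrable_imp_absolutely_integrable[OF m leb i])
       (simp add: abs_mult B[simplified] mult_left_mono)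
qed

text \<open>The rate 2 in the exponent is what gains the factor 1/2: integrating \<open>c\<close>
  against the weight returns at most half of the weight. This closes the Gronwall argument and, in
  the backward form, halves the Filippov defects.\<close>

lemma integral_exp_weight_le:
  fixes c :: "real \<Rightarrow> real"
  assumes c: "c absolutely_integrable_on {0..T}" and t: "t \<in> {0..T}"
  defines "C \<equiv> \<lambda>t. integral {0..t} c"
  shows "integral {0..t} (\<lambda>\<tau>. c \<tau> * exp (2 * C \<tau>)) \<le> exp (2 * C t) / 2"
    and "integral {t..T} (\<lambda>\<tau>. c \<tau> * exp (-2 * C \<tau>)) \<le> exp (-2 * C t) / 2"
proof -
  show "integral {0..t} (\<lambda>\<tau>. c \<tau> * exp (2 * C \<tau>)) \<le> exp (2 * C t) / 2"
    using integral_exp_indefinite_integral[OF c, of 0 t 2] t unfolding C_def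
    by (simp add: integral_unique)
  show "integral {t..T} (\<lambda>\<tau>. c \<tau> * exp (-2 * C \<tau>)) \<le> exp (-2 * C t) / 2"
  proof -
    have "integral {t..T} (\<lambda>\<tau>. c \<tau> * exp (-2 * C \<tau>)) = (exp (-2 * C T) - exp (-2 * C t)) / (-2)"
      unfolding C_def by (rule integral_unique, rule integral_exp_indefinite_integral[OF c]) (use t in auto)
    also have "\<dots> = (exp (-2 * C t) - exp (-2 * C T)) / 2"
      by (metis minus_diff_eq minus_divide_divide)
    also have "\<dots> \<le> exp (-2 * C t) / 2" by simp
    finally show ?thesis .
  qed
qed

text \<open>If the maximum \<open>M\<close> of \<open>u t * exp (-2 * C t)\<close> is positive and
  attained at \<open>s\<close>, the hypothesis gives
  \<open>M * exp (2 * C s) \<le> A + M * exp (2 * C s) / 2\<close>, hence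
  \<open>M \<le> 2 * A\<close>. The constants are not sharp, but \<open>u\<close> is never
  differentiated.\<close>

lemma gronwall_integrable:
  fixes c u :: "real \<Rightarrow> real"
  assumes c: "c absolutely_integrable_on {0..T}" and c0: "\<And>t. 0 \<le> c t"
    and u: "continuous_on {0..T} u" and A: "0 \<le> A"
    and le: "\<And>t. t \<in> {0..T} \<Longrightarrow> u t \<le> A + integral {0..t} (\<lambda>\<tau>. c \<tau> * u \<tau>)" and t: "t \<in> {0..T}"
  shows "u t \<le> 2 * A * exp (2 * integral {0..t} c)"
proof -
  define C where "C t = integral {0..t} c" for t
  have ci: "c integrable_on {0..T}" using c by (rule set_lebesgue_integral_eq_integral)
  have contC: "continuous_on {0..T} C" unfolding C_def by (rule indefinite_integral_continuous_1[OF ci])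
  have "continuous_on {0..T} (\<lambda>t. u t * exp (-2 * C t))" by (intro continuous_intros u contC)
  then obtain s where s: "s \<in> {0..T}" "\<And>t. t \<in> {0..T} \<Longrightarrow> u t * exp (-2 * C t) \<le> u s * exp (-2 * C s)"
    using continuous_attains_sup[of "{0..T}" "\<lambda>t. u t * exp (-2 * C t)"] t by auto
  define M where "M = u s * exp (-2 * C s)"
  have uM: "u t \<le> M * exp (2 * C t)" if "t \<in> {0..T}" for t
  proof -
    have "u t = (u t * exp (-2 * C t)) * exp (2 * C t)" by (simp add: exp_minus)
    also have "\<dots> \<le> M * exp (2 * C t)" using s(2)[OF that] by (intro mult_right_mono) (auto simp: M_def)
    finally show ?thesis .
  qed
  have M2: "M \<le> 2 * A"
  proof (cases "M \<le> 0")
    case True then show ?thesis using A by linarith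
  next
    case False
    have sub: "{0..s} \<subseteq> {0..T}" using s(1) by auto
    have "u s \<le> A + integral {0..s} (\<lambda>\<tau>. c \<tau> * u \<tau>)" by (rule le[OF s(1)])
    also have "integral {0..s} (\<lambda>\<tau>. c \<tau> * u \<tau>) \<le> integral {0..s} (\<lambda>\<tau>. (c \<tau> * exp (2 * C \<tau>)) * M)"
    proof (rule integral_le)
      show "(\<lambda>\<tau>. c \<tau> * u \<tau>) integrable_on {0..s}"
        by (rule integrable_subinterval_real[OF _ sub], rule set_lebesgue_integral_eq_integral, rule absolutely_integrable_mult_continuous[OF c u])
      show "(\<lambda>\<tau>. c \<tau> * exp (2 * C \<tau>) * M) integrable_on {0..s}"
        by (rule integrable_on_mult_left, rule integrable_subinterval_real[OF _ sub], rule set_lebesgue_integral_eq_integral,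
            rule absolutely_integrable_mult_continuous[OF c]) (intro continuous_intros contC)
      fix \<tau> assume "\<tau> \<in> {0..s}"
      then have "u \<tau> \<le> M * exp (2 * C \<tau>)" using sub by (intro uM) auto
      then have "c \<tau> * u \<tau> \<le> c \<tau> * (M * exp (2 * C \<tau>))" by (rule mult_left_mono[OF _ c0])
      then show "c \<tau> * u \<tau> \<le> c \<tau> * exp (2 * C \<tau>) * M" by (simp add: mult_ac)
    qed
    also have "\<dots> = integral {0..s} (\<lambda>\<tau>. c \<tau> * exp (2 * C \<tau>)) * M" by simp
    also have "\<dots> \<le> exp (2 * C s) / 2 * M"
      using integral_exp_weight_le(1)[OF c s(1)] False unfolding C_def by (intro mult_right_mono) auto
    finally have us: "u s \<le> A + exp (2 * C s) / 2 * M" by simp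
    have "u s = M * exp (2 * C s)" by (simp add: M_def exp_minus)
    then have "M * exp (2 * C s) \<le> 2 * A" using us by (simp add: field_simps)
    moreover have "0 \<le> C s" unfolding C_def by (rule integral_nonneg[OF integrable_subinterval_real[OF ci sub]]) (rule c0)
    then have "M * 1 \<le> M * exp (2 * C s)" using False by (intro mult_left_mono) auto
    ultimately show ?thesis by linarith
  qed
  have "u t \<le> M * exp (2 * C t)" by (rule uM[OF t])
  also have "\<dots> \<le> 2 * A * exp (2 * C t)" using M2 by (intro mult_right_mono) auto
  finally show ?thesis by (simp add: C_def)
qed

text \<open>Simple functions approximating \<open>y\<close> reduce the claim to finitely many frozen
  second arguments; continuity passes to the limit.\<close>

lemma borel_measurable_caratheodory:
  fixes h :: "'t \<Rightarrow> 'a::{metric_space, second_countable_topology} \<Rightarrow> real"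
  assumes m: "\<And>x. (\<lambda>t. h t x) \<in> borel_measurable M" and c: "\<And>t. t \<in> space M \<Longrightarrow> continuous_on UNIV (h t)"
    and y: "y \<in> borel_measurable M"
  shows "(\<lambda>t. h t (y t)) \<in> borel_measurable M"
proof -
  obtain F where F: "\<And>i. simple_function M (F i)" "\<And>t. t \<in> space M \<Longrightarrow> (\<lambda>i. F i t) \<longlonglongrightarrow> y t"
    using borel_measurable_implies_sequence_metric[OF y, of undefined] by blast
  show ?thesis
  proof (rule borel_measurable_LIMSEQ_real)
    show "(\<lambda>t. h t (F i t)) \<in> borel_measurable M" for i
    proof (rule measurable_compose_countable'[OF m])
      show "countable (F i ` space M)" using F(1)[of i] by (auto simp: simple_function_def countable_finite)
      then show "F i \<in> measurable M (count_space (F i ` space M))"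
        using F(1)[of i] by (auto simp: simple_function_def measurable_count_space_eq2)
    qed
    fix t assume t: "t \<in> space M"
    have "isCont (h t) (y t)" using c[OF t] by (simp add: continuous_on_eq_continuous_at)
    then show "(\<lambda>i. h t (F i t)) \<longlonglongrightarrow> h t (y t)" by (rule isCont_tendsto_compose[OF _ F(2)[OF t]])
  qed
qed

text \<open>Lets a condition on all momenta be tested on a countable dense set, so that the sets
  defined by it are measurable.\<close>

lemma continuous_le_of_dense:
  fixes f g :: "'a::topological_space \<Rightarrow> real"
  assumes D: "\<And>X. open X \<Longrightarrow> X \<noteq> {} \<Longrightarrow> \<exists>d\<in>D. d \<in> X"
    and f: "continuous_on UNIV f" and g: "continuous_on UNIV g" and le: "\<And>d. d \<in> D \<Longrightarrow> f d \<le> g d"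
  shows "f x \<le> g x"
proof (rule ccontr)
  assume "\<not> f x \<le> g x"
  then have "{y. g y < f y} \<noteq> {}" by (auto simp: not_le)
  moreover have "open {y. g y < f y}" by (rule open_Collect_less[OF g f])
  ultimately obtain d where "d \<in> D" "g d < f d" using D[of "{y. g y < f y}"] by blast
  then show False using le[of d] by simp
qed

text \<open>The projection \<open>P\<close> onto a closed convex set satisfies \<open>\<nabla>(d\<^sup>2/2) = id - P\<close>; as a limit of
  difference quotients of \<open>d\<^sup>2\<close>, the projection inherits measurability from the distance, which by
  \<open>convex_sandwich\<close> is determined by countably many inequalities.\<close>

lemma closest_point_difference_quotient:
  fixes C :: "'a::euclidean_space set"
  assumes C: "closed C" "convex C" "C \<noteq> {}" and b: "norm b = 1" and n: "0 < (n::real)"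
  defines "d \<equiv> \<lambda>q. dist q (closest_point C q)"
  shows "\<bar>n * ((d (v + b /\<^sub>R n))\<^sup>2 - (d v)\<^sup>2) - 2 * (b \<bullet> (v - closest_point C v))\<bar> \<le> 1 / n"
proof -
  define P where "P = closest_point C v"
  define w where "w = v + b /\<^sub>R n"
  define Q where "Q = closest_point C w"
  have PC: "P \<in> C" "Q \<in> C" using closest_point_in_set[OF C(1,3)] by (auto simp: P_def Q_def)
  have bb: "b \<bullet> b = 1" using b by (simp add: dot_square_norm)
  have exp: "(norm (z + b /\<^sub>R n))\<^sup>2 = (norm z)\<^sup>2 + 2 / n * (b \<bullet> z) + 1 / n\<^sup>2" for z
    unfolding power2_norm_eq_inner
    by (simp add: inner_add_left inner_add_right bb inner_commute[of z b] power2_eq_square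
        divide_inverse algebra_simps)
  \<comment> \<open>The upper estimate measures the distance from \<open>w\<close> to the projection
    of \<open>v\<close>, the lower one that from \<open>v\<close> to the projection of
    \<open>w\<close>. The two projections differ by at most \<open>1 / n\<close>, since projection
    is nonexpansive.\<close>
  have "d w \<le> dist w P" unfolding d_def by (rule closest_point_le[OF C(1) PC(1)])
  then have "(d w)\<^sup>2 \<le> (dist w P)\<^sup>2" by (simp add: d_def power_mono)
  also have "\<dots> = (d v)\<^sup>2 + 2 / n * (b \<bullet> (v - P)) + 1 / n\<^sup>2"
    using exp[of "v - P"] by (simp add: d_def P_def w_def dist_norm algebra_simps)
  finally have up: "n * ((d w)\<^sup>2 - (d v)\<^sup>2) - 2 * (b \<bullet> (v - P)) \<le> 1 / n"
    using n by (simp add: field_simps power2_eq_square)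
  have "d v \<le> dist v Q" unfolding d_def by (rule closest_point_le[OF C(1) PC(2)])
  then have "(d v)\<^sup>2 \<le> (dist v Q)\<^sup>2" by (simp add: d_def power_mono)
  moreover have "(d w)\<^sup>2 = (dist v Q)\<^sup>2 + 2 / n * (b \<bullet> (v - Q)) + 1 / n\<^sup>2"
    using exp[of "v - Q"] by (simp add: d_def Q_def w_def dist_norm algebra_simps)
  ultimately have lo: "2 / n * (b \<bullet> (v - Q)) + 1 / n\<^sup>2 \<le> (d w)\<^sup>2 - (d v)\<^sup>2" by linarith
  have "dist P Q \<le> dist v w" unfolding P_def Q_def by (rule closest_point_lipschitz[OF C(2,1,3)])
  also have "\<dots> = 1 / n" using n b by (simp add: w_def dist_norm inverse_eq_divide)
  finally have "norm (Q - P) \<le> 1 / n" by (simp add: dist_norm norm_minus_commute)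
  then have "b \<bullet> (Q - P) \<le> 1 / n" using norm_cauchy_schwarz[of b "Q - P"] b by simp
  then have "b \<bullet> (v - P) - 1 / n \<le> b \<bullet> (v - Q)" by (simp add: inner_diff_right)
  then have "2 / n * (b \<bullet> (v - P) - 1 / n) \<le> 2 / n * (b \<bullet> (v - Q))" using n by (intro mult_left_mono) auto
  then have "2 / n * (b \<bullet> (v - P)) - 1 / n\<^sup>2 \<le> (d w)\<^sup>2 - (d v)\<^sup>2"
    using lo by (simp add: right_diff_distrib power2_eq_square)
  then have "- (1 / n) \<le> n * ((d w)\<^sup>2 - (d v)\<^sup>2) - 2 * (b \<bullet> (v - P))"
    using n by (simp add: field_simps power2_eq_square)
  then show ?thesis using up unfolding P_def w_def by (simp add: abs_le_iff)
qed

text \<open>Taking the nearest point of \<open>C t\<close> makes the selection measurable and, at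
  the same time, as close to \<open>v t\<close> as the sandwich permits.\<close>

lemma measurable_sandwich_selection:
  fixes h :: "'t \<Rightarrow> 'a::euclidean_space \<Rightarrow> real"
  assumes m: "\<And>p. (\<lambda>t. h t p) \<in> borel_measurable M"
    and cv: "\<And>t. t \<in> space M \<Longrightarrow> convex_on UNIV (h t)" and ct: "\<And>t. t \<in> space M \<Longrightarrow> continuous_on UNIV (h t)"
    and v: "v \<in> borel_measurable M" and e0: "\<And>t. 0 \<le> e t"
    and le: "\<And>t p. t \<in> space M \<Longrightarrow> v t \<bullet> p - e t * norm p \<le> h t p"
  shows "\<exists>u\<in>borel_measurable M. \<forall>t\<in>space M. norm (u t - v t) \<le> e t \<and> (\<forall>p. u t \<bullet> p \<le> h t p)"
proof -
  define C where "C t = {u. \<forall>p. u \<bullet> p \<le> h t p}" for t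
  have C_eq: "C t = (\<Inter>p. {u. u \<bullet> p \<le> h t p})" for t by (auto simp: C_def)
  have clo: "closed (C t)" for t unfolding C_eq by (intro closed_INT ballI closed_Collect_le continuous_intros)
  have cvx: "convex (C t)" for t unfolding C_eq
    by (intro convex_INT) (simp add: inner_commute convex_halfspace_le)
  have ex: "\<exists>u\<in>C t. norm (u - v t) \<le> e t" if "t \<in> space M" for t
    using convex_sandwich[OF cv[OF that] e0 le[OF that]] by (auto simp: C_def)
  then have ne: "C t \<noteq> {}" if "t \<in> space M" for t using that by blast
  define d where "d t q = dist q (closest_point (C t) q)" for t q
  \<comment> \<open>Cauchy-Schwarz gives one direction and \<open>convex_sandwich\<close> the other,
    so sublevel sets of the distance are described by inequalities in \<open>p\<close>.\<close>
  have d_le: "d t q \<le> a \<longleftrightarrow> 0 \<le> a \<and> (\<forall>p. q \<bullet> p - a * norm p \<le> h t p)" if t: "t \<in> space M" for t q a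
  proof
    assume a: "d t q \<le> a"
    have P: "closest_point (C t) q \<in> C t" by (rule closest_point_in_set[OF clo ne[OF t]])
    have "q \<bullet> p - a * norm p \<le> h t p" for p
    proof -
      have "(q - closest_point (C t) q) \<bullet> p \<le> d t q * norm p"
        unfolding d_def dist_norm by (rule norm_cauchy_schwarz)
      also have "\<dots> \<le> a * norm p" using a by (rule mult_right_mono) simp
      finally have "q \<bullet> p - a * norm p \<le> closest_point (C t) q \<bullet> p" by (simp add: inner_diff_left)
      then show ?thesis using P by (auto simp: C_def intro: order_trans)
    qed
    moreover have "0 \<le> a" using a order_trans[OF zero_le_dist] unfolding d_def by blast
    ultimately show "0 \<le> a \<and> (\<forall>p. q \<bullet> p - a * norm p \<le> h t p)" by blast
  next
    assume "0 \<le> a \<and> (\<forall>p. q \<bullet> p - a * norm p \<le> h t p)"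
    then obtain u where u: "norm (u - q) \<le> a" "u \<in> C t"
      using convex_sandwich[OF cv[OF t], of a q] by (auto simp: C_def)
    then have "d t q \<le> dist q u" unfolding d_def by (intro closest_point_le clo)
    then show "d t q \<le> a" using u by (simp add: dist_norm norm_minus_commute)
  qed
  obtain D :: "'a set" where D: "countable D" "\<And>X. open X \<Longrightarrow> X \<noteq> {} \<Longrightarrow> \<exists>d\<in>D. d \<in> X"
    using countable_dense_setE by blast
  have md: "(\<lambda>t. d t (w t)) \<in> borel_measurable M" if w[measurable]: "w \<in> borel_measurable M" for w
    unfolding borel_measurable_iff_le
  proof
    fix a :: real
    show "{t \<in> space M. d t (w t) \<le> a} \<in> sets M"
    proof (cases "0 \<le> a")
      case False
      then have "{t \<in> space M. d t (w t) \<le> a} = {}" using d_le by auto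
      then show ?thesis by (simp only: sets.empty_sets)
    next
      case True
      have "(\<forall>p. w t \<bullet> p - a * norm p \<le> h t p) \<longleftrightarrow> (\<forall>p\<in>D. w t \<bullet> p - a * norm p \<le> h t p)"
        if t: "t \<in> space M" for t
      proof -
        have "w t \<bullet> p - a * norm p \<le> h t p" if "\<forall>p\<in>D. w t \<bullet> p - a * norm p \<le> h t p" for p
          by (rule continuous_le_of_dense[OF D(2) _ ct[OF t]]) (use that in \<open>auto intro!: continuous_intros\<close>)
        then show ?thesis by blast
      qed
      then have "{t \<in> space M. d t (w t) \<le> a} = {t \<in> space M. \<forall>p\<in>D. w t \<bullet> p - a * norm p \<le> h t p}"
        using True d_le by auto
      also have "\<dots> \<in> sets M"
      proof (rule sets.sets_Collect_countable_All'[OF _ D(1)])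
        fix p
        note m[of p, measurable]
        show "{t \<in> space M. w t \<bullet> p - a * norm p \<le> h t p} \<in> sets M" by measurable
      qed
      finally show ?thesis .
    qed
  qed
  define u where "u t = closest_point (C t) (v t)" for t
  have "(\<lambda>t. u t \<bullet> b) \<in> borel_measurable M" if b: "b \<in> Basis" for b
  proof -
    \<comment> \<open>The difference quotient with step \<open>1 / (n + 1)\<close> in direction
      \<open>b\<close> tends to \<open>2 * (b \<bullet> (v t - u t))\<close>, so
      \<open>F n t\<close> tends to the component of \<open>u t\<close> along
      \<open>b\<close>.\<close>
    define F where "F n t = v t \<bullet> b - (real (Suc n) * ((d t (v t + b /\<^sub>R real (Suc n)))\<^sup>2 - (d t (v t))\<^sup>2)) / 2" for n t
    have nb: "norm b = 1" using b by simp
    show ?thesis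
    proof (rule borel_measurable_LIMSEQ_real)
      show "F n \<in> borel_measurable M" for n
      proof -
        note v[measurable]
        have [measurable]: "(\<lambda>t. d t (v t)) \<in> borel_measurable M" "(\<lambda>t. d t (v t + b /\<^sub>R real (Suc n))) \<in> borel_measurable M"
          by (rule md, measurable)+
        show ?thesis unfolding F_def by measurable
      qed
      fix t assume t: "t \<in> space M"
      have "\<bar>F n t - u t \<bullet> b\<bar> \<le> inverse (real (Suc n))" for n
      proof -
        define X where "X = real (Suc n) * ((d t (v t + b /\<^sub>R real (Suc n)))\<^sup>2 - (d t (v t))\<^sup>2)"
        have "\<bar>X - 2 * (b \<bullet> (v t - u t))\<bar> \<le> inverse (real (Suc n))"
          using closest_point_difference_quotient[OF clo cvx ne[OF t] nb, of "real (Suc n)" "v t"]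
          unfolding X_def d_def u_def inverse_eq_divide by simp
        moreover have "F n t = b \<bullet> v t - X / 2" by (simp only: F_def X_def inner_commute[of b])
        moreover have "b \<bullet> (v t - u t) = b \<bullet> v t - u t \<bullet> b" by (simp add: inner_diff_right inner_commute[of b])
        ultimately show ?thesis by linarith
      qed
      then have "(\<lambda>n. F n t - u t \<bullet> b) \<longlonglongrightarrow> 0"
        by (intro Lim_null_comparison[OF _ LIMSEQ_inverse_real_of_nat]) (simp add: always_eventually)
      then show "(\<lambda>n. F n t) \<longlonglongrightarrow> u t \<bullet> b" by (rule LIM_zero_cancel)
    qed
  qed
  then have "u \<in> borel_measurable M" by (rule borel_measurable_euclidean_space[THEN iffD2, OF ballI])
  moreover have "norm (u t - v t) \<le> e t \<and> (\<forall>p. u t \<bullet> p \<le> h t p)" if t: "t \<in> space M" for t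
  proof -
    have "d t (v t) \<le> e t" using d_le[OF t] e0 le[OF t] by blast
    moreover have "u t \<in> C t" unfolding u_def by (rule closest_point_in_set[OF clo ne[OF t]])
    ultimately show ?thesis by (simp add: d_def u_def C_def dist_norm norm_minus_commute)
  qed
  ultimately show ?thesis by blast
qed

text \<open>The least \<open>\<epsilon> \<ge> 0\<close> for which the affine function \<open>p \<mapsto> v \<bullet> p - r\<close> lies below
  \<open>h(p) + \<epsilon> (1 + |p|)\<close>.\<close>

definition conj_gap :: "('a::euclidean_space \<Rightarrow> real) \<Rightarrow> 'a \<Rightarrow> real \<Rightarrow> real" where
  "conj_gap h v r = (SUP p. max 0 ((v \<bullet> p - r - h p) / (1 + norm p)))"

text \<open>By \<open>lip\<close>, \<open>v \<bullet> p - r - h p\<close> grows at most linearly, so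
  dividing by \<open>1 + norm p\<close> keeps the supremum finite. The third estimate later serves
  as an integrable majorant.\<close>

lemma conj_gap_bounds:
  fixes h :: "'a::euclidean_space \<Rightarrow> real"
  assumes lip: "\<And>p. h 0 \<le> h p + L * norm p" and L: "0 \<le> L"
  shows "0 \<le> conj_gap h v r" "v \<bullet> p - r - h p \<le> conj_gap h v r * (1 + norm p)"
    "conj_gap h v r \<le> norm v + \<bar>r\<bar> + \<bar>h 0\<bar> + L"
    "conj_gap h v r \<le> a \<longleftrightarrow> 0 \<le> a \<and> (\<forall>p. v \<bullet> p - r - h p \<le> a * (1 + norm p))"
proof -
  let ?g = "\<lambda>p. max 0 ((v \<bullet> p - r - h p) / (1 + norm p))"
  have pos: "0 < 1 + norm p" for p :: 'a by (simp add: add_pos_nonneg)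
  have B: "?g p \<le> norm v + \<bar>r\<bar> + \<bar>h 0\<bar> + L" for p
  proof -
    have "v \<bullet> p - r - h p \<le> norm v * norm p + \<bar>r\<bar> + \<bar>h 0\<bar> + L * norm p"
      using norm_cauchy_schwarz[of v p] lip[of p] by linarith
    also have "\<dots> \<le> (norm v + \<bar>r\<bar> + \<bar>h 0\<bar> + L) * (1 + norm p)"
      using L by (simp add: algebra_simps)
    finally show ?thesis using L pos[of p] by (simp add: divide_le_eq)
  qed
  then have bdd: "bdd_above (range ?g)" by (intro bdd_aboveI[of _ "norm v + \<bar>r\<bar> + \<bar>h 0\<bar> + L"]) auto
  have up: "?g p \<le> conj_gap h v r" for p unfolding conj_gap_def by (rule cSUP_upper[OF UNIV_I bdd])
  show nn: "0 \<le> conj_gap h v r" using up[of 0] by simp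
  have *: "v \<bullet> p - r - h p \<le> conj_gap h v r * (1 + norm p)" for p
    using up[of p] pos[of p] by (simp add: pos_divide_le_eq)
  then show "v \<bullet> p - r - h p \<le> conj_gap h v r * (1 + norm p)" .
  show "conj_gap h v r \<le> norm v + \<bar>r\<bar> + \<bar>h 0\<bar> + L" unfolding conj_gap_def by (rule cSUP_least) (use B in auto)
  show "conj_gap h v r \<le> a \<longleftrightarrow> 0 \<le> a \<and> (\<forall>p. v \<bullet> p - r - h p \<le> a * (1 + norm p))"
  proof
    assume a: "conj_gap h v r \<le> a"
    have "conj_gap h v r * (1 + norm p) \<le> a * (1 + norm p)" for p :: 'a using a by (intro mult_right_mono) auto
    then show "0 \<le> a \<and> (\<forall>p. v \<bullet> p - r - h p \<le> a * (1 + norm p))" using nn a * by (meson order_trans)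
  next
    assume "0 \<le> a \<and> (\<forall>p. v \<bullet> p - r - h p \<le> a * (1 + norm p))"
    then have "?g p \<le> a" for p using pos[of p] by (simp add: pos_divide_le_eq)
    then show "conj_gap h v r \<le> a" unfolding conj_gap_def by (intro cSUP_least) auto
  qed
qed

lemma conj_gap_measurable:
  fixes h :: "'t \<Rightarrow> 'a::euclidean_space \<Rightarrow> real"
  assumes m: "\<And>p. (\<lambda>t. h t p) \<in> borel_measurable M"
    and lip: "\<And>t p q. t \<in> space M \<Longrightarrow> \<bar>h t p - h t q\<bar> \<le> L t * norm (p - q)" and L: "\<And>t. 0 \<le> L t"
    and v[measurable]: "v \<in> borel_measurable M" and r[measurable]: "r \<in> borel_measurable M"
  shows "(\<lambda>t. conj_gap (h t) (v t) (r t)) \<in> borel_measurable M"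
proof -
  obtain D :: "'a set" where D: "countable D" "\<And>X. open X \<Longrightarrow> X \<noteq> {} \<Longrightarrow> \<exists>d\<in>D. d \<in> X"
    using countable_dense_setE by blast
  have ct: "continuous_on UNIV (h t)" if "t \<in> space M" for t
    by (rule lipschitz_on_continuous_on[of "L t"], rule lipschitz_onI)
       (use lip[OF that] L in \<open>auto simp: dist_norm\<close>)
  have lip0: "h t 0 \<le> h t p + L t * norm p" if "t \<in> space M" for t p
    using lip[OF that, of 0 p] by (simp add: abs_le_iff)
  show ?thesis unfolding borel_measurable_iff_le
  proof
    fix a :: real
    show "{t \<in> space M. conj_gap (h t) (v t) (r t) \<le> a} \<in> sets M"
    proof (cases "0 \<le> a")
      case False
      then have "{t \<in> space M. conj_gap (h t) (v t) (r t) \<le> a} = {}"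
        using conj_gap_bounds(1)[OF lip0 L] by (auto intro: order_trans)
      then show ?thesis by (simp only: sets.empty_sets)
    next
      case True
      have "(\<forall>p. v t \<bullet> p - r t - h t p \<le> a * (1 + norm p)) \<longleftrightarrow> (\<forall>p\<in>D. v t \<bullet> p - r t - h t p \<le> a * (1 + norm p))"
        if t: "t \<in> space M" for t
      proof -
        have "v t \<bullet> p - r t - h t p \<le> a * (1 + norm p)" if "\<forall>p\<in>D. v t \<bullet> p - r t - h t p \<le> a * (1 + norm p)" for p
          by (rule continuous_le_of_dense[OF D(2)]) (use that ct[OF t] in \<open>auto intro!: continuous_intros\<close>)
        then show ?thesis by blast
      qed
      then have "{t \<in> space M. conj_gap (h t) (v t) (r t) \<le> a} =
          {t \<in> space M. \<forall>p\<in>D. v t \<bullet> p - r t - h t p \<le> a * (1 + norm p)}"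
        using True conj_gap_bounds(4)[OF lip0 L] by auto
      also have "\<dots> \<in> sets M"
      proof (rule sets.sets_Collect_countable_All'[OF _ D(1)])
        fix p
        note m[of p, measurable]
        show "{t \<in> space M. v t \<bullet> p - r t - h t p \<le> a * (1 + norm p)} \<in> sets M" by measurable
      qed
      finally show ?thesis .
    qed
  qed
qed

text \<open>Convergence is only locally uniform, whereas the gap ranges over all momenta. Convexity
  closes this difference: a distant momentum is pulled back along its ray to norm
  \<open>\<rho>\<close>, and the constants that appear are absorbed by
  \<open>e * norm p\<close>.\<close>

lemma conj_gap_tendsto_0:
  fixes h :: "nat \<Rightarrow> 'a::euclidean_space \<Rightarrow> real"
  assumes cv: "\<And>i. convex_on UNIV (h i)" and lip: "\<And>i p. h i 0 \<le> h i p + L * norm p" and L: "0 \<le> L"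
    and lim: "\<And>K. compact K \<Longrightarrow> uniform_limit K h h0 sequentially"
    and epi: "\<And>p. v \<bullet> p - h0 p \<le> r"
  shows "(\<lambda>i. conj_gap (h i) v r) \<longlonglongrightarrow> 0"
proof (rule LIMSEQ_I)
  fix e' :: real assume "0 < e'"
  define e where "e = e' / 2"
  have e: "0 < e" "e < e'" using \<open>0 < e'\<close> by (auto simp: e_def)
  \<comment> \<open>With this radius \<open>e * \<rho>\<close> equals the total error after pulling
    back: \<open>e / 2\<close> at the point of norm \<open>\<rho>\<close>, and
    \<open>\<bar>r\<bar> + \<bar>h0 0\<bar> + e / 2\<close> from the value at 0.\<close>
  define \<rho> where "\<rho> = 1 + (\<bar>r\<bar> + \<bar>h0 0\<bar>) / e"
  have \<rho>: "0 < \<rho>" "e * \<rho> = e + \<bar>r\<bar> + \<bar>h0 0\<bar>" using e by (auto simp: \<rho>_def field_simps intro: add_pos_nonneg)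
  have "\<forall>\<^sub>F i in sequentially. \<forall>p\<in>cball 0 \<rho>. dist (h i p) (h0 p) < e / 2"
    using lim[of "cball 0 \<rho>", unfolded uniform_limit_iff, rule_format, of "e / 2"] e by simp
  then obtain i0 where "\<forall>i\<ge>i0. \<forall>p\<in>cball 0 \<rho>. dist (h i p) (h0 p) < e / 2"
    unfolding eventually_sequentially by blast
  then have i0: "\<bar>h i p - h0 p\<bar> < e / 2" if "i \<ge> i0" "norm p \<le> \<rho>" for i p
    using that by (simp add: dist_real_def)
  show "\<exists>no. \<forall>n\<ge>no. norm (conj_gap (h n) v r - 0) < e'"
  proof (intro exI[of _ i0] allI impI)
    fix i assume i: "i0 \<le> i"
    have "v \<bullet> p - r - h i p \<le> e * (1 + norm p)" for p
    proof (cases "norm p \<le> \<rho>")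
      case True
      have "v \<bullet> p - r - h i p \<le> e / 2" using i0[OF i True] epi[of p] unfolding abs_less_iff by linarith
      also have "\<dots> \<le> e * (1 + norm p)" using e by (simp add: algebra_simps add_increasing2)
      finally show ?thesis .
    next
      case False
      define l where "l = \<rho> / norm p"
      have "\<rho> < norm p" "0 < norm p" using False \<rho>(1) by linarith+
      then have l: "0 < l" "l < 1" "l * norm p = \<rho>" using \<rho>(1) by (simp_all add: l_def)
      have np: "norm (l *\<^sub>R p) \<le> \<rho>" using l by simp
      have "h i (l *\<^sub>R p + (1 - l) *\<^sub>R 0) \<le> l * h i p + (1 - l) * h i 0"
        using convex_onD[OF cv, of l 0 p i] l by (simp add: add.commute)
      then have "l * (v \<bullet> p - r - h i p) \<le> (v \<bullet> (l *\<^sub>R p) - r - h i (l *\<^sub>R p)) + (1 - l) * (r + h i 0)"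
        by (simp add: algebra_simps)
      also have "v \<bullet> (l *\<^sub>R p) - r - h i (l *\<^sub>R p) \<le> e / 2"
        using i0[OF i np] epi[of "l *\<^sub>R p"] unfolding abs_less_iff by linarith
      also have "(1 - l) * (r + h i 0) \<le> 1 * (\<bar>r\<bar> + \<bar>h0 0\<bar> + e / 2)"
      proof -
        have "norm (0::'a) \<le> \<rho>" using \<rho>(1) by simp
        then have "r + h i 0 \<le> \<bar>r\<bar> + \<bar>h0 0\<bar> + e / 2"
          using i0[OF i, of 0] abs_ge_self[of r] abs_ge_self[of "h0 0"] unfolding abs_less_iff by linarith
        then have "(1 - l) * (r + h i 0) \<le> (1 - l) * (\<bar>r\<bar> + \<bar>h0 0\<bar> + e / 2)" using l by (intro mult_left_mono) auto
        also have "\<dots> \<le> 1 * (\<bar>r\<bar> + \<bar>h0 0\<bar> + e / 2)" using l e by (intro mult_right_mono) auto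
        finally show ?thesis .
      qed
      finally have "l * (v \<bullet> p - r - h i p) \<le> e * \<rho>" using \<rho>(2) by simp
      also have "\<dots> \<le> l * (e * (1 + norm p))" using l e by (simp add: algebra_simps)
      finally show ?thesis using l by simp
    qed
    then have "conj_gap (h i) v r \<le> e" using conj_gap_bounds(4)[OF lip[of i] L] e by auto
    then show "norm (conj_gap (h i) v r - 0) < e'" using e conj_gap_bounds(1)[OF lip[of i] L] by (simp add: order_le_less_trans)
  qed
qed

section \<open>Convex combinations of dominated sequences\<close>

text \<open>Closure under midpoints is all that the parallelogram argument below uses, and it makes every
  convex constraint inherited by induction.\<close>

inductive_set midpoints :: "(nat \<Rightarrow> 't \<Rightarrow> 'b::real_vector) \<Rightarrow> nat \<Rightarrow> ('t \<Rightarrow> 'b) set" for Z n where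
  midpoints_base: "n \<le> i \<Longrightarrow> Z i \<in> midpoints Z n"
| midpoints_step: "f \<in> midpoints Z n \<Longrightarrow> g \<in> midpoints Z n \<Longrightarrow> (\<lambda>t. (1/2) *\<^sub>R (f t + g t)) \<in> midpoints Z n"

lemma midpoints_antimono: "f \<in> midpoints Z m \<Longrightarrow> n \<le> m \<Longrightarrow> f \<in> midpoints Z n"
  by (induction rule: midpoints.induct) (auto intro: midpoints.intros)

lemma convex_half_sum: "convex C \<Longrightarrow> x \<in> C \<Longrightarrow> y \<in> C \<Longrightarrow> (1/2::real) *\<^sub>R (x + y) \<in> C"
  using convexD[of C x y "1/2" "1/2"] by (simp add: scaleR_add_right)

lemma midpoints_pointwise:
  assumes "f \<in> midpoints Z n" and C: "convex C" and Z: "\<And>i. n \<le> i \<Longrightarrow> Z i t \<in> C"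
  shows "f t \<in> C"
  using assms(1) by induction (auto intro: Z convex_half_sum[OF C])

lemma midpoints_integral:
  fixes Z :: "nat \<Rightarrow> real \<Rightarrow> 'b::euclidean_space"
  assumes "f \<in> midpoints Z n" and C: "convex C" and S: "\<And>i. Z i integrable_on S"
    and Z: "\<And>i. n \<le> i \<Longrightarrow> integral S (Z i) \<in> C"
  shows "f integrable_on S \<and> integral S f \<in> C"
  using assms(1)
proof induction
  case (midpoints_base i)
  then show ?case using S Z by blast
next
  case (midpoints_step f g)
  have "integral S (\<lambda>t. (1/2) *\<^sub>R (f t + g t)) = (1/2::real) *\<^sub>R (integral S f + integral S g)"
    using midpoints_step.IH by (simp add: Henstock_Kurzweil_Integration.integral_add)
  moreover have "(\<lambda>t. (1/2::real) *\<^sub>R (f t + g t)) integrable_on S"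
    using midpoints_step.IH by (intro integrable_cmul Henstock_Kurzweil_Integration.integrable_add) auto
  ultimately show ?case using midpoints_step.IH by (simp add: convex_half_sum[OF C])
qed

lemma midpoints_comp_linear:
  assumes "f \<in> midpoints Z n" and L: "linear L"
  shows "(\<lambda>t. L (f t)) \<in> midpoints (\<lambda>i t. L (Z i t)) n"
  using assms(1)
proof induction
  case (midpoints_base i)
  then show ?case by (rule midpoints.intros)
next
  case (midpoints_step f g)
  then show ?case using midpoints.midpoints_step[OF midpoints_step.IH]
    by (simp add: linear_scale[OF L] linear_add[OF L])
qed

text \<open>Minimising the strictly convex functional \<open>\<integral> |u|\<^sup>2 / \<phi>\<close> over the midpoint hulls of the tails gives an
  \<open>L\<^sup>1\<close>-Cauchy sequence: this replaces weak compactness of dominated sequences.\<close>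

lemma midpoints_AE_convergent:
  fixes w :: "nat \<Rightarrow> 't \<Rightarrow> 'b::euclidean_space"
  assumes \<phi>: "integrable M \<phi>" "\<And>t. t \<in> space M \<Longrightarrow> 0 < \<phi> t"
    and w: "\<And>i. w i \<in> borel_measurable M" "\<And>i t. t \<in> space M \<Longrightarrow> norm (w i t) \<le> \<phi> t"
  obtains u where "\<And>n. u n \<in> midpoints w n" "AE t in M. convergent (\<lambda>n. u n t)"
proof -
  \<comment> \<open>For functions dominated by \<open>\<phi>\<close> the integrand is at most
    \<open>\<phi>\<close>. The weight thus gives them a Hilbert norm although \<open>\<phi>\<close>
    itself is merely integrable.\<close>
  define J where "J f = (\<integral>t. (norm (f t))\<^sup>2 / \<phi> t \<partial>M)" for f :: "'t \<Rightarrow> 'b"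
  note [measurable] = borel_measurable_integrable[OF \<phi>(1)]
  have mm[measurable]: "f \<in> borel_measurable M" if "f \<in> midpoints w n" for f n
    using that by induction (use w in auto)
  have mb: "norm (f t) \<le> \<phi> t" if "f \<in> midpoints w n" "t \<in> space M" for f n t
    using midpoints_pointwise[OF that(1) convex_cball[of 0 "\<phi> t"], of t] w(2)[OF that(2)] by simp
  have Jint: "integrable M (\<lambda>t. (norm (f t))\<^sup>2 / \<phi> t)"
    if f: "f \<in> borel_measurable M" "\<And>t. t \<in> space M \<Longrightarrow> norm (f t) \<le> 2 * \<phi> t" for f :: "'t \<Rightarrow> 'b"
  proof (rule Bochner_Integration.integrable_bound[of M "\<lambda>t. 4 * \<phi> t"])
    show "integrable M (\<lambda>t. 4 * \<phi> t)" using \<phi>(1) by simp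
    show "(\<lambda>t. (norm (f t))\<^sup>2 / \<phi> t) \<in> borel_measurable M" using f(1) by measurable
    show "AE t in M. norm ((norm (f t))\<^sup>2 / \<phi> t) \<le> norm (4 * \<phi> t)"
    proof (rule AE_I2)
      fix t assume t: "t \<in> space M"
      have "(norm (f t))\<^sup>2 \<le> (2 * \<phi> t)\<^sup>2" using f(2)[OF t] by (intro power_mono) auto
      then show "norm ((norm (f t))\<^sup>2 / \<phi> t) \<le> norm (4 * \<phi> t)"
        using \<phi>(2)[OF t] by (simp add: divide_le_eq power2_eq_square)
    qed
  qed
  have mb2: "norm (f t) \<le> 2 * \<phi> t" if "f \<in> midpoints w n" "t \<in> space M" for f n t
    using mb[OF that] \<phi>(2)[OF that(2)] by linarith
  have J0: "0 \<le> J f" for f unfolding J_def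
    by (rule integral_nonneg_AE, rule AE_I2) (auto intro!: divide_nonneg_pos \<phi>(2))
  have JB: "J f \<le> (\<integral>t. \<phi> t \<partial>M)" if f: "f \<in> midpoints w n" for f n unfolding J_def
  proof (rule integral_mono[OF Jint \<phi>(1)])
    show "f \<in> borel_measurable M" using f by measurable
    fix t assume t: "t \<in> space M"
    show "norm (f t) \<le> 2 * \<phi> t" using mb2[OF f t] .
    have "(norm (f t))\<^sup>2 \<le> (\<phi> t)\<^sup>2" using mb[OF f t] by (intro power_mono) auto
    then show "(norm (f t))\<^sup>2 / \<phi> t \<le> \<phi> t" using \<phi>(2)[OF t] by (simp add: divide_le_eq power2_eq_square)
  qed
  have par: "J (\<lambda>t. f t - g t) = 2 * J f + 2 * J g - 4 * J (\<lambda>t. (1/2) *\<^sub>R (f t + g t))"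
    if f: "f \<in> midpoints w n" and g: "g \<in> midpoints w n" for f g n
  proof -
    note h = midpoints.midpoints_step[OF f g]
    have lin: "(\<integral>t. 2 * A t + 2 * B t - 4 * C t \<partial>M) = 2 * (\<integral>t. A t \<partial>M) + 2 * (\<integral>t. B t \<partial>M) - 4 * (\<integral>t. C t \<partial>M)"
      if "integrable M A" "integrable M B" "integrable M C" for A B C :: "'t \<Rightarrow> real" using that by simp
    have "J (\<lambda>t. f t - g t) = (\<integral>t. 2 * ((norm (f t))\<^sup>2 / \<phi> t) + 2 * ((norm (g t))\<^sup>2 / \<phi> t)
        - 4 * ((norm ((1/2) *\<^sub>R (f t + g t)))\<^sup>2 / \<phi> t) \<partial>M)" unfolding J_def
    proof (rule Bochner_Integration.integral_cong[OF refl])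
      fix t
      have "(norm (f t - g t))\<^sup>2 = 2 * (norm (f t))\<^sup>2 + 2 * (norm (g t))\<^sup>2 - 4 * (norm ((1/2::real) *\<^sub>R (f t + g t)))\<^sup>2"
        unfolding power2_norm_eq_inner
        by (simp add: inner_add_left inner_add_right inner_diff_left inner_diff_right inner_commute[of "g t" "f t"] add_divide_distrib)
      then show "(norm (f t - g t))\<^sup>2 / \<phi> t = 2 * ((norm (f t))\<^sup>2 / \<phi> t) + 2 * ((norm (g t))\<^sup>2 / \<phi> t)
        - 4 * ((norm ((1/2) *\<^sub>R (f t + g t)))\<^sup>2 / \<phi> t)" by (simp add: diff_divide_distrib add_divide_distrib)
    qed
    also have "\<dots> = 2 * J f + 2 * J g - 4 * J (\<lambda>t. (1/2) *\<^sub>R (f t + g t))" unfolding J_def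
      by (rule lin[OF Jint[OF mm[OF f] mb2[OF f]] Jint[OF mm[OF g] mb2[OF g]] Jint[OF mm[OF h] mb2[OF h]]])
    finally show ?thesis .
  qed
  define d where "d n = Inf (J ` midpoints w n)" for n
  have bdd: "bdd_below (J ` midpoints w n)" for n using J0 by (intro bdd_belowI[of _ 0]) auto
  have ne: "midpoints w n \<noteq> {}" for n using midpoints_base[of n n w] by blast
  have dle: "d n \<le> J f" if "f \<in> midpoints w n" for f n unfolding d_def by (rule cINF_lower[OF bdd that])
  have "incseq d" unfolding d_def
    by (intro incseq_SucI cINF_superset_mono ne bdd subsetI) (auto intro: midpoints_antimono)
  moreover have dB: "d n \<le> (\<integral>t. \<phi> t \<partial>M)" for n
    using dle[OF midpoints_base[OF order_refl]] JB[OF midpoints_base[OF order_refl]] by (rule order_trans)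
  ultimately obtain d' where d': "d \<longlonglongrightarrow> d'" "\<And>n. d n \<le> d'" using incseq_convergent by blast
  have "\<exists>f\<in>midpoints w n. J f < d n + inverse (real (Suc n))" for n
    using cInf_lessD[of "J ` midpoints w n" "d n + inverse (real (Suc n))"] ne[of n] by (auto simp: d_def)
  then obtain u where u: "\<And>n. u n \<in> midpoints w n" "\<And>n. J (u n) < d n + inverse (real (Suc n))" by metis
  \<comment> \<open>Both functions lie in the hull of index \<open>n\<close>, so their midpoint has
    \<open>J\<close> at least \<open>d n\<close>; since both nearly minimise \<open>J\<close>, the
    parallelogram identity forces them to be close.\<close>
  have Jd: "J (\<lambda>t. u n t - u m t) \<le> 4 * inverse (real (Suc n)) + 2 * (d' - d n)" if nm: "n \<le> m" for n m
  proof -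
    have um: "u m \<in> midpoints w n" using u(1) nm by (rule midpoints_antimono)
    have 1: "d n \<le> J (\<lambda>t. (1/2) *\<^sub>R (u n t + u m t))" by (rule dle[OF midpoints.midpoints_step[OF u(1) um]])
    have 2: "inverse (real (Suc m)) \<le> inverse (real (Suc n))" using nm by simp
    have "A \<le> 4 * a + 2 * (D - dn)"
      if "dn \<le> J3" "b \<le> a" "A = 2 * J1 + 2 * J2 - 4 * J3" "J1 < dn + a" "J2 < dm + b" "dm \<le> D"
      for A D J1 J2 J3 a b dn dm :: real using that by argo
    from this[OF 1 2 par[OF u(1) um] u(2)[of n] u(2)[of m] d'(2)[of m]] show ?thesis .
  qed
  define \<epsilon> where "\<epsilon> n = 4 * inverse (real (Suc n)) + 2 * (d' - d n)" for n
  have "\<epsilon> \<longlonglongrightarrow> 4 * 0 + 2 * (d' - d')" unfolding \<epsilon>_def by (intro tendsto_intros LIMSEQ_inverse_real_of_nat d'(1))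
  then have \<epsilon>: "\<epsilon> \<longlonglongrightarrow> 0" by simp
  define \<Phi> where "\<Phi> = (\<integral>t. \<phi> t \<partial>M)"
  have \<Phi>0: "0 \<le> \<Phi>" unfolding \<Phi>_def by (rule integral_nonneg_AE, rule AE_I2) (use \<phi>(2) less_imp_le in blast)
  have ui: "integrable M (u n)" for n
    by (rule Bochner_Integration.integrable_bound[OF \<phi>(1) mm[OF u(1)]], rule AE_I2)
       (metis mb[OF u(1)] abs_ge_self order_trans real_norm_def)
  \<comment> \<open>Young's inequality, with free parameter \<open>\<eta>\<close>, passes from the
    weighted square norm to the L1 norm.\<close>
  have L1: "(\<integral>t. norm (u n t - u m t) \<partial>M) \<le> J (\<lambda>t. u n t - u m t) / (2 * \<eta>) + \<eta> * \<Phi> / 2" if \<eta>: "0 < \<eta>" for n m \<eta>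
  proof -
    have b: "norm (u n t - u m t) \<le> 2 * \<phi> t" if "t \<in> space M" for t
      using norm_triangle_ineq4[of "u n t" "u m t"] mb[OF u(1) that, of n] mb[OF u(1) that, of m] by linarith
    have m': "(\<lambda>t. u n t - u m t) \<in> borel_measurable M" using mm[OF u(1)] by measurable
    have i: "integrable M (\<lambda>t. (norm (u n t - u m t))\<^sup>2 / \<phi> t)" by (rule Jint[OF m' b])
    have "(\<integral>t. norm (u n t - u m t) \<partial>M) \<le> (\<integral>t. ((norm (u n t - u m t))\<^sup>2 / \<phi> t) * (1 / (2 * \<eta>)) + \<phi> t * (\<eta> / 2) \<partial>M)"
    proof (rule integral_mono)
      show "integrable M (\<lambda>t. norm (u n t - u m t))" using ui by simp
      show "integrable M (\<lambda>t. ((norm (u n t - u m t))\<^sup>2 / \<phi> t) * (1 / (2 * \<eta>)) + \<phi> t * (\<eta> / 2))"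
        by (intro Bochner_Integration.integrable_add integrable_mult_left i \<phi>(1))
      fix t assume t: "t \<in> space M"
      let ?a = "norm (u n t - u m t)"
      have "0 \<le> (?a - \<eta> * \<phi> t)\<^sup>2" by simp
      then have "2 * ?a * (\<eta> * \<phi> t) \<le> ?a\<^sup>2 + (\<eta> * \<phi> t)\<^sup>2" by (simp add: power2_diff algebra_simps)
      then have "2 * ?a * (\<eta> * \<phi> t) / (2 * \<eta> * \<phi> t) \<le> (?a\<^sup>2 + (\<eta> * \<phi> t)\<^sup>2) / (2 * \<eta> * \<phi> t)"
        using \<phi>(2)[OF t] \<eta> by (intro divide_right_mono) auto
      moreover have "2 * ?a * (\<eta> * \<phi> t) / (2 * \<eta> * \<phi> t) = ?a" using \<phi>(2)[OF t] \<eta> by simp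
      moreover have "(?a\<^sup>2 + (\<eta> * \<phi> t)\<^sup>2) / (2 * \<eta> * \<phi> t) = (?a\<^sup>2 / \<phi> t) * (1 / (2 * \<eta>)) + \<phi> t * (\<eta> / 2)"
        using \<phi>(2)[OF t] \<eta> by (simp add: power2_eq_square field_simps)
      ultimately show "?a \<le> (?a\<^sup>2 / \<phi> t) * (1 / (2 * \<eta>)) + \<phi> t * (\<eta> / 2)" by simp
    qed
    also have "\<dots> = J (\<lambda>t. u n t - u m t) / (2 * \<eta>) + \<eta> * \<Phi> / 2"
    proof -
      have lin: "(\<integral>t. A t * p + B t * q \<partial>M) = (\<integral>t. A t \<partial>M) * p + (\<integral>t. B t \<partial>M) * q"
        if "integrable M A" "integrable M B" for A B :: "'t \<Rightarrow> real" and p q using that by simp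
      show ?thesis unfolding lin[OF i \<phi>(1)] J_def \<Phi>_def by simp
    qed
    finally show ?thesis .
  qed
  have cauchy: "\<exists>N. \<forall>i\<ge>N. \<forall>j\<ge>N. (\<integral>t. norm (u i t - u j t) \<partial>M) < e" if e: "0 < e" for e
  proof -
    define \<eta> where "\<eta> = e / (\<Phi> + 1)"
    have \<eta>: "0 < \<eta>" "\<eta> * \<Phi> \<le> e" using e \<Phi>0 by (auto simp: \<eta>_def field_simps)
    have "\<forall>\<^sub>F n in sequentially. \<epsilon> n < e * \<eta> / 2" using \<epsilon> e \<eta> by (intro order_tendstoD) auto
    then obtain N where N: "\<And>n. n \<ge> N \<Longrightarrow> \<epsilon> n < e * \<eta> / 2" by (auto simp: eventually_sequentially)
    have le: "(\<integral>t. norm (u i t - u j t) \<partial>M) < e" if ij: "N \<le> i" "i \<le> j" for i j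
    proof -
      have "J (\<lambda>t. u i t - u j t) < e * \<eta> / 2" using Jd[OF ij(2)] N[OF ij(1)] by (simp add: \<epsilon>_def)
      then have "J (\<lambda>t. u i t - u j t) / (2 * \<eta>) < e / 4" using \<eta>(1) by (simp add: field_simps)
      then show ?thesis using L1[OF \<eta>(1), of i j] \<eta>(2) e by linarith
    qed
    have "(\<integral>t. norm (u i t - u j t) \<partial>M) < e" if "N \<le> i" "N \<le> j" for i j
      using le[of i j] le[of j i] that by (cases "i \<le> j") (auto simp: norm_minus_commute)
    then show ?thesis by blast
  qed
  obtain s where s: "strict_mono s" "AE t in M. Cauchy (\<lambda>i. u (s i) t)"
    using cauchy_L1_AE_cauchy_subseq[OF ui cauchy] by blast
  show thesis
  proof (rule that)
    show "u (s n) \<in> midpoints w n" for n using u(1) seq_suble[OF s(1)] by (rule midpoints_antimono)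
    show "AE t in M. convergent (\<lambda>n. u (s n) t)" using s(2) by eventually_elim (simp add: Cauchy_convergent_iff)
  qed
qed

section \<open>Limits of trajectories\<close>

lemma traj_velocity_le:
  assumes H: "ham_hyps T c k H" and c0: "\<And>t. 0 \<le> c t" and tr: "traj T H t0 x v r"
    and t0: "0 \<le> t0" and t: "t \<in> {0..T}"
  shows "norm (v t) \<le> c t * (1 + norm (x t))"
proof (cases "t < t0")
  case True
  then show ?thesis using tr c0 by (simp add: traj_def)
next
  case False
  then have tt: "t \<in> {t0..T}" using t by simp
  have lip: "\<bar>H t (x t) p - H t (x t) 0\<bar> \<le> c t * (1 + norm (x t)) * norm (p - 0)" for p
    using H t unfolding ham_hyps_def by blast
  show ?thesis
  proof (rule ham_epi_norm_le)
    show "v t \<bullet> p - H t (x t) p \<le> r t" for p using tr tt unfolding traj_def by blast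
    show "H t (x t) p \<le> H t (x t) 0 + c t * (1 + norm (x t)) * norm p" for p using lip[of p] by (simp add: abs_le_iff)
  qed (simp add: c0)
qed

lemma traj_continuous: "traj T H t0 x v r \<Longrightarrow> continuous_on {0..T} x"
proof -
  assume tr: "traj T H t0 x v r"
  then have "v integrable_on {0..T}" unfolding traj_def using set_lebesgue_integral_eq_integral(1) by blast
  then have "continuous_on {0..T} (\<lambda>t. x 0 + integral {0..t} v)"
    by (intro continuous_intros indefinite_integral_continuous_1)
  then show "continuous_on {0..T} x"
    by (rule continuous_on_eq) (use tr in \<open>unfold traj_def, metis\<close>)
qed

text \<open>(H4) with Gronwall's inequality for \<open>1 + norm (x t)\<close>. The bound depends
  only on \<open>c\<close> and the initial state, so it is common to all the Hamiltonians.\<close>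

lemma traj_bound:
  assumes H: "ham_hyps T c k H" and c: "c absolutely_integrable_on {0..T}" and c0: "\<And>t. 0 \<le> c t"
    and tr: "traj T H t0 x v r" and t0: "0 \<le> t0" and t: "t \<in> {0..T}"
  shows "norm (x t) \<le> 2 * (1 + norm (x 0)) * exp (2 * integral {0..T} c)"
proof -
  have ci: "c integrable_on {0..T}" using c by (rule set_lebesgue_integral_eq_integral)
  have vi: "v integrable_on {0..T}" using tr unfolding traj_def using set_lebesgue_integral_eq_integral(1) by blast
  have xc: "continuous_on {0..T} x" by (rule traj_continuous[OF tr])
  have u: "continuous_on {0..T} (\<lambda>t. 1 + norm (x t))" by (intro continuous_intros xc)
  have "1 + norm (x t) \<le> 2 * (1 + norm (x 0)) * exp (2 * integral {0..t} c)"
  proof (rule gronwall_integrable[OF c c0 u _ _ t])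
    fix s assume s: "s \<in> {0..T}"
    then have sub: "{0..s} \<subseteq> {0..T}" by auto
    have "norm (integral {0..s} v) \<le> integral {0..s} (\<lambda>\<tau>. c \<tau> * (1 + norm (x \<tau>)))"
    proof (rule integral_norm_bound_integral)
      show "v integrable_on {0..s}" by (rule integrable_subinterval_real[OF vi sub])
      show "(\<lambda>\<tau>. c \<tau> * (1 + norm (x \<tau>))) integrable_on {0..s}"
        by (rule integrable_subinterval_real[OF _ sub], rule set_lebesgue_integral_eq_integral, rule absolutely_integrable_mult_continuous[OF c u])
      show "norm (v \<tau>) \<le> c \<tau> * (1 + norm (x \<tau>))" if "\<tau> \<in> {0..s}" for \<tau>
        using that sub by (intro traj_velocity_le[OF H c0 tr t0]) auto
    qed
    moreover have "x s = x 0 + integral {0..s} v" using tr s unfolding traj_def by blast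
    then have "norm (x s) \<le> norm (x 0) + norm (integral {0..s} v)" by (metis norm_triangle_ineq)
    ultimately show "1 + norm (x s) \<le> (1 + norm (x 0)) + integral {0..s} (\<lambda>\<tau>. c \<tau> * (1 + norm (x \<tau>)))" by linarith
  qed simp
  also have "\<dots> \<le> 2 * (1 + norm (x 0)) * exp (2 * integral {0..T} c)"
  proof -
    have "integral {0..t} c \<le> integral {0..T} c"
      by (rule integral_subset_le) (use t ci c0 in \<open>auto intro: integrable_subinterval_real[OF ci]\<close>)
    then show ?thesis by (intro mult_left_mono) auto
  qed
  finally show ?thesis by linarith
qed

lemma integral_diff_interval:
  fixes f :: "real \<Rightarrow> 'b::banach"
  assumes "f integrable_on {0..T}" "0 \<le> s" "s \<le> t" "t \<le> T"
  shows "integral {0..t} f - integral {0..s} f = integral {s..t} f"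
proof -
  have "f integrable_on {0..t}" using assms by (intro integrable_subinterval_real[OF assms(1)]) auto
  then show ?thesis using Henstock_Kurzweil_Integration.integral_combine[of 0 s t f] assms by (simp add: algebra_simps)
qed

text \<open>One choice of convex combinations acts on velocities and costs together, which respects
  constraints linear in the pair. The limit velocity comes from dominated convergence, the limit
  cost is a pointwise lower limit, and Fatou's lemma keeps its integral below
  \<open>B\<close>.\<close>

lemma trajectory_limit_cost:
  fixes Hs :: "nat \<Rightarrow> real \<Rightarrow> 'a::euclidean_space \<Rightarrow> 'a \<Rightarrow> real"
  assumes Hc: "\<And>t. t \<in> {0..T} \<Longrightarrow> continuous_on UNIV (\<lambda>(x, p). H t x p)"
    and unif: "\<And>t K. t \<in> {0..T} \<Longrightarrow> compact K \<Longrightarrow>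
        uniform_limit K (\<lambda>i (x, p). Hs i t x p) (\<lambda>(x, p). H t x p) sequentially"
    and tr: "\<And>i. traj T (Hs i) (ts i) (xs i) (vs i) (rs i)"
    and t0: "t0 \<in> {0..T}" and ts: "ts \<longlonglongrightarrow> t0"
    and \<phi>: "\<phi> absolutely_integrable_on {0..T}" "\<And>i t. t \<in> {0..T} \<Longrightarrow> norm (vs i t) \<le> \<phi> t"
    and \<psi>: "\<psi> absolutely_integrable_on {0..T}" "\<And>i t. t \<in> {0..T} \<Longrightarrow> - \<psi> t \<le> rs i t"
    and B: "\<And>i. integral {0..T} (rs i) \<le> B"
    and x: "\<And>t. t \<in> {0..T} \<Longrightarrow> (\<lambda>i. xs i t) \<longlonglongrightarrow> x t"
  shows "value_fun T g (steiner_f H) (steiner_l H) (t0, x 0) \<le> g (x T) + ereal B"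
proof -
  let ?M = "lebesgue_on {0..T}"
  have leb: "{0..T} \<in> sets lebesgue" by simp
  have sp[simp]: "space ?M = {0..T}" by simp
  have vi: "vs i absolutely_integrable_on {0..T}" and ri: "rs i absolutely_integrable_on {0..T}" for i
    using tr[of i] by (auto simp: traj_def)
  have v0: "vs i t = 0" and r0: "rs i t = 0" if "t < ts i" for i t
    using tr[of i] that unfolding traj_def by auto
  have xi: "xs i t = xs i 0 + integral {0..t} (vs i)" if "t \<in> {0..T}" for i t
    using tr[of i] that unfolding traj_def by blast
  have E: "vs i t \<bullet> p - Hs i t (xs i t) p \<le> rs i t" if "t \<in> {ts i..T}" for i t p
    using tr[of i] that unfolding traj_def by blast

  \<comment> \<open>Convex combinations of velocities and costs\<close>
  define Z where "Z i t = (vs i t, rs i t)" for i t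
  have meas: "vs i \<in> borel_measurable ?M" "rs i \<in> borel_measurable ?M" for i
    using vi ri by (simp_all add: absolutely_integrable_on_iff_integrable borel_measurable_integrable)
  have \<phi>M: "integrable ?M \<phi>" and \<psi>M: "integrable ?M \<psi>"
    using \<phi>(1) \<psi>(1) by (simp_all add: absolutely_integrable_on_iff_integrable)
  have one: "integrable ?M (\<lambda>_. 1::real)"
    using absolutely_integrable_on_const[of "{0..T}" "1::real"] by (simp add: absolutely_integrable_on_iff_integrable)
  \<comment> \<open>A strictly positive majorant, since the functional minimised in
    \<open>midpoints_AE_convergent\<close> divides by it.\<close>
  define \<phi>' where "\<phi>' t = \<bar>\<phi> t\<bar> + 1" for t
  have \<phi>': "integrable ?M \<phi>'" unfolding \<phi>'_def using \<phi>M one by simp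
  have "norm (vs i t) \<le> \<phi>' t" if "t \<in> space ?M" for i t using \<phi>(2)[of t i] that by (simp add: \<phi>'_def)
  moreover have "0 < \<phi>' t" for t by (simp add: \<phi>'_def add_nonneg_pos)
  ultimately obtain U0 where U0: "\<And>n. U0 n \<in> midpoints vs n" "AE t in ?M. convergent (\<lambda>n. U0 n t)"
    using midpoints_AE_convergent[OF \<phi>', of vs] meas(1) by blast
  \<comment> \<open>Lifts the combinations found for the velocities to pairs, so that the costs are
    combined in the same way.\<close>
  have "\<exists>f\<in>midpoints Z n. (\<lambda>t. fst (f t)) = U0 n" for n
  proof -
    have "\<exists>f\<in>midpoints Z n. (\<lambda>t. fst (f t)) = u" if "u \<in> midpoints vs n" for u
      using that
    proof induction
      case (midpoints_base i)
      then show ?case by (intro bexI[of _ "Z i"] midpoints.intros) (auto simp: Z_def)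
    next
      case (midpoints_step f g)
      then obtain f' g' where "f' \<in> midpoints Z n" "g' \<in> midpoints Z n" "f = (\<lambda>t. fst (f' t))" "g = (\<lambda>t. fst (g' t))" by metis
      then show ?case by (intro bexI[OF _ midpoints.midpoints_step[of f' Z n g']]) auto
    qed
    then show ?thesis using U0(1) by blast
  qed
  then obtain U where U: "\<And>n. U n \<in> midpoints Z n" "\<And>n t. fst (U n t) = U0 n t" by (metis (no_types))
  define u where "u n t = fst (U n t)" for n t
  define R where "R n t = snd (U n t)" for n t
  have pw: "(u n t, R n t) \<in> C" if "convex C" "\<And>i. n \<le> i \<Longrightarrow> (vs i t, rs i t) \<in> C" for C n t
    using midpoints_pointwise[OF U(1)[of n] that(1), of t] that(2) by (simp add: u_def R_def Z_def)
  have umid: "u n \<in> midpoints vs n" for n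
    using midpoints_comp_linear[OF U(1)[of n] linear_fst] by (simp add: u_def[abs_def] Z_def)
  have Rmid: "R n \<in> midpoints rs n" for n
    using midpoints_comp_linear[OF U(1)[of n] linear_snd] by (simp add: R_def[abs_def] Z_def)
  have vint: "vs i integrable_on {0..t}" if "t \<in> {0..T}" for i t
    by (rule integrable_subinterval_real[of _ 0 T]) (use that set_lebesgue_integral_eq_integral(1)[OF vi] in auto)
  have rint: "rs i integrable_on {0..T}" for i using ri by (rule set_lebesgue_integral_eq_integral)
  have uint: "u n integrable_on {0..t}" if "t \<in> {0..T}" for n t
    using midpoints_integral[OF umid convex_UNIV vint[OF that]] by blast
  have RB: "R n integrable_on {0..T}" "integral {0..T} (R n) \<le> B" for n
    using midpoints_integral[OF Rmid[of n] convex_real_interval(2)[of B] rint] B by auto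
  have ub: "norm (u n t) \<le> \<phi> t" if "t \<in> {0..T}" for n t
    using midpoints_pointwise[OF umid[of n] convex_cball[of 0 "\<phi> t"], of t] \<phi>(2)[OF that] by simp
  have Rb: "0 \<le> R n t + \<psi> t" if "t \<in> {0..T}" for n t
    using midpoints_pointwise[OF Rmid[of n] convex_real_interval(1)[of "- \<psi> t"], of t] \<psi>(2)[OF that] by simp
  have RM: "integrable ?M (R n)" for n
  proof -
    have "(\<lambda>t. R n t + \<psi> t) integrable_on {0..T}"
      using RB(1) \<psi>(1) by (intro Henstock_Kurzweil_Integration.integrable_add) (auto intro: set_lebesgue_integral_eq_integral)
    then have "(\<lambda>t. R n t + \<psi> t) absolutely_integrable_on {0..T}"
      using Rb by (intro nonnegative_absolutely_integrable_1) auto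
    then have "integrable ?M (\<lambda>t. (R n t + \<psi> t) - \<psi> t)"
      using \<psi>M by (intro Bochner_Integration.integrable_diff) (simp_all add: absolutely_integrable_on_iff_integrable)
    then show ?thesis by simp
  qed
  \<comment> \<open>Adding \<open>\<psi>\<close> makes the costs nonnegative, as Fatou's lemma in
    \<open>ennreal\<close> requires.\<close>
  define G where "G t = liminf (\<lambda>n. ennreal (R n t + \<psi> t))" for t
  have [measurable]: "R n \<in> borel_measurable ?M" "\<psi> \<in> borel_measurable ?M" for n
    using RM \<psi>M by (auto intro: borel_measurable_integrable)
  have Gm[measurable]: "G \<in> borel_measurable ?M" unfolding G_def by measurable
  define D where "D = B + integral\<^sup>L ?M \<psi>"
  have "(\<integral>\<^sup>+t. G t \<partial>?M) \<le> liminf (\<lambda>n. \<integral>\<^sup>+t. ennreal (R n t + \<psi> t) \<partial>?M)"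
    unfolding G_def by (rule nn_integral_liminf) measurable
  also have "\<dots> \<le> liminf (\<lambda>n. ennreal D)"
  proof (rule Liminf_mono, rule always_eventually, rule allI)
    fix n
    have "(\<integral>\<^sup>+t. ennreal (R n t + \<psi> t) \<partial>?M) = ennreal (integral\<^sup>L ?M (\<lambda>t. R n t + \<psi> t))"
      by (rule nn_integral_eq_integral) (use RM \<psi>M Rb in \<open>auto intro!: AE_I2\<close>)
    also have "integral\<^sup>L ?M (\<lambda>t. R n t + \<psi> t) = integral\<^sup>L ?M (R n) + integral\<^sup>L ?M \<psi>" using RM \<psi>M by simp
    also have "integral\<^sup>L ?M (R n) = integral {0..T} (R n)" by (rule lebesgue_integral_eq_integral[OF RM leb])
    finally show "(\<integral>\<^sup>+t. ennreal (R n t + \<psi> t) \<partial>?M) \<le> ennreal D" using RB(2)[of n] by (simp add: D_def ennreal_leI)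
  qed
  also have "\<dots> = ennreal D" by (simp add: Liminf_const)
  finally have GD: "(\<integral>\<^sup>+t. G t \<partial>?M) \<le> ennreal D" .
  have D0: "0 \<le> D"
  proof -
    have "0 \<le> integral\<^sup>L ?M (\<lambda>t. R 0 t + \<psi> t)" by (rule integral_nonneg_AE, rule AE_I2) (use Rb in simp)
    also have "\<dots> = integral {0..T} (R 0) + integral\<^sup>L ?M \<psi>" using RM[of 0] \<psi>M lebesgue_integral_eq_integral[OF RM leb, of 0] by simp
    also have "\<dots> \<le> D" using RB(2)[of 0] by (simp add: D_def)
    finally show ?thesis .
  qed
  have "AE t in ?M. G t \<noteq> \<infinity>"
    by (rule nn_integral_PInf_AE[OF Gm]) (use GD in \<open>auto simp: top_unique\<close>)
  then have "AE t in ?M. G t \<noteq> \<infinity> \<and> convergent (\<lambda>n. U0 n t)" using U0(2) by eventually_elim simp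
  then obtain N0 where N0: "negligible N0" "\<And>t. t \<in> {0..T} - N0 \<Longrightarrow> G t \<noteq> \<infinity> \<and> convergent (\<lambda>n. U0 n t)"
    unfolding AE_lebesgue_on_iff_negligible[OF leb] by blast
  \<comment> \<open>The time \<open>t0\<close> joins the null set because \<open>ts i\<close> may
    exceed \<open>t0\<close> for infinitely many \<open>i\<close>, and then the constraint says
    nothing there.\<close>
  define N where "N = insert t0 N0"
  have N: "negligible N" using N0(1) by (simp add: N_def negligible_insert)

  \<comment> \<open>The limit pair and its state equation\<close>
  define v where "v t = (if t \<in> N \<or> t < t0 then 0 else lim (\<lambda>n. u n t))" for t
  define r where "r t = (if t < t0 then 0 else enn2real (G t) - \<psi> t)" for t
  have early: "\<forall>\<^sub>F n in sequentially. u n t = 0 \<and> R n t = 0" if t: "t < t0" for t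
  proof -
    have "\<forall>\<^sub>F i in sequentially. t < ts i" using ts t by (rule order_tendstoD)
    then obtain m where m: "\<And>i. i \<ge> m \<Longrightarrow> t < ts i" by (auto simp: eventually_sequentially)
    have "u n t = 0 \<and> R n t = 0" if "n \<ge> m" for n
      using pw[of "{0}" n t] v0[OF m] r0[OF m] that by (simp add: zero_prod_def)
    then show ?thesis by (auto simp: eventually_sequentially)
  qed
  have uv: "(\<lambda>n. u n t) \<longlonglongrightarrow> v t" if t: "t \<in> {0..T} - N" for t
  proof (cases "t < t0")
    case True
    have "\<forall>\<^sub>F n in sequentially. u n t = v t" using early[OF True] by eventually_elim (use True in \<open>simp add: v_def\<close>)
    then show ?thesis by (rule tendsto_eventually)
  next
    case False
    have "convergent (\<lambda>n. u n t)" using N0(2)[of t] t U(2) by (simp add: N_def u_def)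
    then show ?thesis using False t by (simp add: v_def convergent_LIMSEQ_iff)
  qed
  \<comment> \<open>Zeroing on \<open>N\<close> changes no integral and gives convergence at every
    point, as dominated convergence is applied in that form.\<close>
  define u' where "u' n t = (if t \<in> N then 0 else u n t)" for n t
  have u'i: "u' n integrable_on {0..t}" "integral {0..t} (u' n) = integral {0..t} (u n)" if "t \<in> {0..T}" for n t
  proof -
    show "u' n integrable_on {0..t}"
      by (rule integrable_spike[OF uint[OF that] N]) (simp add: u'_def)
    show "integral {0..t} (u' n) = integral {0..t} (u n)"
      by (rule integral_spike[OF N]) (simp add: u'_def)
  qed
  have \<phi>i: "\<phi> integrable_on {0..t}" if "t \<in> {0..T}" for t
    by (rule integrable_subinterval_real[of _ 0 T]) (use that set_lebesgue_integral_eq_integral(1)[OF \<phi>(1)] in auto)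
  have \<phi>0: "0 \<le> \<phi> t" if "t \<in> {0..T}" for t using \<phi>(2)[OF that] norm_ge_zero order_trans by blast
  have u'v: "v integrable_on {0..t}" "(\<lambda>n. integral {0..t} (u' n)) \<longlonglongrightarrow> integral {0..t} v" if t: "t \<in> {0..T}" for t
  proof -
    have 1: "norm (u' n s) \<le> \<phi> s" if "s \<in> {0..t}" for n s using that t ub[of s n] \<phi>0[of s] by (auto simp: u'_def)
    have 2: "(\<lambda>n. u' n s) \<longlonglongrightarrow> v s" if "s \<in> {0..t}" for s
      using that t uv[of s] by (cases "s \<in> N") (auto simp: u'_def v_def)
    show "v integrable_on {0..t}" "(\<lambda>n. integral {0..t} (u' n)) \<longlonglongrightarrow> integral {0..t} v"
      using dominated_convergence[of u' "{0..t}" \<phi> v, OF u'i(1)[OF t] \<phi>i[OF t] 1 2] by blast+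
  qed
  have vb: "norm (v t) \<le> \<phi> t" if t: "t \<in> {0..T}" for t
  proof (cases "t \<in> N")
    case True then show ?thesis using \<phi>0[OF t] by (simp add: v_def)
  next
    case False
    then have "(\<lambda>n. norm (u n t)) \<longlonglongrightarrow> norm (v t)" using uv t by (intro tendsto_norm) auto
    then show ?thesis by (rule Lim_bounded) (use ub[OF t] in auto)
  qed
  have va: "v absolutely_integrable_on {0..T}"
  proof (cases "0 \<le> T")
    case True
    then have T: "T \<in> {0..T}" by simp
    show ?thesis by (rule absolutely_integrable_integrable_bound[OF vb u'v(1)[OF T] \<phi>i[OF T]])
  qed (use t0 in auto)
  have T0: "0 \<in> {0..T}" using t0 by auto
  have xv: "x t = x 0 + integral {0..t} v" if t: "t \<in> {0..T}" for t
  proof -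
    have lim: "(\<lambda>i. integral {0..t} (vs i)) \<longlonglongrightarrow> x t - x 0"
      using tendsto_diff[OF x[OF t] x[OF T0]] by (simp add: xi[OF t, of _])
    have "(\<lambda>n. integral {0..t} (u' n)) \<longlonglongrightarrow> x t - x 0"
    proof (rule LIMSEQ_I)
      fix e :: real assume "0 < e"
      then obtain m where m: "\<And>i. i \<ge> m \<Longrightarrow> norm (integral {0..t} (vs i) - (x t - x 0)) < e"
        using LIMSEQ_D[OF lim] by blast
      have "norm (integral {0..t} (u' n) - (x t - x 0)) < e" if n: "n \<ge> m" for n
      proof -
        \<comment> \<open>The integrals of the tail lie in a ball, and convexity of the ball passes
          this on to their midpoint combinations.\<close>
        have "integral {0..t} (u n) \<in> ball (x t - x 0) e"
          using midpoints_integral[OF umid[of n] convex_ball[of "x t - x 0" e] vint[OF t]] m n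
          by (simp add: dist_norm norm_minus_commute)
        then show ?thesis using u'i(2)[OF t] by (simp add: dist_norm norm_minus_commute)
      qed
      then show "\<exists>no. \<forall>n\<ge>no. norm (integral {0..t} (u' n) - (x t - x 0)) < e" by blast
    qed
    then have "x t - x 0 = integral {0..t} v" using u'v(2)[OF t] LIMSEQ_unique by blast
    then show ?thesis by (simp add: algebra_simps)
  qed

  \<comment> \<open>The epigraph constraint in the limit\<close>
  have HE: "v t \<bullet> q - H t (x t) q \<le> r t" if t: "t \<in> {t0..T} - N" for t q
  proof -
    have tT: "t \<in> {0..T}" "t0 < t" "t \<notin> N" using t t0 by (auto simp: N_def less_le)
    have "\<forall>\<^sub>F i in sequentially. ts i < t" using ts tT(2) by (rule order_tendstoD)
    have Hlim: "(\<lambda>i. Hs i t (xs i t) q) \<longlonglongrightarrow> H t (x t) q"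
    proof -
      define K where "K = insert (x t) (range (\<lambda>i. xs i t)) \<times> {q}"
      have "compact K" unfolding K_def by (intro compact_Times compact_sequence_with_limit x[OF tT(1)]) auto
      then have ul: "uniform_limit K (\<lambda>i (x, p). Hs i t x p) (\<lambda>(x, p). H t x p) sequentially" by (rule unif[OF tT(1)])
      have "(\<lambda>i. Hs i t (xs i t) q - H t (xs i t) q) \<longlonglongrightarrow> 0"
      proof (rule LIMSEQ_I)
        fix e :: real assume "0 < e"
        then have "\<forall>\<^sub>F i in sequentially. \<forall>z\<in>K. dist (case z of (x, p) \<Rightarrow> Hs i t x p) (case z of (x, p) \<Rightarrow> H t x p) < e"
          using ul unfolding uniform_limit_iff by blast
        then have "\<forall>\<^sub>F i in sequentially. norm (Hs i t (xs i t) q - H t (xs i t) q - 0) < e"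
          by eventually_elim (auto simp: K_def dist_norm)
        then show "\<exists>no. \<forall>i\<ge>no. norm (Hs i t (xs i t) q - H t (xs i t) q - 0) < e"
          by (simp add: eventually_sequentially)
      qed
      moreover have "(\<lambda>i. H t (xs i t) q) \<longlonglongrightarrow> H t (x t) q"
        using continuous_on_tendsto_compose[OF Hc[OF tT(1)], of "\<lambda>i. (xs i t, q)" "(x t, q)" sequentially]
          tendsto_Pair[OF x[OF tT(1)] tendsto_const[of q]] by simp
      ultimately show ?thesis using tendsto_add by fastforce
    qed
    show ?thesis
    proof (rule field_le_epsilon)
      fix \<epsilon> :: real assume \<epsilon>: "0 < \<epsilon>"
      have "\<forall>\<^sub>F i in sequentially. Hs i t (xs i t) q < H t (x t) q + \<epsilon>"
        using Hlim by (rule order_tendstoD) (use \<epsilon> in simp)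
      then have "\<forall>\<^sub>F i in sequentially. vs i t \<bullet> q - (H t (x t) q + \<epsilon>) \<le> rs i t"
        using \<open>\<forall>\<^sub>F i in sequentially. ts i < t\<close>
      proof eventually_elim
        case (elim i)
        then show ?case using E[of t i q] tT(1) by force
      qed
      then obtain m where m: "\<And>i. i \<ge> m \<Longrightarrow> vs i t \<bullet> q - (H t (x t) q + \<epsilon>) \<le> rs i t" by (auto simp: eventually_sequentially)
      have "u n t \<bullet> q - (H t (x t) q + \<epsilon>) \<le> R n t" if n: "n \<ge> m" for n
      proof -
        \<comment> \<open>Each pair satisfies the constraint at its own state. Once those values of
          \<open>Hs i\<close> are replaced by the common bound
          \<open>H t (x t) q + \<epsilon>\<close>, a fixed \<open>q\<close> gives one half-space for
          the whole tail, and midpoints stay in it.\<close>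
        let ?C = "{z::'a \<times> real. (q, -1) \<bullet> z \<le> H t (x t) q + \<epsilon>}"
        have "(u n t, R n t) \<in> ?C"
        proof (rule pw[OF convex_halfspace_le])
          fix i assume "n \<le> i"
          then show "(vs i t, rs i t) \<in> ?C" using m[of i] n by (simp add: inner_commute)
        qed
        then show ?thesis by (simp add: inner_commute)
      qed
      then have ev: "\<forall>\<^sub>F n in sequentially. ennreal (u n t \<bullet> q - (H t (x t) q + \<epsilon>) + \<psi> t) \<le> ennreal (R n t + \<psi> t)"
        unfolding eventually_sequentially by (meson add_right_mono ennreal_leI)
      have "(\<lambda>n. u n t \<bullet> q - (H t (x t) q + \<epsilon>) + \<psi> t) \<longlonglongrightarrow> v t \<bullet> q - (H t (x t) q + \<epsilon>) + \<psi> t"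
        using uv[of t] tT by (intro tendsto_intros) auto
      then have "(\<lambda>n. ennreal (u n t \<bullet> q - (H t (x t) q + \<epsilon>) + \<psi> t)) \<longlonglongrightarrow> ennreal (v t \<bullet> q - (H t (x t) q + \<epsilon>) + \<psi> t)"
        by (rule tendsto_ennrealI)
      then have "ennreal (v t \<bullet> q - (H t (x t) q + \<epsilon>) + \<psi> t) = liminf (\<lambda>n. ennreal (u n t \<bullet> q - (H t (x t) q + \<epsilon>) + \<psi> t))"
        by (simp add: lim_imp_Liminf)
      also have "\<dots> \<le> G t" unfolding G_def by (rule Liminf_mono[OF ev])
      finally have "ennreal (v t \<bullet> q - (H t (x t) q + \<epsilon>) + \<psi> t) \<le> G t" .
      moreover have "G t < top" using N0(2)[of t] tT by (auto simp: N_def less_top)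
      ultimately have "enn2real (ennreal (v t \<bullet> q - (H t (x t) q + \<epsilon>) + \<psi> t)) \<le> enn2real (G t)"
        by (rule enn2real_mono)
      \<comment> \<open>\<open>ennreal\<close> truncates a negative left-hand side, but then the
        claim is trivial because the right-hand side is nonnegative.\<close>
      then have "v t \<bullet> q - (H t (x t) q + \<epsilon>) + \<psi> t \<le> enn2real (G t)"
        by (metis enn2real_ennreal enn2real_nonneg linear order_trans)
      then show "v t \<bullet> q - H t (x t) q \<le> r t + \<epsilon>" using tT by (simp add: r_def)
    qed
  qed

  \<comment> \<open>Integrability and bound of the limit cost\<close>
  have GR: "integrable ?M (\<lambda>t. enn2real (G t))" "integral\<^sup>L ?M (\<lambda>t. enn2real (G t)) \<le> D"
  proof -
    have eq: "(\<integral>\<^sup>+t. ennreal (enn2real (G t)) \<partial>?M) = (\<integral>\<^sup>+t. G t \<partial>?M)"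
    proof (rule nn_integral_cong_AE)
      show "AE t in ?M. ennreal (enn2real (G t)) = G t"
        using \<open>AE t in ?M. G t \<noteq> \<infinity>\<close> by eventually_elim (simp add: less_top)
    qed
    show "integrable ?M (\<lambda>t. enn2real (G t))"
      by (rule integrableI_nonneg) (use eq GD in \<open>auto simp: less_top[symmetric] top_unique\<close>)
    then have "ennreal (integral\<^sup>L ?M (\<lambda>t. enn2real (G t))) \<le> ennreal D"
      using nn_integral_eq_integral[of ?M "\<lambda>t. enn2real (G t)"] eq GD by simp
    then show "integral\<^sup>L ?M (\<lambda>t. enn2real (G t)) \<le> D" using D0 by simp
  qed
  define r1 where "r1 t = enn2real (G t) - \<psi> t" for t
  have r1: "integrable ?M r1" "integral\<^sup>L ?M r1 \<le> B"
    using GR \<psi>M by (simp_all add: r1_def[abs_def] D_def)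
  \<comment> \<open>Before \<open>t0\<close> the combined costs are eventually 0, so
    \<open>G\<close> equals \<open>\<psi>\<close> there and the value 0 of \<open>r\<close> agrees
    with the formula for \<open>r1\<close>.\<close>
  have r_r1: "r t = r1 t" if t: "t \<in> {0..T}" for t
  proof (cases "t < t0")
    case True
    have "G t = liminf (\<lambda>n. ennreal (\<psi> t))" unfolding G_def
      by (rule Liminf_eq) (use early[OF True] in \<open>auto elim!: eventually_mono\<close>)
    then have "G t = ennreal (\<psi> t)" by (simp add: Liminf_const)
    moreover have "0 \<le> \<psi> t"
    proof -
      obtain n where "R n t = 0" using eventually_happens[OF early[OF True]] by auto
      then show ?thesis using Rb[OF t, of n] by simp
    qed
    ultimately show ?thesis using True by (simp add: r_def r1_def)
  qed (simp add: r_def r1_def)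
  have r1a: "r1 absolutely_integrable_on {0..T}" using r1(1) by (simp add: absolutely_integrable_on_iff_integrable)
  have ra: "r absolutely_integrable_on {0..T}"
    by (rule absolutely_integrable_spike[OF r1a negligible_empty]) (simp add: r_r1)
  have "integral {0..T} r = integral {0..T} r1" by (rule Henstock_Kurzweil_Integration.integral_cong) (rule r_r1)
  also have "\<dots> \<le> B" using r1 lebesgue_integral_eq_integral[OF r1(1) leb] by simp
  finally have rB: "integral {0..T} r \<le> B" .
  have "value_fun T g (steiner_f H) (steiner_l H) (t0, x 0) \<le> g (x T) + ereal (integral {0..T} r)"
  proof (rule value_fun_le_traj[OF t0 va ra])
    show "v t = 0" "r t = 0" if "t < t0" for t using that by (simp_all add: v_def r_def)
    show "x t = x 0 + integral {0..t} v" if "t \<in> {0..T}" for t by (rule xv[OF that])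
    show "negligible N" by (rule N)
    show "v t \<bullet> p - H t (x t) p \<le> r t" if "t \<in> {t0..T} - N" for t p by (rule HE[OF that])
  qed
  also have "\<dots> \<le> g (x T) + ereal B" using rB by (intro add_left_mono) simp
  finally show ?thesis .
qed

section \<open>Filippov trajectories\<close>

lemma integral_nonneg_interval_mono:
  fixes f :: "real \<Rightarrow> real"
  assumes "f integrable_on {0..T}" "\<And>t. t \<in> {0..T} \<Longrightarrow> 0 \<le> f t" "t \<in> {0..T}"
  shows "0 \<le> integral {t..T} f" "integral {t..T} f \<le> integral {0..T} f" "integral {0..t} f \<le> integral {0..T} f"
proof -
  have sub: "{t..T} \<subseteq> {0..T}" "{0..t} \<subseteq> {0..T}" using assms(3) by auto
  note i = integrable_subinterval_real[OF assms(1) sub(1)] integrable_subinterval_real[OF assms(1) sub(2)]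
  show "0 \<le> integral {t..T} f" by (rule integral_nonneg[OF i(1)]) (use assms(2) sub in blast)
  show "integral {t..T} f \<le> integral {0..T} f" by (rule integral_subset_le[OF sub(1) i(1) assms(1)]) (use assms(2) in blast)
  show "integral {0..t} f \<le> integral {0..T} f" by (rule integral_subset_le[OF sub(2) i(2) assms(1)]) (use assms(2) in blast)
qed

text \<open>Filippov's successive selections, run backwards from the end point \<open>z\<close>: the velocity is
  repeatedly projected so that \<open>(w', \<rho> + e)\<close> lies in the epigraph along the current curve, and the
  defect \<open>e\<close> of the next curve is controlled by the Lipschitz bound in the state. The exponential
  weight makes the defects decay geometrically.\<close>

lemma filippov_trajectory:
  fixes G :: "real \<Rightarrow> 'a::euclidean_space \<Rightarrow> 'a \<Rightarrow> real" and z :: 'a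
  assumes G: "ham_hyps T c k G" and t0: "t0 \<in> {0..T}" and R: "0 < R"
    and \<kappa>: "k R absolutely_integrable_on {0..T}" and \<kappa>0: "\<And>t. 0 \<le> k R t"
    and v: "v absolutely_integrable_on {0..T}" and r: "r absolutely_integrable_on {0..T}"
    and vr0: "\<And>t. t < t0 \<Longrightarrow> v t = 0" "\<And>t. t < t0 \<Longrightarrow> r t = 0"
    and x: "\<And>t. t \<in> {0..T} \<Longrightarrow> x t = x 0 + integral {0..t} v"
    and xR: "\<And>t. t \<in> {0..T} \<Longrightarrow> norm (x t) + 1 \<le> R"
    and e0: "e0 absolutely_integrable_on {0..T}" "\<And>t. 0 \<le> e0 t" "\<And>t. t < t0 \<Longrightarrow> e0 t = 0"
    and E0: "\<And>t p. t \<in> {t0..T} \<Longrightarrow> v t \<bullet> p - G t (x t) p \<le> r t + e0 t * (1 + norm p)"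
  defines "K \<equiv> integral {0..T} (k R)"
    and "\<delta> \<equiv> norm (z - x T) + integral {0..T} e0"
  assumes small: "3 * \<delta> * exp (2 * K) \<le> 1"
  obtains y w \<rho> where "traj T G t0 y w \<rho>" "y T = z"
    "\<And>t. t \<in> {0..T} \<Longrightarrow> norm (y t - x t) \<le> 3 * \<delta> * exp (2 * K)"
    "integral {0..T} \<rho> \<le> integral {0..T} r + 2 * \<delta> * exp (2 * K)"
proof -
  let ?M = "lebesgue_on {0..T}"
  define \<kappa>' where "\<kappa>' = k R"
  note \<kappa> = \<kappa>[folded \<kappa>'_def] and \<kappa>0 = \<kappa>0[folded \<kappa>'_def]
  have K: "K = integral {0..T} \<kappa>'" by (simp add: K_def \<kappa>'_def)
  have leb: "{0..T} \<in> sets lebesgue" by simp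
  have idm[measurable]: "(\<lambda>t::real. t) \<in> borel_measurable ?M"
    by (rule continuous_imp_measurable_on_sets_lebesgue[OF continuous_on_id leb])
  have T: "0 \<le> T" "T \<in> {0..T}" "0 \<in> {0..T}" using t0 by auto
  have hi: "f integrable_on {s..t}" if "f absolutely_integrable_on {0..T}" "s \<in> {0..T}" "t \<in> {0..T}"
    for f :: "real \<Rightarrow> 'b::euclidean_space" and s t
    by (rule integrable_subinterval_real[of _ 0 T]) (use that set_lebesgue_integral_eq_integral(1)[OF that(1)] in auto)
  have split: "integral {0..T} f - integral {0..t} f = integral {t..T} f"
    if "f absolutely_integrable_on {0..T}" "t \<in> {0..T}" for f :: "real \<Rightarrow> 'b::euclidean_space" and t
    by (rule integral_diff_interval) (use that hi[OF that(1) T(3) T(2)] in auto)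
  have Gm: "(\<lambda>t. G t x p) \<in> borel_measurable ?M" for x p using G unfolding ham_hyps_def by blast
  have Gc: "continuous_on UNIV (\<lambda>(x, p). G t x p)" if "t \<in> {0..T}" for t using G that unfolding ham_hyps_def by blast
  have Gcv: "convex_on UNIV (G t x)" if "t \<in> {0..T}" for t x using G that unfolding ham_hyps_def by blast
  have Gk: "\<bar>G t x p - G t y p\<bar> \<le> \<kappa>' t * (1 + norm p) * norm (x - y)"
    if "t \<in> {0..T}" "norm x \<le> R" "norm y \<le> R" for t x y p
    using G R that unfolding ham_hyps_def \<kappa>'_def by (metis mem_cball_0)
  have Gcx: "continuous_on UNIV (\<lambda>x. G t x p)" if "t \<in> {0..T}" for t p
    using continuous_on_compose2[OF Gc[OF that] continuous_on_Pair[OF continuous_on_id continuous_on_const]] by simp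
  have Gcp: "continuous_on UNIV (G t x)" if "t \<in> {0..T}" for t x
    using continuous_on_compose2[OF Gc[OF that] continuous_on_Pair[OF continuous_on_const continuous_on_id]] by simp

  \<comment> \<open>The exponential weight\<close>
  define C where "C t = integral {0..t} \<kappa>'" for t
  \<comment> \<open>This is \<open>exp (2 * (K - C t))\<close>: it equals 1 at \<open>T\<close> and
    grows backwards in time, as errors do when the end point is fixed.\<close>
  define W where "W t = exp (2 * K) * exp (-2 * C t)" for t
  have CK: "0 \<le> C t" "C t \<le> K" "K - C t = integral {t..T} \<kappa>'" if t: "t \<in> {0..T}" for t
  proof -
    show "0 \<le> C t" unfolding C_def by (rule integral_nonneg[OF hi[OF \<kappa> T(3) t]]) (rule \<kappa>0)
    show "C t \<le> K" unfolding C_def K by (rule integral_nonneg_interval_mono(3)[OF hi[OF \<kappa> T(3,2)] _ t]) (rule \<kappa>0)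
    show "K - C t = integral {t..T} \<kappa>'" unfolding C_def K by (rule split[OF \<kappa> t])
  qed
  have K0: "0 \<le> K" using CK(1)[OF T(2)] by (simp add: C_def K)
  have W1: "1 \<le> W t" "W t \<le> exp (2 * K)" "integral {t..T} \<kappa>' \<le> W t" if t: "t \<in> {0..T}" for t
  proof -
    have W: "W t = exp (2 * (K - C t))" by (simp add: W_def mult_exp_exp algebra_simps)
    show "1 \<le> W t" using CK[OF t] by (simp add: W)
    show "W t \<le> exp (2 * K)" using CK[OF t] by (simp add: W)
    have "1 + 2 * (K - C t) \<le> W t" unfolding W by (rule exp_ge_add_one_self)
    then show "integral {t..T} \<kappa>' \<le> W t" using CK[OF t] by simp
  qed
  have contC: "continuous_on {0..T} C" unfolding C_def by (rule indefinite_integral_continuous_1[OF hi[OF \<kappa> T(3,2)]])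
  have contW: "continuous_on {0..T} W" unfolding W_def by (intro continuous_intros contC)
  have \<kappa>W: "integral {t..T} (\<lambda>\<tau>. \<kappa>' \<tau> * W \<tau>) \<le> W t / 2" if t: "t \<in> {0..T}" for t
  proof -
    have "integral {t..T} (\<lambda>\<tau>. \<kappa>' \<tau> * W \<tau>) = integral {t..T} (\<lambda>\<tau>. exp (2 * K) * (\<kappa>' \<tau> * exp (-2 * C \<tau>)))"
      by (simp add: W_def mult_ac)
    also have "\<dots> = exp (2 * K) * integral {t..T} (\<lambda>\<tau>. \<kappa>' \<tau> * exp (-2 * C \<tau>))" by simp
    also have "\<dots> \<le> exp (2 * K) * (exp (-2 * C t) / 2)"
      using integral_exp_weight_le(2)[OF \<kappa> t] unfolding C_def by (intro mult_left_mono) auto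
    finally show ?thesis by (simp add: W_def)
  qed
  have e0n: "0 \<le> integral {0..T} e0" by (rule integral_nonneg[OF hi[OF e0(1) T(3,2)]]) (rule e0(2))
  have \<delta>0: "0 \<le> \<delta>" unfolding \<delta>_def using e0n by simp
  have WR: "norm y \<le> R" if "t \<in> {0..T}" "norm (y - x t) \<le> 3 * \<delta> * W t" for y t
  proof -
    have "3 * \<delta> * W t \<le> 3 * \<delta> * exp (2 * K)" using W1(2)[OF that(1)] \<delta>0 by (intro mult_left_mono) auto
    then have "norm (y - x t) \<le> 1" using that(2) small by linarith
    then show ?thesis using xR[OF that(1)] norm_triangle_sub[of y "x t"] by linarith
  qed
  \<comment> \<open>The defects halve, and each is paid once as displacement and once as cost. Since
    the powers \<open>1 / 2 ^ j\<close> with \<open>j < n\<close> sum to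
    \<open>2 - 2 / 2 ^ n\<close>, this is the factor in the cost; the factor for the curve has an
    additional 1 for the initial shift by \<open>z - x T\<close>.\<close>
  define P where "P n s = (case s of (y :: real \<Rightarrow> 'a, w :: real \<Rightarrow> 'a, \<rho> :: real \<Rightarrow> real, e :: real \<Rightarrow> real) \<Rightarrow>
      w absolutely_integrable_on {0..T} \<and> \<rho> absolutely_integrable_on {0..T} \<and> e absolutely_integrable_on {0..T} \<and>
      (\<forall>t. 0 \<le> e t) \<and> (\<forall>t<t0. w t = 0 \<and> \<rho> t = 0 \<and> e t = 0) \<and>
      (\<forall>t\<in>{0..T}. y t = z - integral {t..T} w) \<and>
      (\<forall>t\<in>{t0..T}. \<forall>p. w t \<bullet> p - G t (y t) p \<le> \<rho> t + e t * (1 + norm p)) \<and>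
      (\<forall>t\<in>{0..T}. integral {t..T} e \<le> \<delta> * W t / 2 ^ n) \<and>
      (\<forall>t\<in>{0..T}. norm (y t - x t) \<le> \<delta> * W t * (3 - 2 / 2 ^ n)) \<and>
      integral {0..T} \<rho> \<le> integral {0..T} r + \<delta> * W 0 * (2 - 2 / 2 ^ n))" for n :: nat and s
  \<comment> \<open>The exact constraint relates the new velocity to the old curve. Consecutive
    curves have the same limit, so this suffices.\<close>
  define Q where "Q n s s' = (case s of (y :: real \<Rightarrow> 'a, w :: real \<Rightarrow> 'a, \<rho> :: real \<Rightarrow> real, e :: real \<Rightarrow> real) \<Rightarrow>
      case s' of (y' :: real \<Rightarrow> 'a, w' :: real \<Rightarrow> 'a, \<rho>' :: real \<Rightarrow> real, e' :: real \<Rightarrow> real) \<Rightarrow>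
      (\<forall>t. \<rho>' t = \<rho> t + e t) \<and> (\<forall>t\<in>{0..T}. norm (w' t - w t) \<le> e t) \<and>
      (\<forall>t\<in>{t0..T}. \<forall>p. w' t \<bullet> p - G t (y t) p \<le> \<rho>' t) \<and>
      (\<forall>t\<in>{0..T}. norm (y' t - y t) \<le> \<delta> * W t / 2 ^ n) \<and>
      (\<forall>t\<in>{0..T}. e' t \<le> \<kappa>' t * norm (y' t - y t)))" for n :: nat and s s'
  \<comment> \<open>By \<open>small\<close>, every curve stays within distance 1 of
    \<open>x\<close>, hence in the ball of radius \<open>R\<close> where \<open>k R\<close> is a
    Lipschitz bound.\<close>
  have NR: "norm y \<le> R" if "t \<in> {0..T}" "norm (y - x t) \<le> \<delta> * W t * (3 - 2 / 2 ^ n)" for y t and n :: nat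
  proof (rule WR[OF that(1)])
    have "\<delta> * W t * (3 - 2 / 2 ^ n) \<le> \<delta> * W t * 3"
      using \<delta>0 W1(1)[OF that(1)] by (intro mult_left_mono) auto
    then show "norm (y - x t) \<le> 3 * \<delta> * W t" using that(2) by (simp add: mult_ac)
  qed

  \<comment> \<open>The translated initial curve\<close>
  have base: "\<exists>s. P 0 s"
  proof -
    define a where "a = norm (z - x T)"
    define y where "y t = z - integral {t..T} v" for t
    \<comment> \<open>The first curve is \<open>x\<close> translated so that it ends at
      \<open>z\<close>. By (HLC) the translation adds at most \<open>\<kappa>' t * a\<close> to the
      defect.\<close>
    define e where "e t = e0 t + (if t < t0 then 0 else \<kappa>' t * a)" for t
    have yx: "y t = x t + (z - x T)" if "t \<in> {0..T}" for t
      using x[OF that] x[OF T(2)] split[OF v that] by (simp add: y_def algebra_simps)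
    have ind: "(\<lambda>t. if t < t0 then 0 else \<kappa>' t * a) absolutely_integrable_on {0..T}"
    proof (rule measurable_bounded_by_integrable_imp_absolutely_integrable[OF _ leb])
      have [measurable]: "\<kappa>' \<in> borel_measurable ?M" using \<kappa> by (simp add: absolutely_integrable_on_iff_integrable borel_measurable_integrable)
      show "(\<lambda>t. if t < t0 then 0 else \<kappa>' t * a) \<in> borel_measurable ?M" by measurable
      show "(\<lambda>t. \<kappa>' t * a) integrable_on {0..T}" by (intro integrable_on_mult_left hi[OF \<kappa> T(3,2)])
    qed (auto simp: a_def \<kappa>0)
    have ea: "e absolutely_integrable_on {0..T}" unfolding e_def using e0(1) ind by (rule set_integral_add(1))
    have "P 0 (y, v, r, e)" unfolding P_def prod.case
    proof (intro conjI allI impI ballI)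
      show "v absolutely_integrable_on {0..T}" "r absolutely_integrable_on {0..T}" "e absolutely_integrable_on {0..T}"
        by (rule v r ea)+
      show "0 \<le> e t" for t using e0(2) \<kappa>0 by (simp add: e_def a_def)
      show "v t = 0" "r t = 0" "e t = 0" if "t < t0" for t using that vr0 e0(3) by (auto simp: e_def)
      show "y t = z - integral {t..T} v" for t by (simp add: y_def)
    next
      fix t p assume t: "t \<in> {t0..T}"
      then have tT: "t \<in> {0..T}" using t0 by auto
      have a1: "a \<le> 1"
      proof -
        have "a * 1 \<le> \<delta> * exp (2 * K)" unfolding \<delta>_def a_def using e0n K0 by (intro mult_mono) auto
        moreover have "0 \<le> \<delta> * exp (2 * K)" "3 * (\<delta> * exp (2 * K)) \<le> 1" using \<delta>0 small by simp_all
        ultimately show ?thesis by linarith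
      qed
      have "norm (y t) \<le> norm (x t) + a" using yx[OF tT] norm_triangle_ineq[of "x t" "z - x T"] by (simp add: a_def)
      then have "norm (y t) \<le> R" "norm (x t) \<le> R" using xR[OF tT] a1 by auto
      then have "\<bar>G t (x t) p - G t (y t) p\<bar> \<le> \<kappa>' t * (1 + norm p) * norm (x t - y t)" by (intro Gk tT)
      also have "norm (x t - y t) = a" using yx[OF tT] by (simp add: a_def norm_minus_commute)
      finally have "G t (x t) p - G t (y t) p \<le> \<kappa>' t * (1 + norm p) * a" by (simp add: abs_le_iff)
      moreover have "e t * (1 + norm p) = e0 t * (1 + norm p) + \<kappa>' t * (1 + norm p) * a"
        using t by (simp add: e_def algebra_simps)
      ultimately show "v t \<bullet> p - G t (y t) p \<le> r t + e t * (1 + norm p)" using E0[OF t, of p] by linarith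
    next
      fix t assume t: "t \<in> {0..T}"
      have "integral {t..T} e \<le> integral {t..T} (\<lambda>t. e0 t + \<kappa>' t * a)"
        by (rule integral_le[OF hi[OF ea t T(2)]])
           (auto simp: e_def a_def \<kappa>0 intro!: Henstock_Kurzweil_Integration.integrable_add integrable_on_mult_left hi[OF e0(1) t T(2)] hi[OF \<kappa> t T(2)])
      also have "\<dots> = integral {t..T} e0 + integral {t..T} \<kappa>' * a"
        using hi[OF e0(1) t T(2)] hi[OF \<kappa> t T(2)] by (subst Henstock_Kurzweil_Integration.integral_add) (auto intro: integrable_on_mult_left)
      also have "\<dots> \<le> integral {0..T} e0 * W t + W t * a"
      proof (rule add_mono)
        have "integral {t..T} e0 \<le> integral {0..T} e0 * 1"
          using integral_nonneg_interval_mono(2)[OF hi[OF e0(1) T(3,2)] _ t] e0(2) by simp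
        also have "\<dots> \<le> integral {0..T} e0 * W t" using W1(1)[OF t] e0n by (rule mult_left_mono)
        finally show "integral {t..T} e0 \<le> integral {0..T} e0 * W t" .
        show "integral {t..T} \<kappa>' * a \<le> W t * a" using W1(3)[OF t] by (rule mult_right_mono) (simp add: a_def)
      qed
      also have "\<dots> = \<delta> * W t / 2 ^ 0" by (simp add: \<delta>_def a_def algebra_simps)
      finally show "integral {t..T} e \<le> \<delta> * W t / 2 ^ 0" .
      have "norm (y t - x t) \<le> \<delta> * 1" using yx[OF t] e0n by (simp add: \<delta>_def)
      also have "\<dots> \<le> \<delta> * W t" using W1(1)[OF t] \<delta>0 by (rule mult_left_mono)
      finally show "norm (y t - x t) \<le> \<delta> * W t * (3 - 2 / 2 ^ 0)" by simp
    qed simp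
    then show ?thesis by blast
  qed

  \<comment> \<open>One selection step\<close>
  have step: "\<exists>s'. P (Suc n) s' \<and> Q n s s'" if Ps: "P n s" for n s
  proof -
    obtain y w \<rho> e where s: "s = (y, w, \<rho>, e)" by (cases s) auto
    have wa: "w absolutely_integrable_on {0..T}" and \<rho>a: "\<rho> absolutely_integrable_on {0..T}"
      and ea: "e absolutely_integrable_on {0..T}"
      and en: "\<And>t. 0 \<le> e t" and z0: "\<And>t. t < t0 \<Longrightarrow> w t = 0" "\<And>t. t < t0 \<Longrightarrow> \<rho> t = 0" "\<And>t. t < t0 \<Longrightarrow> e t = 0"
      and y: "\<And>t. t \<in> {0..T} \<Longrightarrow> y t = z - integral {t..T} w"
      and E: "\<And>t p. t \<in> {t0..T} \<Longrightarrow> w t \<bullet> p - G t (y t) p \<le> \<rho> t + e t * (1 + norm p)"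
      and D: "\<And>t. t \<in> {0..T} \<Longrightarrow> integral {t..T} e \<le> \<delta> * W t / 2 ^ n"
      and N: "\<And>t. t \<in> {0..T} \<Longrightarrow> norm (y t - x t) \<le> \<delta> * W t * (3 - 2 / 2 ^ n)"
      and I: "integral {0..T} \<rho> \<le> integral {0..T} r + \<delta> * W 0 * (2 - 2 / 2 ^ n)"
      using Ps unfolding s P_def prod.case by blast+
    have [measurable]: "w \<in> borel_measurable ?M" "\<rho> \<in> borel_measurable ?M" "e \<in> borel_measurable ?M"
      using wa \<rho>a ea by (simp_all add: absolutely_integrable_on_iff_integrable borel_measurable_integrable)
    have yc: "continuous_on {0..T} y"
    proof -
      have "continuous_on {0..T} (\<lambda>t. z - (integral {0..T} w - integral {0..t} w))"
        by (intro continuous_intros indefinite_integral_continuous_1[OF hi[OF wa T(3,2)]])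
      then show ?thesis by (rule continuous_on_eq) (simp add: y split[OF wa])
    qed
    have ym: "y \<in> borel_measurable ?M" by (rule continuous_imp_measurable_on_sets_lebesgue[OF yc leb])
    have [measurable]: "(\<lambda>t. G t (y t) p) \<in> borel_measurable ?M" for p
      by (rule borel_measurable_caratheodory[OF Gm _ ym]) (simp add: Gcx)
    \<comment> \<open>The defect \<open>e * (1 + norm p)\<close> is split: adding \<open>e\<close>
      to the cost removes the constant part, and the sandwich removes \<open>e * norm p\<close> by
      moving the velocity by at most \<open>e\<close>. Before \<open>t0\<close> the zero function
      keeps the selection problem solvable on all of [0, T].\<close>
    define h where "h t p = (if t < t0 then 0 else G t (y t) p + (\<rho> t + e t))" for t p
    have "\<exists>u\<in>borel_measurable ?M. \<forall>t\<in>space ?M. norm (u t - w t) \<le> e t \<and> (\<forall>p. u t \<bullet> p \<le> h t p)"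
    proof (rule measurable_sandwich_selection)
      show "(\<lambda>t. h t p) \<in> borel_measurable ?M" for p unfolding h_def by measurable
      show "convex_on UNIV (h t)" if "t \<in> space ?M" for t
        using that by (cases "t < t0") (auto simp: h_def[abs_def] convex_on_const intro!: convex_on_add Gcv)
      show "continuous_on UNIV (h t)" if "t \<in> space ?M" for t
        using that by (cases "t < t0") (auto simp: h_def[abs_def] intro!: continuous_intros Gcp)
      show "w \<in> borel_measurable ?M" by measurable
      show "0 \<le> e t" for t by (rule en)
      show "w t \<bullet> p - e t * norm p \<le> h t p" if "t \<in> space ?M" for t p
        using that z0[of t] E[of t p] by (cases "t < t0") (auto simp: h_def algebra_simps)
    qed
    then obtain u where u: "u \<in> borel_measurable ?M" "\<And>t. t \<in> {0..T} \<Longrightarrow> norm (u t - w t) \<le> e t"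
      "\<And>t p. t \<in> {0..T} \<Longrightarrow> u t \<bullet> p \<le> h t p" by auto
    define w' where "w' t = (if t < t0 then 0 else u t)" for t
    define \<rho>' where "\<rho>' t = \<rho> t + e t" for t
    define y' where "y' t = z - integral {t..T} w'" for t
    define e' where "e' t = (if t < t0 then 0 else \<kappa>' t * norm (y' t - y t))" for t
    have w'w: "norm (w' t - w t) \<le> e t" if "t \<in> {0..T}" for t using u(2)[OF that] z0[of t] by (simp add: w'_def)
    have w'm: "w' \<in> borel_measurable ?M" unfolding w'_def using u(1) by measurable
    have w'a: "w' absolutely_integrable_on {0..T}"
    proof (rule measurable_bounded_by_integrable_imp_absolutely_integrable[OF w'm leb])
      show "(\<lambda>t. norm (w t) + e t) integrable_on {0..T}"
        using wa hi[OF ea T(3,2)] by (intro Henstock_Kurzweil_Integration.integrable_add) (auto simp: absolutely_integrable_on_def)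
      show "norm (w' t) \<le> norm (w t) + e t" if "t \<in> {0..T}" for t
        using w'w[OF that] norm_triangle_sub[of "w' t" "w t"] by linarith
    qed
    have \<rho>'a: "\<rho>' absolutely_integrable_on {0..T}" unfolding \<rho>'_def using \<rho>a ea by (rule set_integral_add(1))
    have yy: "norm (y' t - y t) \<le> \<delta> * W t / 2 ^ n" if t: "t \<in> {0..T}" for t
    proof -
      have "y' t - y t = integral {t..T} (\<lambda>t. w t - w' t)"
        using hi[OF wa t T(2)] hi[OF w'a t T(2)] by (simp add: y[OF t] y'_def Henstock_Kurzweil_Integration.integral_diff)
      also have "norm \<dots> \<le> integral {t..T} e"
        by (rule integral_norm_bound_integral[OF Henstock_Kurzweil_Integration.integrable_diff[OF hi[OF wa t T(2)] hi[OF w'a t T(2)]] hi[OF ea t T(2)]])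
           (use w'w t in \<open>auto simp: norm_minus_commute\<close>)
      also note D[OF t]
      finally show ?thesis .
    qed
    have y'c: "continuous_on {0..T} y'"
    proof -
      have "continuous_on {0..T} (\<lambda>t. z - (integral {0..T} w' - integral {0..t} w'))"
        by (intro continuous_intros indefinite_integral_continuous_1[OF hi[OF w'a T(3,2)]])
      then show ?thesis by (rule continuous_on_eq) (simp add: y'_def split[OF w'a])
    qed
    have \<kappa>y: "(\<lambda>t. \<kappa>' t * norm (y' t - y t)) absolutely_integrable_on {0..T}"
      by (intro absolutely_integrable_mult_continuous \<kappa> continuous_intros yc y'c)
    have e'a: "e' absolutely_integrable_on {0..T}"
    proof (rule measurable_bounded_by_integrable_imp_absolutely_integrable[OF _ leb hi[OF \<kappa>y T(3,2)]])
      have [measurable]: "(\<lambda>t. \<kappa>' t * norm (y' t - y t)) \<in> borel_measurable ?M"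
        using \<kappa>y by (simp add: absolutely_integrable_on_iff_integrable borel_measurable_integrable)
      show "e' \<in> borel_measurable ?M" unfolding e'_def by measurable
    qed (auto simp: e'_def \<kappa>0)
    have N': "norm (y' t - x t) \<le> \<delta> * W t * (3 - 2 / 2 ^ Suc n)" if t: "t \<in> {0..T}" for t
    proof -
      have "norm (y' t - x t) \<le> norm (y' t - y t) + norm (y t - x t)" using norm_triangle_ineq[of "y' t - y t" "y t - x t"] by simp
      also have "\<dots> \<le> \<delta> * W t / 2 ^ n + \<delta> * W t * (3 - 2 / 2 ^ n)" using yy[OF t] N[OF t] by (rule add_mono)
      also have "\<dots> = \<delta> * W t * (3 - 2 / 2 ^ Suc n)" by (simp add: field_simps)
      finally show ?thesis .
    qed
    have "P (Suc n) (y', w', \<rho>', e')" unfolding P_def prod.case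
    proof (intro conjI allI impI ballI)
      show "w' absolutely_integrable_on {0..T}" "\<rho>' absolutely_integrable_on {0..T}" "e' absolutely_integrable_on {0..T}"
        by (rule w'a \<rho>'a e'a)+
      show "0 \<le> e' t" for t by (simp add: e'_def \<kappa>0)
      show "w' t = 0" "\<rho>' t = 0" "e' t = 0" if "t < t0" for t using that z0[of t] by (auto simp: w'_def \<rho>'_def e'_def)
      show "y' t = z - integral {t..T} w'" for t by (simp add: y'_def)
    next
      fix t p assume t: "t \<in> {t0..T}"
      then have tT: "t \<in> {0..T}" using t0 by auto
      have "\<bar>G t (y t) p - G t (y' t) p\<bar> \<le> \<kappa>' t * (1 + norm p) * norm (y t - y' t)"
        by (rule Gk[OF tT NR[OF tT N[OF tT]] NR[OF tT N'[OF tT]]])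
      then have "G t (y t) p - G t (y' t) p \<le> \<kappa>' t * norm (y' t - y t) * (1 + norm p)"
        by (simp add: abs_le_iff norm_minus_commute mult_ac)
      moreover have "w' t \<bullet> p - G t (y t) p \<le> \<rho>' t" using u(3)[OF tT, of p] t by (simp add: h_def w'_def \<rho>'_def)
      ultimately show "w' t \<bullet> p - G t (y' t) p \<le> \<rho>' t + e' t * (1 + norm p)" using t by (simp add: e'_def)
    next
      fix t assume t: "t \<in> {0..T}"
      have i: "(\<lambda>\<tau>. \<kappa>' \<tau> * W \<tau> * (\<delta> / 2 ^ n)) integrable_on {t..T}"
        by (intro integrable_on_mult_left hi[OF absolutely_integrable_mult_continuous[OF \<kappa> contW] t T(2)])
      \<comment> \<open>The bound on \<open>y' - y\<close> carries the weight \<open>W\<close>,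
        whose integral against \<open>\<kappa>'\<close> returns at most half of it; this is the
        geometric decay.\<close>
      have "integral {t..T} e' \<le> integral {t..T} (\<lambda>\<tau>. \<kappa>' \<tau> * W \<tau> * (\<delta> / 2 ^ n))"
      proof (rule integral_le[OF hi[OF e'a t T(2)] i])
        fix \<tau> assume "\<tau> \<in> {t..T}"
        then have tT: "\<tau> \<in> {0..T}" using t by auto
        have "e' \<tau> \<le> \<kappa>' \<tau> * norm (y' \<tau> - y \<tau>)" by (simp add: e'_def \<kappa>0)
        also have "\<dots> \<le> \<kappa>' \<tau> * (\<delta> * W \<tau> / 2 ^ n)" by (rule mult_left_mono[OF yy[OF tT] \<kappa>0])
        finally show "e' \<tau> \<le> \<kappa>' \<tau> * W \<tau> * (\<delta> / 2 ^ n)" by (simp add: mult_ac)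
      qed
      also have "\<dots> = integral {t..T} (\<lambda>\<tau>. \<kappa>' \<tau> * W \<tau>) * (\<delta> / 2 ^ n)" by simp
      also have "\<dots> \<le> W t / 2 * (\<delta> / 2 ^ n)" using \<kappa>W[OF t] \<delta>0 by (intro mult_right_mono) auto
      finally show "integral {t..T} e' \<le> \<delta> * W t / 2 ^ Suc n" by (simp add: mult_ac)
      show "norm (y' t - x t) \<le> \<delta> * W t * (3 - 2 / 2 ^ Suc n)" by (rule N'[OF t])
    next
      have "integral {0..T} \<rho>' = integral {0..T} \<rho> + integral {0..T} e"
        unfolding \<rho>'_def by (rule Henstock_Kurzweil_Integration.integral_add[OF hi[OF \<rho>a T(3,2)] hi[OF ea T(3,2)]])
      also have "\<dots> \<le> integral {0..T} r + \<delta> * W 0 * (2 - 2 / 2 ^ n) + \<delta> * W 0 / 2 ^ n"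
        using I D[OF T(3)] by linarith
      also have "\<dots> = integral {0..T} r + \<delta> * W 0 * (2 - 2 / 2 ^ Suc n)" by (simp add: field_simps)
      finally show "integral {0..T} \<rho>' \<le> integral {0..T} r + \<delta> * W 0 * (2 - 2 / 2 ^ Suc n)" .
    qed
    moreover have "Q n s (y', w', \<rho>', e')" unfolding s Q_def prod.case
    proof (intro conjI allI ballI)
      show "\<rho>' t = \<rho> t + e t" for t by (simp add: \<rho>'_def)
      show "norm (w' t - w t) \<le> e t" "norm (y' t - y t) \<le> \<delta> * W t / 2 ^ n" if "t \<in> {0..T}" for t
        using w'w[OF that] yy[OF that] by auto
      show "w' t \<bullet> p - G t (y t) p \<le> \<rho>' t" if "t \<in> {t0..T}" for t p
        using u(3)[of t p] that t0 by (simp add: h_def w'_def \<rho>'_def)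
      show "e' t \<le> \<kappa>' t * norm (y' t - y t)" for t by (simp add: e'_def \<kappa>0)
    qed
    ultimately show ?thesis by blast
  qed

  \<comment> \<open>Passage to the limit\<close>
  obtain s where Ps: "\<And>n. P n (s n)" and Qs: "\<And>n. Q n (s n) (s (Suc n))"
    using dependent_nat_choice[of P Q, OF base step] by blast
  define ys where "ys n = fst (s n)" for n
  define ws where "ws n = fst (snd (s n))" for n
  define rs where "rs n = fst (snd (snd (s n)))" for n
  define es where "es n = snd (snd (snd (s n)))" for n
  have s: "s n = (ys n, ws n, rs n, es n)" for n by (simp add: ys_def ws_def rs_def es_def)
  have wsa: "ws n absolutely_integrable_on {0..T}" and rsa: "rs n absolutely_integrable_on {0..T}"
    and esa: "es n absolutely_integrable_on {0..T}" and es0: "0 \<le> es n t"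
    and sz: "t < t0 \<Longrightarrow> ws n t = 0" "t < t0 \<Longrightarrow> rs n t = 0"
    and ysw: "t \<in> {0..T} \<Longrightarrow> ys n t = z - integral {t..T} (ws n)"
    and ysN: "t \<in> {0..T} \<Longrightarrow> norm (ys n t - x t) \<le> \<delta> * W t * (3 - 2 / 2 ^ n)"
    and rsI: "integral {0..T} (rs n) \<le> integral {0..T} r + \<delta> * W 0 * (2 - 2 / 2 ^ n)" for n t
    using Ps[of n] unfolding s P_def prod.case by blast+
  have rs1: "rs (Suc n) t = rs n t + es n t" and ws1: "t \<in> {0..T} \<Longrightarrow> norm (ws (Suc n) t - ws n t) \<le> es n t"
    and wE: "t \<in> {t0..T} \<Longrightarrow> ws (Suc n) t \<bullet> p - G t (ys n t) p \<le> rs (Suc n) t"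
    and ys1: "t \<in> {0..T} \<Longrightarrow> norm (ys (Suc n) t - ys n t) \<le> \<delta> * W t / 2 ^ n"
    and es1: "t \<in> {0..T} \<Longrightarrow> es (Suc n) t \<le> \<kappa>' t * norm (ys (Suc n) t - ys n t)" for n t p
    using Qs[of n] unfolding s Q_def prod.case by blast+
  \<comment> \<open>An integrable bound for the sum of all defects: the first one plus the geometric
    series of the bounds on the others.\<close>
  define S where "S t = es 0 t + 2 * (\<kappa>' t * (\<delta> * exp (2 * K)))" for t
  have esb: "es (Suc n) t \<le> \<kappa>' t * (\<delta> * exp (2 * K)) * (1 / 2) ^ n" if t: "t \<in> {0..T}" for n t
  proof -
    have "es (Suc n) t \<le> \<kappa>' t * norm (ys (Suc n) t - ys n t)" by (rule es1[OF t])
    also have "\<dots> \<le> \<kappa>' t * (\<delta> * exp (2 * K) * (1 / 2) ^ n)"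
    proof (rule mult_left_mono[OF _ \<kappa>0])
      have "\<delta> * W t / 2 ^ n \<le> \<delta> * exp (2 * K) / 2 ^ n"
        using W1(2)[OF t] \<delta>0 by (intro divide_right_mono mult_left_mono) auto
      then show "norm (ys (Suc n) t - ys n t) \<le> \<delta> * exp (2 * K) * (1 / 2) ^ n"
        using ys1[OF t, of n] by (simp add: power_one_over)
    qed
    finally show ?thesis by (simp add: mult_ac)
  qed
  have esum: "summable (\<lambda>n. es n t)" "(\<Sum>n. es n t) \<le> S t" if t: "t \<in> {0..T}" for t
  proof -
    have g: "(\<lambda>n. \<kappa>' t * (\<delta> * exp (2 * K)) * (1 / 2) ^ n) sums (\<kappa>' t * (\<delta> * exp (2 * K)) * 2)"
      using sums_mult[OF geometric_sums[of "1/2::real"], of "\<kappa>' t * (\<delta> * exp (2 * K))"] by simp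
    have s1: "summable (\<lambda>n. es (Suc n) t)"
      by (rule summable_comparison_test'[OF sums_summable[OF g], of 0]) (use esb[OF t] es0 in simp)
    then show s0: "summable (\<lambda>n. es n t)" using summable_Suc_iff[of "\<lambda>n. es n t"] by blast
    have "(\<Sum>n. es n t) = (\<Sum>n. es (Suc n) t) + es 0 t" using suminf_split_head[OF s0] by simp
    also have "(\<Sum>n. es (Suc n) t) \<le> \<kappa>' t * (\<delta> * exp (2 * K)) * 2"
      using suminf_le[OF _ s1 sums_summable[OF g]] esb[OF t] sums_unique[OF g] by simp
    finally show "(\<Sum>n. es n t) \<le> S t" by (simp add: S_def mult_ac)
  qed
  have rsum: "rs n t = rs 0 t + (\<Sum>j<n. es j t)" for n t by (induction n) (auto simp: rs1)
  have psum: "(\<Sum>j<n. es j t) \<le> S t" if "t \<in> {0..T}" for n t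
    using sum_le_suminf[OF esum(1)[OF that], of "{..<n}"] esum(2)[OF that] es0 by (simp add: order_trans)
  have wsum: "norm (ws n t - ws 0 t) \<le> (\<Sum>j<n. es j t)" if t: "t \<in> {0..T}" for n t
  proof (induction n)
    case (Suc n)
    have "norm (ws (Suc n) t - ws 0 t) \<le> norm (ws (Suc n) t - ws n t) + norm (ws n t - ws 0 t)"
      by (metis norm_triangle_ineq diff_add_cancel add_diff_eq)
    then show ?case using Suc ws1[OF t, of n] by simp
  qed simp
  have wconv: "convergent (\<lambda>n. ws n t)" if t: "t \<in> {0..T}" for t
  proof -
    have "summable (\<lambda>n. ws (Suc n) t - ws n t)"
      by (rule summable_norm_cancel, rule summable_comparison_test'[OF esum(1)[OF t], of 0]) (use ws1[OF t] in simp)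
    then have "convergent (\<lambda>n. \<Sum>j<n. ws (Suc j) t - ws j t)" by (simp add: summable_iff_convergent)
    then have "convergent (\<lambda>n. (\<Sum>j<n. ws (Suc j) t - ws j t) + ws 0 t)" by (intro convergent_add convergent_const)
    then show ?thesis by (simp add: sum_lessThan_telescope[of "\<lambda>n. ws n t"])
  qed
  define w where "w t = (if t \<in> {0..T} then lim (\<lambda>n. ws n t) else 0)" for t
  have wl: "(\<lambda>n. ws n t) \<longlonglongrightarrow> w t" if "t \<in> {0..T}" for t
    using wconv[OF that] that by (simp add: w_def convergent_LIMSEQ_iff)
  define \<rho> where "\<rho> t = (if t \<in> {0..T} then rs 0 t + (\<Sum>n. es n t) else 0)" for t
  have \<rho>l: "(\<lambda>n. rs n t) \<longlonglongrightarrow> \<rho> t" if t: "t \<in> {0..T}" for t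
  proof -
    have "(\<lambda>n. rs 0 t + (\<Sum>j<n. es j t)) \<longlonglongrightarrow> rs 0 t + (\<Sum>n. es n t)"
      by (intro tendsto_intros summable_LIMSEQ esum(1)[OF t])
    then show ?thesis using t by (simp add: rsum[symmetric] \<rho>_def)
  qed
  have Sa: "S absolutely_integrable_on {0..T}" unfolding S_def
    by (intro set_integral_add(1) esa set_integrable_mult_right set_integrable_mult_left \<kappa>)
  have Si: "S integrable_on {t..T}" if "t \<in> {0..T}" for t by (rule hi[OF Sa that T(2)])
  have dom: "(\<lambda>\<tau>. norm (ws 0 \<tau>) + S \<tau>) integrable_on {t..T}" if t: "t \<in> {0..T}" for t
    by (intro Henstock_Kurzweil_Integration.integrable_add Si t hi[OF absolutely_integrable_norm[OF wsa, unfolded comp_def] t T(2)])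
  have wb: "norm (ws n \<tau>) \<le> norm (ws 0 \<tau>) + S \<tau>" if "\<tau> \<in> {0..T}" for n \<tau>
    using wsum[OF that, of n] psum[OF that, of n] norm_triangle_sub[of "ws n \<tau>" "ws 0 \<tau>"] by linarith
  have wdct: "w integrable_on {t..T}" "(\<lambda>n. integral {t..T} (ws n)) \<longlonglongrightarrow> integral {t..T} w" if t: "t \<in> {0..T}" for t
  proof -
    have 1: "norm (ws n \<tau>) \<le> norm (ws 0 \<tau>) + S \<tau>" if "\<tau> \<in> {t..T}" for n \<tau> using wb that t by auto
    have 2: "(\<lambda>n. ws n \<tau>) \<longlonglongrightarrow> w \<tau>" if "\<tau> \<in> {t..T}" for \<tau> using wl that t by auto
    show "w integrable_on {t..T}" "(\<lambda>n. integral {t..T} (ws n)) \<longlonglongrightarrow> integral {t..T} w"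
      using dominated_convergence[of ws "{t..T}" "\<lambda>\<tau>. norm (ws 0 \<tau>) + S \<tau>" w, OF hi[OF wsa t T(2)] dom[OF t] 1 2] by blast+
  qed
  have wa: "w absolutely_integrable_on {0..T}"
  proof (rule absolutely_integrable_integrable_bound[OF _ wdct(1)[OF T(3)] dom[OF T(3)]])
    fix t assume "t \<in> {0..T}"
    then show "norm (w t) \<le> norm (ws 0 t) + S t" by (intro Lim_bounded[OF tendsto_norm[OF wl], of t 0]) (use wb in blast)+
  qed
  have rb: "norm (rs n t) \<le> norm (rs 0 t) + S t" if "t \<in> {0..T}" for n t
  proof -
    have "0 \<le> (\<Sum>j<n. es j t)" by (intro sum_nonneg es0)
    then show ?thesis using psum[OF that, of n] unfolding rsum[of n t] real_norm_def by linarith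
  qed
  have rdom: "(\<lambda>\<tau>. norm (rs 0 \<tau>) + S \<tau>) integrable_on {0..T}"
    by (intro Henstock_Kurzweil_Integration.integrable_add Si T hi[OF absolutely_integrable_norm[OF rsa, unfolded comp_def] T(3,2)])
  have \<rho>i: "\<rho> integrable_on {0..T}" "(\<lambda>n. integral {0..T} (rs n)) \<longlonglongrightarrow> integral {0..T} \<rho>"
    using dominated_convergence[of rs "{0..T}" "\<lambda>\<tau>. norm (rs 0 \<tau>) + S \<tau>" \<rho>, OF hi[OF rsa T(3,2)] rdom rb \<rho>l] by blast+
  have \<rho>a: "\<rho> absolutely_integrable_on {0..T}"
  proof (rule absolutely_integrable_integrable_bound[OF _ \<rho>i(1) rdom])
    fix t assume "t \<in> {0..T}"
    then show "norm (\<rho> t) \<le> norm (rs 0 t) + S t" by (intro Lim_bounded[OF tendsto_norm[OF \<rho>l], of t 0]) (use rb in blast)+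
  qed
  define y where "y t = z - integral {t..T} w" for t
  have yl: "(\<lambda>n. ys n t) \<longlonglongrightarrow> y t" if t: "t \<in> {0..T}" for t
    unfolding y_def ysw[OF t] by (intro tendsto_intros wdct(2)[OF t])
  have two_pow: "2 / 2 ^ n \<le> (2::real)" for n :: nat
    using one_le_power[of "2::real" n] by (simp add: divide_le_eq)
  show thesis
  proof (rule that[of y w \<rho>])
    show "traj T G t0 y w \<rho>" unfolding traj_def
    proof (intro conjI allI impI ballI wa \<rho>a)
      fix t assume t: "t < t0"
      show "w t = 0" using wl[of t] sz(1)[OF t] by (cases "t \<in> {0..T}") (simp_all add: w_def LIMSEQ_const_iff)
      show "\<rho> t = 0" using \<rho>l[of t] sz(2)[OF t]
        by (cases "t \<in> {0..T}") (simp_all add: LIMSEQ_const_iff \<rho>_def del: sum.lessThan_Suc)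
    next
      fix t assume t: "t \<in> {0..T}"
      show "y t = y 0 + integral {0..t} w" using split[OF wa t] by (simp add: y_def algebra_simps)
    next
      fix t p assume t: "t \<in> {t0..T}"
      then have tT: "t \<in> {0..T}" using t0 by auto
      have "isCont (\<lambda>x. G t x p) (y t)" using Gcx[OF tT, of p] by (simp add: continuous_on_eq_continuous_at)
      then have "(\<lambda>n. G t (ys n t) p) \<longlonglongrightarrow> G t (y t) p" by (rule isCont_tendsto_compose[OF _ yl[OF tT]])
      \<comment> \<open>The velocity is one index ahead of the curve, as in \<open>Q\<close>; the
        shift does not affect the limits.\<close>
      then have "(\<lambda>n. ws (Suc n) t \<bullet> p - G t (ys n t) p) \<longlonglongrightarrow> w t \<bullet> p - G t (y t) p"
        by (intro tendsto_intros LIMSEQ_Suc[OF wl[OF tT]])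
      then show "w t \<bullet> p - G t (y t) p \<le> \<rho> t"
        by (rule LIMSEQ_le[OF _ LIMSEQ_Suc[OF \<rho>l[OF tT]]]) (use wE[OF t] in blast)
    qed
    show "y T = z" by (simp add: y_def)
    show "norm (y t - x t) \<le> 3 * \<delta> * exp (2 * K)" if t: "t \<in> {0..T}" for t
    proof (rule Lim_bounded)
      show "(\<lambda>n. norm (ys n t - x t)) \<longlonglongrightarrow> norm (y t - x t)" by (intro tendsto_intros yl[OF t])
      have "\<delta> * W t * (3 - 2 / 2 ^ n) \<le> \<delta> * exp (2 * K) * 3" for n :: nat
        using \<delta>0 W1[OF t] order_trans[OF two_pow[of n], of 3] by (intro mult_mono) auto
      then show "\<forall>n\<ge>0. norm (ys n t - x t) \<le> 3 * \<delta> * exp (2 * K)" using ysN[OF t] by (fastforce simp: mult_ac intro: order_trans)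
    qed
    show "integral {0..T} \<rho> \<le> integral {0..T} r + 2 * \<delta> * exp (2 * K)"
    proof (rule Lim_bounded[OF \<rho>i(2)], intro allI impI)
      fix n :: nat
      have "\<delta> * W 0 * (2 - 2 / 2 ^ n) \<le> \<delta> * exp (2 * K) * 2"
        using \<delta>0 W1[OF T(3)] two_pow[of n] by (intro mult_mono) auto
      then show "integral {0..T} (rs n) \<le> integral {0..T} r + 2 * \<delta> * exp (2 * K)" using rsI[of n] by (simp add: mult_ac)
    qed
  qed
qed

section \<open>Epi-convergence of the value functions\<close>

text \<open>A diagonal choice: at index \<open>i\<close> take a point that realises the finest level
  available there. Levels and radii decrease, so it also serves all coarser available
  levels.\<close>

lemma exists_recovery_sequence:
  fixes \<phi>s :: "nat \<Rightarrow> 'a::metric_space \<Rightarrow> ereal"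
  assumes z: "z \<in> D" and ex: "\<And>M \<epsilon>. \<phi> < ereal M \<Longrightarrow> 0 < \<epsilon> \<Longrightarrow>
      \<forall>\<^sub>F i in sequentially. \<exists>z'\<in>D. dist z' z < \<epsilon> \<and> \<phi>s i z' < ereal M"
  shows "\<exists>zs. (\<forall>i. zs i \<in> D) \<and> zs \<longlonglongrightarrow> z \<and> limsup (\<lambda>i. \<phi>s i (zs i)) \<le> \<phi>"
proof (cases "\<phi> = \<infinity>")
  case True
  then show ?thesis using z by (intro exI[of _ "\<lambda>_. z"]) simp
next
  case False
  \<comment> \<open>Real levels decreasing to \<open>\<phi>\<close>, which may be
    \<open>- \<infinity>\<close>.\<close>
  define m where "m n = (if \<phi> = - \<infinity> then - real n else real_of_ereal \<phi> + inverse (real (Suc n)))" for n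
  have m\<phi>: "\<phi> < ereal (m n)" for n using False by (cases \<phi>) (auto simp: m_def)
  have mdec: "m n' \<le> m n" if "n \<le> n'" for n n' using that by (simp add: m_def)
  have mlim: "\<exists>n. ereal (m n) < a" if a: "\<phi> < a" for a
  proof -
    obtain b where b: "\<phi> < ereal b" "ereal b < a" using ereal_dense2[OF a] by blast
    show ?thesis
    proof (cases \<phi>)
      case (real r)
      then obtain n where "inverse (real (Suc n)) < b - r" using reals_Archimedean[of "b - r"] b(1) by auto
      then have "m n < b" using real by (simp add: m_def)
      then have "ereal (m n) < ereal b" by simp
      then show ?thesis using less_trans[OF _ b(2)] by blast
    next
      case MInf
      obtain n where "- b < real n" using reals_Archimedean2 by blast
      then have "m n < b" using MInf by (simp add: m_def)
      then have "ereal (m n) < ereal b" by simp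
      then show ?thesis using less_trans[OF _ b(2)] by blast
    qed (use False in auto)
  qed
  \<comment> \<open>The restriction \<open>n \<le> i\<close> keeps the set of available levels
    finite, so that a finest one exists.\<close>
  define good where "good i n \<longleftrightarrow> n \<le> i \<and> (\<exists>z'\<in>D. dist z' z < inverse (real (Suc n)) \<and> \<phi>s i z' < ereal (m n))" for i n
  have "\<exists>z'\<in>D. (\<forall>n. good i n \<longrightarrow> dist z' z < inverse (real (Suc n)) \<and> \<phi>s i z' < ereal (m n))" for i
  proof (cases "\<exists>n. good i n")
    case False
    then show ?thesis using z by blast
  next
    case True
    define N where "N = Max {n. good i n}"
    have fin: "finite {n. good i n}" by (rule finite_subset[of _ "{..i}"]) (auto simp: good_def)
    then have "good i N" unfolding N_def using Max_in[OF fin] True by blast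
    then obtain z' where z': "z' \<in> D" "dist z' z < inverse (real (Suc N))" "\<phi>s i z' < ereal (m N)" by (auto simp: good_def)
    have "dist z' z < inverse (real (Suc n)) \<and> \<phi>s i z' < ereal (m n)" if "good i n" for n
    proof -
      have nN: "n \<le> N" unfolding N_def using fin that by (intro Max_ge) auto
      then have "inverse (real (Suc N)) \<le> inverse (real (Suc n))" by simp
      moreover have "ereal (m N) \<le> ereal (m n)" using mdec[OF nN] by simp
      ultimately show ?thesis using z' by (meson less_le_trans)
    qed
    then show ?thesis using z'(1) by blast
  qed
  then obtain zs where zs: "\<And>i. zs i \<in> D"
    "\<And>i n. good i n \<Longrightarrow> dist (zs i) z < inverse (real (Suc n)) \<and> \<phi>s i (zs i) < ereal (m n)" by metis
  have ev: "\<forall>\<^sub>F i in sequentially. good i n" for n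
  proof -
    have "0 < inverse (real (Suc n))" by simp
    from ex[OF m\<phi>[of n] this] eventually_ge_at_top[of n] show ?thesis
      by eventually_elim (simp add: good_def)
  qed
  have "zs \<longlonglongrightarrow> z"
  proof (rule tendstoI)
    fix e :: real assume "0 < e"
    then obtain n where n: "inverse (real (Suc n)) < e" using reals_Archimedean by blast
    show "\<forall>\<^sub>F i in sequentially. dist (zs i) z < e"
      using ev[of n] by eventually_elim (use zs(2)[of _ n] n in force)
  qed
  moreover have "limsup (\<lambda>i. \<phi>s i (zs i)) \<le> \<phi>"
  proof (rule ccontr)
    assume "\<not> limsup (\<lambda>i. \<phi>s i (zs i)) \<le> \<phi>"
    then have "\<phi> < limsup (\<lambda>i. \<phi>s i (zs i))" by simp
    from mlim[OF this] obtain n where n: "ereal (m n) < limsup (\<lambda>i. \<phi>s i (zs i))" by blast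
    have "\<forall>\<^sub>F i in sequentially. \<phi>s i (zs i) \<le> ereal (m n)"
      using ev[of n] by eventually_elim (use zs(2)[of _ n] less_imp_le in blast)
    then have "limsup (\<lambda>i. \<phi>s i (zs i)) \<le> ereal (m n)" by (rule Limsup_bounded)
    then show False using n by simp
  qed
  ultimately show ?thesis using zs(1) by blast
qed

text \<open>Epi-convergence speaks of full sequences. Filling the indices outside the subsequence
  with the limit point \<open>x\<close> gives a convergent full sequence, and passing back to the
  subsequence can only raise the lower limit.\<close>

lemma epi_liminf_subseq:
  fixes gs :: "nat \<Rightarrow> 'a::metric_space \<Rightarrow> ereal"
  assumes epi: "epi_converges_on UNIV gs g" and s: "strict_mono s" and y: "y \<longlonglongrightarrow> x"
  shows "g x \<le> liminf (\<lambda>j. gs (s j) (y j))"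
proof -
  define zs where "zs i = (if i \<in> range s then y (inv s i) else x)" for i
  have inj: "inj s" using s by (rule strict_mono_imp_inj_on)
  have zs: "zs (s j) = y j" for j by (simp add: zs_def inj)
  have "zs \<longlonglongrightarrow> x"
  proof (rule tendstoI)
    fix e :: real assume e: "0 < e"
    then have "\<forall>\<^sub>F j in sequentially. dist (y j) x < e" using tendstoD[OF y] by blast
    then obtain N where N: "\<And>j. j \<ge> N \<Longrightarrow> dist (y j) x < e" by (auto simp: eventually_sequentially)
    have "dist (zs i) x < e" if i: "i \<ge> s N" for i
    proof (cases "i \<in> range s")
      case True
      then obtain j where j: "i = s j" by blast
      then have "N \<le> j" using i s by (simp add: strict_mono_less_eq)
      then show ?thesis using N j zs by simp
    qed (use e in \<open>simp add: zs_def\<close>)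
    then show "\<forall>\<^sub>F i in sequentially. dist (zs i) x < e" by (auto simp: eventually_sequentially)
  qed
  then have "g x \<le> liminf (\<lambda>i. gs i (zs i))" using epi by (simp add: epi_converges_on_def)
  also have "\<dots> \<le> liminf ((\<lambda>i. gs i (zs i)) \<circ> s)" by (rule liminf_subseq_mono[OF s])
  also have "\<dots> = liminf (\<lambda>j. gs (s j) (y j))" by (simp add: comp_def zs)
  finally show ?thesis .
qed

text \<open>The constraint at momentum 0 gives \<open>- H t (x t) 0 \<le> r t\<close>, and (HLC)
  compares this value with \<open>H t 0 0\<close>.\<close>

lemma traj_cost_ge:
  assumes H: "ham_hyps T c k H" and tr: "traj T H t0 x v r" and t0: "0 \<le> t0" and R: "0 < R"
    and k0: "\<And>t. 0 \<le> k R t" and x: "norm (x t) \<le> R" and \<mu>: "\<bar>H t 0 0\<bar> \<le> \<mu> t" and t: "t \<in> {0..T}"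
  shows "- (\<mu> t + k R t * R) \<le> r t"
proof (cases "t < t0")
  case True
  have "0 \<le> \<mu> t + k R t * R" using \<mu> k0[of t] R by (intro add_nonneg_nonneg mult_nonneg_nonneg) auto
  then show ?thesis using True tr by (simp add: traj_def)
next
  case False
  then have "t \<in> {t0..T}" using t by simp
  then have "v t \<bullet> 0 - H t (x t) 0 \<le> r t" using tr unfolding traj_def by blast
  moreover have "\<bar>H t (x t) 0 - H t 0 0\<bar> \<le> k R t * (1 + norm (0::'a)) * norm (x t - 0)"
    using H t R x unfolding ham_hyps_def by (metis mem_cball_0 norm_zero less_imp_le)
  then have "H t (x t) 0 \<le> H t 0 0 + k R t * norm (x t)" by (simp add: abs_le_iff)
  moreover have "k R t * norm (x t) \<le> k R t * R" using x k0 by (rule mult_left_mono)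
  ultimately show ?thesis using \<mu> by (simp add: abs_le_iff)
qed

text \<open>Convergent initial points are bounded, which gives a state bound \<open>R\<close> common
  to all near-optimal trajectories, and with it common majorants for the velocities and minorants
  for the costs.\<close>

lemma value_fun_liminf:
  fixes Hs :: "nat \<Rightarrow> real \<Rightarrow> 'a::euclidean_space \<Rightarrow> 'a \<Rightarrow> real"
  assumes c: "c absolutely_integrable_on {0..T}" and c0: "\<And>t. 0 \<le> c t"
    and k: "\<And>R. 0 < R \<Longrightarrow> k R absolutely_integrable_on {0..T}" and k0: "\<And>R t. 0 < R \<Longrightarrow> 0 \<le> k R t"
    and Hs: "\<And>i. ham_hyps T c k (Hs i)" and H: "ham_hyps T c k H"
    and gp: "proper_fun g" and epi: "epi_converges_on UNIV gs g"
    and \<mu>: "\<mu> absolutely_integrable_on {0..T}" "\<And>t i. t \<in> {0..T} \<Longrightarrow> \<bar>Hs i t 0 0\<bar> \<le> \<mu> t"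
    and unif: "\<And>t K. t \<in> {0..T} \<Longrightarrow> compact K \<Longrightarrow>
        uniform_limit K (\<lambda>i (x, p). Hs i t x p) (\<lambda>(x, p). H t x p) sequentially"
    and zs: "\<And>i. zs i \<in> {0..T} \<times> UNIV" "zs \<longlonglongrightarrow> z" and z: "z \<in> {0..T} \<times> UNIV"
  shows "value_fun T g (steiner_f H) (steiner_l H) z \<le>
    liminf (\<lambda>i. value_fun T (gs i) (steiner_f (Hs i)) (steiner_l (Hs i)) (zs i))"
proof (rule ccontr)
  let ?V = "value_fun T g (steiner_f H) (steiner_l H) z"
  let ?Vs = "\<lambda>i. value_fun T (gs i) (steiner_f (Hs i)) (steiner_l (Hs i)) (zs i)"
  assume "\<not> ?V \<le> liminf ?Vs"
  then have "liminf ?Vs < ?V" by simp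
  then obtain M where M: "liminf ?Vs < ereal M" "ereal M < ?V" using ereal_dense2 by blast
  \<comment> \<open>The slack \<open>M' - M\<close> pays for the terminal costs, which are bounded
    below by \<open>g (X T)\<close> only in the lower limit.\<close>
  obtain M' where M': "ereal M < ereal M'" "ereal M' < ?V" using ereal_dense2[OF M(2)] by blast
  have "infinite {i. ?Vs i < ereal M}"
  proof
    assume "finite {i. ?Vs i < ereal M}"
    then obtain n where "\<forall>i\<in>{i. ?Vs i < ereal M}. i < n" using finite_nat_set_iff_bounded by blast
    then have n: "i < n" if "?Vs i < ereal M" for i using that by blast
    have "ereal M \<le> ?Vs i" if "n \<le> i" for i
      by (rule ccontr) (use n[of i] that in \<open>simp add: not_le\<close>)
    then have "\<forall>\<^sub>F i in sequentially. ereal M \<le> ?Vs i"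
      unfolding eventually_sequentially by blast
    then have "ereal M \<le> liminf ?Vs" by (rule Liminf_bounded)
    then show False using M(1) by simp
  qed
  then obtain s :: "nat \<Rightarrow> nat" where s: "strict_mono s" "\<And>j. s j \<in> {i. ?Vs i < ereal M}"
    using infinite_enumerate[of "{i. ?Vs i < ereal M}"] by blast
  define ts where "ts j = fst (zs (s j))" for j
  define ys where "ys j = snd (zs (s j))" for j
  have tsT: "ts j \<in> {0..T}" for j using zs(1)[of "s j"] by (auto simp: ts_def)
  have T: "0 \<le> T" "T \<in> {0..T}" "0 \<in> {0..T}" using tsT[of 0] by auto
  obtain t0 y0 where z_eq: "z = (t0, y0)" and t0: "t0 \<in> {0..T}" using z by (cases z) auto
  have zsl: "(\<lambda>j. zs (s j)) \<longlonglongrightarrow> z" using LIMSEQ_subseq_LIMSEQ[OF zs(2) s(1)] by (simp add: comp_def)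
  have tsl: "ts \<longlonglongrightarrow> t0" and ysl: "ys \<longlonglongrightarrow> y0"
    using tendsto_fst[OF zsl] tendsto_snd[OF zsl] by (simp_all add: ts_def[abs_def] ys_def[abs_def] z_eq)
  have "\<exists>x v r. traj T (Hs (s j)) (ts j) x v r \<and> x 0 = ys j \<and> gs (s j) (x T) + ereal (integral {0..T} r) < ereal M" for j
  proof -
    have "value_fun T (gs (s j)) (steiner_f (Hs (s j))) (steiner_l (Hs (s j))) (ts j, ys j) < ereal M"
      using s(2)[of j] unfolding ts_def ys_def by simp
    then show ?thesis using traj_of_value_fun_less[OF Hs c c0 tsT] by metis
  qed
  then obtain x v r where tr: "\<And>j. traj T (Hs (s j)) (ts j) (x j) (v j) (r j)" and x0: "\<And>j. x j 0 = ys j"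
    and cost: "\<And>j. gs (s j) (x j T) + ereal (integral {0..T} (r j)) < ereal M" by metis
  obtain B0 where B0: "\<And>j. norm (ys j) \<le> B0"
    using convergent_imp_Bseq[of ys] ysl by (auto simp: convergent_def Bseq_def)
  define R where "R = 2 * (1 + B0) * exp (2 * integral {0..T} c)"
  have "0 \<le> B0" using B0[of 0] norm_ge_zero order_trans by blast
  then have R: "0 < R" by (simp add: R_def)
  have ts0: "0 \<le> ts j" for j using tsT[of j] by simp
  have xR: "norm (x j t) \<le> R" if "t \<in> {0..T}" for j t
  proof -
    have "norm (x j t) \<le> 2 * (1 + norm (x j 0)) * exp (2 * integral {0..T} c)"
      by (rule traj_bound[OF Hs c c0 tr ts0 that])
    also have "\<dots> \<le> R" unfolding R_def x0 using B0[of j] by (intro mult_right_mono mult_left_mono) auto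
    finally show ?thesis .
  qed
  define \<phi> where "\<phi> t = c t * (1 + R)" for t
  have \<phi>a: "\<phi> absolutely_integrable_on {0..T}" unfolding \<phi>_def using c by (rule set_integrable_mult_left)
  have \<phi>i: "\<phi> integrable_on {0..T}" using \<phi>a by (rule set_lebesgue_integral_eq_integral)
  have v\<phi>: "norm (v j t) \<le> \<phi> t" if "t \<in> {0..T}" for j t
  proof -
    have "norm (v j t) \<le> c t * (1 + norm (x j t))" by (rule traj_velocity_le[OF Hs c0 tr ts0 that])
    also have "\<dots> \<le> \<phi> t" unfolding \<phi>_def using xR[OF that] c0 by (intro mult_left_mono) auto
    finally show ?thesis .
  qed
  define \<psi> where "\<psi> t = \<mu> t + k R t * R" for t
  have \<psi>a: "\<psi> absolutely_integrable_on {0..T}" unfolding \<psi>_def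
    by (intro set_integral_add(1) \<mu>(1) set_integrable_mult_left k R)
  have r\<psi>: "- \<psi> t \<le> r j t" if "t \<in> {0..T}" for j t unfolding \<psi>_def
    by (rule traj_cost_ge[where k = k and \<mu> = \<mu> and R = R, OF Hs tr ts0 R k0[OF R] xR[OF that] \<mu>(2)[OF that] that])
  \<comment> \<open>The indefinite integral of \<open>\<phi>\<close> is a common modulus of
    continuity, as Arzela-Ascoli requires.\<close>
  have inc: "norm (x j t - x j t') \<le> \<bar>integral {0..t} \<phi> - integral {0..t'} \<phi>\<bar>" if tt: "t \<in> {0..T}" "t' \<in> {0..T}" for j t t'
  proof -
    have vi: "v j integrable_on {0..T}" using tr[of j] unfolding traj_def using set_lebesgue_integral_eq_integral(1) by blast
    have le: "norm (x j b - x j a) \<le> \<bar>integral {0..b} \<phi> - integral {0..a} \<phi>\<bar>" if ab: "a \<in> {0..T}" "b \<in> {0..T}" "a \<le> b" for a b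
    proof -
      have xi: "x j u = x j 0 + integral {0..u} (v j)" if "u \<in> {0..T}" for u using tr[of j] that unfolding traj_def by blast
      have "x j b - x j a = integral {a..b} (v j)"
        using xi[OF ab(1)] xi[OF ab(2)] integral_diff_interval[OF vi, of a b] ab
        by (metis add_diff_cancel_left atLeastAtMost_iff)
      also have "norm \<dots> \<le> integral {a..b} \<phi>"
      proof (rule integral_norm_bound_integral)
        show "v j integrable_on {a..b}" "\<phi> integrable_on {a..b}"
          by (rule integrable_subinterval_real[OF vi] integrable_subinterval_real[OF \<phi>i], use ab in auto)+
      qed (use v\<phi> ab in auto)
      also have "\<dots> = integral {0..b} \<phi> - integral {0..a} \<phi>" using integral_diff_interval[OF \<phi>i, of a b] ab by simp
      finally show ?thesis by linarith
    qed
    show ?thesis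
    proof (cases "t \<le> t'")
      case True
      show ?thesis using le[OF tt True] by (simp add: norm_minus_commute abs_minus_commute)
    next
      case False
      then show ?thesis using le[OF tt(2,1)] by simp
    qed
  qed
  have \<phi>c: "continuous_on {0..T} (\<lambda>t. integral {0..t} \<phi>)" by (rule indefinite_integral_continuous_1[OF \<phi>i])
  have equi: "\<exists>d>0. \<forall>n y. y \<in> {0..T} \<and> norm (t - y) < d \<longrightarrow> norm (x n t - x n y) < e" if tT: "t \<in> {0..T}" and e: "0 < e" for t e
  proof -
    obtain d where d: "0 < d" "\<And>y. y \<in> {0..T} \<Longrightarrow> dist y t < d \<Longrightarrow> dist (integral {0..y} \<phi>) (integral {0..t} \<phi>) < e"
      using \<phi>c[unfolded continuous_on_iff, THEN bspec, OF tT, THEN spec, THEN mp, OF e] by blast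
    have "norm (x n t - x n y) < e" if "y \<in> {0..T}" "norm (t - y) < d" for n y
    proof -
      have "dist (integral {0..y} \<phi>) (integral {0..t} \<phi>) < e"
        by (rule d(2)[OF that(1)]) (use that(2) in \<open>simp add: dist_norm norm_minus_commute\<close>)
      then show ?thesis using inc[OF tT that(1), of n] by (simp add: dist_real_def abs_minus_commute)
    qed
    then show ?thesis using d(1) by blast
  qed
  obtain X \<kappa> where \<kappa>: "strict_mono (\<kappa> :: nat \<Rightarrow> nat)"
    and X: "\<And>e. 0 < e \<Longrightarrow> \<exists>N. \<forall>n t. n \<ge> N \<and> t \<in> {0..T} \<longrightarrow> norm (x (\<kappa> n) t - X t) < e"
    by (rule Arzela_Ascoli[of "{0..T}" x R]) (use xR equi in auto)
  have Xl: "(\<lambda>n. x (\<kappa> n) t) \<longlonglongrightarrow> X t" if "t \<in> {0..T}" for t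
    by (rule LIMSEQ_I) (use X that in meson)
  have X0: "X 0 = y0"
  proof -
    have "(\<lambda>n. x (\<kappa> n) 0) \<longlonglongrightarrow> y0" using LIMSEQ_subseq_LIMSEQ[OF ysl \<kappa>] by (simp add: x0 comp_def)
    then show ?thesis using Xl[OF T(3)] LIMSEQ_unique by blast
  qed
  define \<sigma> where "\<sigma> = s \<circ> \<kappa>"
  have \<sigma>: "strict_mono \<sigma>" unfolding \<sigma>_def using s(1) \<kappa> by (rule strict_mono_o)
  have gl: "g (X T) \<le> liminf (\<lambda>j. gs (\<sigma> j) (x (\<kappa> j) T))" by (rule epi_liminf_subseq[OF epi \<sigma> Xl[OF T(2)]])
  define b where "b j = integral {0..T} (r (\<kappa> j))" for j
  have ab: "gs (\<sigma> j) (x (\<kappa> j) T) + ereal (b j) < ereal M" for j using cost[of "\<kappa> j"] by (simp add: \<sigma>_def b_def)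
  have aM: "gs (\<sigma> j) (x (\<kappa> j) T) < ereal (M - b j)" for j
    using ab[of j] by (cases "gs (\<sigma> j) (x (\<kappa> j) T)") auto
  have b\<psi>: "- integral {0..T} \<psi> \<le> b j" for j
  proof -
    have "integral {0..T} (\<lambda>t. - \<psi> t) \<le> integral {0..T} (r (\<kappa> j))"
    proof (rule integral_le)
      show "(\<lambda>t. - \<psi> t) integrable_on {0..T}" using set_lebesgue_integral_eq_integral(1)[OF \<psi>a] by (rule Henstock_Kurzweil_Integration.integrable_neg)
      show "r (\<kappa> j) integrable_on {0..T}" using tr[of "\<kappa> j"] unfolding traj_def using set_lebesgue_integral_eq_integral(1) by blast
    qed (rule r\<psi>)
    then show ?thesis by (simp add: b_def)
  qed
  \<comment> \<open>The lower bound on the running costs leaves only a bounded amount for the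
    terminal costs, so the limit state has a finite one.\<close>
  have "g (X T) < \<infinity>"
  proof -
    have "gs (\<sigma> j) (x (\<kappa> j) T) \<le> ereal (M + integral {0..T} \<psi>)" for j
      by (rule order_trans[OF less_imp_le[OF aM[of j]]]) (use b\<psi>[of j] in simp)
    then have "liminf (\<lambda>j. gs (\<sigma> j) (x (\<kappa> j) T)) \<le> liminf (\<lambda>j::nat. ereal (M + integral {0..T} \<psi>))"
      by (intro Liminf_mono always_eventually allI)
    also have "\<dots> = ereal (M + integral {0..T} \<psi>)" by (simp add: Liminf_const)
    finally show ?thesis using gl by (auto intro: le_less_trans)
  qed
  moreover have "g (X T) \<noteq> - \<infinity>" using gp by (simp add: proper_fun_def)
  ultimately obtain \<gamma> where \<gamma>: "g (X T) = ereal \<gamma>" by (cases "g (X T)") auto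
  have "ereal (\<gamma> - (M' - M)) < g (X T)" using M'(1) \<gamma> by simp
  from this gl have "ereal (\<gamma> - (M' - M)) < liminf (\<lambda>j. gs (\<sigma> j) (x (\<kappa> j) T))" by (rule less_le_trans)
  then have "\<forall>\<^sub>F j in sequentially. ereal (\<gamma> - (M' - M)) < gs (\<sigma> j) (x (\<kappa> j) T)" by (rule less_LiminfD)
  then obtain m where m: "\<And>j. j \<ge> m \<Longrightarrow> ereal (\<gamma> - (M' - M)) < gs (\<sigma> j) (x (\<kappa> j) T)" by (auto simp: eventually_sequentially)
  \<comment> \<open>A terminal cost above \<open>\<gamma> - (M' - M)\<close> within a total below
    \<open>M\<close> leaves at most \<open>M' - \<gamma>\<close> for the running cost.\<close>
  have bB: "b (j + m) \<le> M' - \<gamma>" for j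
  proof -
    have "ereal (\<gamma> - (M' - M)) < ereal (M - b (j + m))" using less_trans[OF m[of "j + m"] aM] by simp
    then show ?thesis by simp
  qed
  have sub: "strict_mono (\<lambda>j. \<sigma> (j + m))" using \<sigma> by (simp add: strict_mono_def)
  have sub\<kappa>: "strict_mono (\<lambda>j. \<kappa> (j + m))" using \<kappa> by (simp add: strict_mono_def)
  have "value_fun T g (steiner_f H) (steiner_l H) (t0, X 0) \<le> g (X T) + ereal (M' - \<gamma>)"
  proof (rule trajectory_limit_cost[where \<phi> = \<phi> and \<psi> = \<psi>])
    show "continuous_on UNIV (\<lambda>(x, p). H t x p)" if "t \<in> {0..T}" for t using H that unfolding ham_hyps_def by blast
    show "uniform_limit K (\<lambda>j (x, p). Hs (\<sigma> (j + m)) t x p) (\<lambda>(x, p). H t x p) sequentially"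
      if "t \<in> {0..T}" "compact K" for t K
      using unif[OF that] unfolding uniform_limit_iff
      by (auto intro: eventually_subseq[OF sub])
    show "traj T (Hs (\<sigma> (j + m))) (ts (\<kappa> (j + m))) (x (\<kappa> (j + m))) (v (\<kappa> (j + m))) (r (\<kappa> (j + m)))" for j
      using tr by (simp add: \<sigma>_def)
    show "(\<lambda>j. ts (\<kappa> (j + m))) \<longlonglongrightarrow> t0" using LIMSEQ_subseq_LIMSEQ[OF tsl sub\<kappa>] by (simp add: comp_def)
    show "integral {0..T} (r (\<kappa> (j + m))) \<le> M' - \<gamma>" for j using bB by (simp add: b_def)
    show "(\<lambda>j. x (\<kappa> (j + m)) t) \<longlonglongrightarrow> X t" if "t \<in> {0..T}" for t
      using LIMSEQ_ignore_initial_segment[OF Xl[OF that], of m] .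
  qed (use t0 \<phi>a v\<phi> \<psi>a r\<psi> in auto)
  then have "?V \<le> ereal M'" by (simp add: z_eq X0 \<gamma>)
  then show False using M'(2) by simp
qed

text \<open>The initial time is kept and only the initial state moves. A near-optimal trajectory of
  \<open>H\<close> satisfies the constraint of \<open>Hs i\<close> up to \<open>conj_gap\<close>,
  whose integral tends to 0, and Filippov's construction repairs this from the end point
  \<open>ws i\<close>.\<close>

lemma value_fun_recovery:
  fixes Hs :: "nat \<Rightarrow> real \<Rightarrow> 'a::euclidean_space \<Rightarrow> 'a \<Rightarrow> real"
  assumes c: "c absolutely_integrable_on {0..T}" and c0: "\<And>t. 0 \<le> c t"
    and k: "\<And>R. 0 < R \<Longrightarrow> k R absolutely_integrable_on {0..T}" and k0: "\<And>R t. 0 < R \<Longrightarrow> 0 \<le> k R t"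
    and Hs: "\<And>i. ham_hyps T c k (Hs i)" and H: "ham_hyps T c k H"
    and gp: "proper_fun g" and epi: "epi_converges_on UNIV gs g"
    and \<mu>: "\<mu> absolutely_integrable_on {0..T}" "\<And>t i. t \<in> {0..T} \<Longrightarrow> \<bar>Hs i t 0 0\<bar> \<le> \<mu> t"
    and unif: "\<And>t K. t \<in> {0..T} \<Longrightarrow> compact K \<Longrightarrow>
        uniform_limit K (\<lambda>i (x, p). Hs i t x p) (\<lambda>(x, p). H t x p) sequentially"
    and t0: "t0 \<in> {0..T}" and V: "value_fun T g (steiner_f H) (steiner_l H) (t0, x0) < ereal M" and \<epsilon>: "0 < \<epsilon>"
  shows "\<forall>\<^sub>F i in sequentially. \<exists>y0. dist y0 x0 < \<epsilon> \<and>
    value_fun T (gs i) (steiner_f (Hs i)) (steiner_l (Hs i)) (t0, y0) < ereal M"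
proof -
  let ?M = "lebesgue_on {0..T}"
  have leb: "{0..T} \<in> sets lebesgue" by simp
  have T: "T \<in> {0..T}" "0 \<in> {0..T}" "0 \<le> t0" using t0 by auto
  obtain x v r where tr: "traj T H t0 x v r" and x0: "x 0 = x0"
    and cost: "g (x T) + ereal (integral {0..T} r) < ereal M"
    by (rule traj_of_value_fun_less[OF H c c0 t0 V])
  have va: "v absolutely_integrable_on {0..T}" and ra: "r absolutely_integrable_on {0..T}"
    and vr0: "\<And>t. t < t0 \<Longrightarrow> v t = 0" "\<And>t. t < t0 \<Longrightarrow> r t = 0"
    and xv: "\<And>t. t \<in> {0..T} \<Longrightarrow> x t = x 0 + integral {0..t} v"
    and E: "\<And>t p. t \<in> {t0..T} \<Longrightarrow> v t \<bullet> p - H t (x t) p \<le> r t"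
    using tr unfolding traj_def by blast+
  have xc: "continuous_on {0..T} x" by (rule traj_continuous[OF tr])
  obtain R where R: "0 < R" "\<And>t. t \<in> {0..T} \<Longrightarrow> norm (x t) + 1 \<le> R"
  proof (rule that)
    fix t assume "t \<in> {0..T}"
    then show "norm (x t) + 1 \<le> 2 * (1 + norm (x 0)) * exp (2 * integral {0..T} c) + 1"
      using traj_bound[OF H c c0 tr T(3)] by simp
  qed (simp add: add_nonneg_pos)
  define \<gamma> where "\<gamma> = real_of_ereal (g (x T))"
  have \<gamma>: "g (x T) = ereal \<gamma>"
    using gp cost by (cases "g (x T)") (auto simp: \<gamma>_def proper_fun_def)
  \<comment> \<open>Half of the slack below \<open>M\<close>: one half is for the terminal cost, the
    other for the running cost.\<close>
  define \<eta> where "\<eta> = (M - \<gamma> - integral {0..T} r) / 2"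
  have \<eta>: "0 < \<eta>" "\<gamma> + \<eta> + (integral {0..T} r + \<eta>) = M" using cost by (auto simp: \<gamma> \<eta>_def field_simps)
  obtain ws where ws: "ws \<longlonglongrightarrow> x T" "limsup (\<lambda>i. gs i (ws i)) \<le> g (x T)"
    using epi unfolding epi_converges_on_def by blast
  have "limsup (\<lambda>i. gs i (ws i)) < ereal (\<gamma> + \<eta>)" by (rule le_less_trans[OF ws(2)]) (simp add: \<gamma> \<eta>(1))
  then have evg: "\<forall>\<^sub>F i in sequentially. gs i (ws i) < ereal (\<gamma> + \<eta>)" by (rule Limsup_lessD)
  define L where "L t = c t * (1 + norm (x t))" for t
  have L0: "0 \<le> L t" for t using c0 by (simp add: L_def)
  have lip: "\<bar>Hs i t (x t) p - Hs i t (x t) q\<bar> \<le> L t * norm (p - q)" if "t \<in> {0..T}" for i t p q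
    using Hs[of i] that unfolding ham_hyps_def L_def by blast
  have lip0: "Hs i t (x t) 0 \<le> Hs i t (x t) p + L t * norm p" if "t \<in> {0..T}" for i t p
    using lip[OF that, of i 0 p] by (simp add: abs_le_iff)
  define e where "e i t = (if t \<in> {t0..T} then conj_gap (Hs i t (x t)) (v t) (r t) else 0)" for i t
  have idm[measurable]: "(\<lambda>t::real. t) \<in> borel_measurable ?M"
    by (rule continuous_imp_measurable_on_sets_lebesgue[OF continuous_on_id leb])
  have xm: "x \<in> borel_measurable ?M" by (rule continuous_imp_measurable_on_sets_lebesgue[OF xc leb])
  have Hm: "(\<lambda>t. Hs i t (x t) p) \<in> borel_measurable ?M" for i p
  proof (rule borel_measurable_caratheodory[OF _ _ xm])
    show "(\<lambda>t. Hs i t y p) \<in> borel_measurable ?M" for y using Hs[of i] unfolding ham_hyps_def by blast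
    show "continuous_on UNIV (\<lambda>y. Hs i t y p)" if "t \<in> space ?M" for t
    proof -
      have "continuous_on UNIV (\<lambda>(x, p). Hs i t x p)" using Hs[of i] that unfolding ham_hyps_def by simp
      from continuous_on_compose2[OF this continuous_on_Pair[OF continuous_on_id continuous_on_const]] show ?thesis by simp
    qed
  qed
  have em: "e i \<in> borel_measurable ?M" for i
  proof -
    have [measurable]: "(\<lambda>t. conj_gap (Hs i t (x t)) (v t) (r t)) \<in> borel_measurable ?M"
      by (rule conj_gap_measurable[OF Hm _ L0])
         (use lip va ra in \<open>auto simp: absolutely_integrable_on_iff_integrable intro: borel_measurable_integrable\<close>)
    have eq: "e i = (\<lambda>t. if t0 \<le> t \<and> t \<le> T then conj_gap (Hs i t (x t)) (v t) (r t) else 0)" by (auto simp: e_def)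
    show ?thesis unfolding eq by measurable
  qed
  \<comment> \<open>A majorant independent of \<open>i\<close>: the third estimate of
    \<open>conj_gap_bounds\<close>, with \<open>Hs i t (x t) 0\<close> bounded through
    \<open>\<mu>\<close> and (HLC).\<close>
  define b where "b t = norm (v t) + \<bar>r t\<bar> + (\<mu> t + k R t * R) + c t * (1 + R)" for t
  have ba: "b integrable_on {0..T}"
  proof -
    have "(\<lambda>t. norm (v t)) integrable_on {0..T}" "(\<lambda>t. \<bar>r t\<bar>) integrable_on {0..T}"
      using va ra unfolding absolutely_integrable_on_def by auto
    moreover have "\<mu> integrable_on {0..T}" "k R integrable_on {0..T}" "c integrable_on {0..T}"
      using \<mu>(1) k[OF R(1)] c by (auto intro: set_lebesgue_integral_eq_integral(1))
    ultimately show ?thesis unfolding b_def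
      by (intro Henstock_Kurzweil_Integration.integrable_add integrable_on_mult_left)
  qed
  have e0: "0 \<le> e i t" for i t
    using conj_gap_bounds(1)[OF lip0[of t i] L0[of t], of "v t" "r t"] t0 by (auto simp: e_def)
  have eb: "norm (e i t) \<le> b t" if t: "t \<in> {0..T}" for i t
  proof -
    have xR: "norm (x t) \<le> R" using R(2)[OF t] by simp
    have "\<bar>Hs i t (x t) 0 - Hs i t 0 0\<bar> \<le> k R t * (1 + norm (0::'a)) * norm (x t - 0)"
      using Hs[of i] t R(1) xR unfolding ham_hyps_def by (metis mem_cball_0 norm_zero less_imp_le)
    also have "\<dots> \<le> k R t * R" using xR k0[OF R(1)] by (simp add: mult_left_mono)
    finally have "\<bar>Hs i t (x t) 0\<bar> \<le> \<mu> t + k R t * R" using \<mu>(2)[OF t, of i] by linarith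
    moreover have "L t \<le> c t * (1 + R)" unfolding L_def using xR c0 by (intro mult_left_mono) auto
    moreover have "e i t \<le> norm (v t) + \<bar>r t\<bar> + \<bar>Hs i t (x t) 0\<bar> + L t"
      using conj_gap_bounds(3)[OF lip0[OF t, of i] L0[of t], of "v t" "r t"] L0[of t] by (auto simp: e_def)
    ultimately show ?thesis using e0[of i t] by (simp add: b_def)
  qed
  have ea: "e i absolutely_integrable_on {0..T}" for i
    by (rule measurable_bounded_by_integrable_imp_absolutely_integrable[OF em leb ba eb])
  have elim0: "(\<lambda>i. e i t) \<longlonglongrightarrow> 0" if t: "t \<in> {0..T}" for t
  proof (cases "t \<in> {t0..T}")
    case True
    have "(\<lambda>i. conj_gap (Hs i t (x t)) (v t) (r t)) \<longlonglongrightarrow> 0"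
    proof (rule conj_gap_tendsto_0[where h = "\<lambda>i. Hs i t (x t)" and ?h0.0 = "H t (x t)" and L = "L t"])
      show "Hs i t (x t) 0 \<le> Hs i t (x t) p + L t * norm p" for i p by (rule lip0[OF t])
      show "0 \<le> L t" by (rule L0)
      show "v t \<bullet> p - H t (x t) p \<le> r t" for p by (rule E[OF True])
      show "convex_on UNIV (Hs i t (x t))" for i using Hs[of i] t unfolding ham_hyps_def by blast
      fix K :: "'a set" assume "compact K"
      then have "compact ({x t} \<times> K)" by (intro compact_Times) auto
      from unif[OF t this] show "uniform_limit K (\<lambda>i. Hs i t (x t)) (H t (x t)) sequentially"
        unfolding uniform_limit_iff by auto
    qed
    then show ?thesis using True by (simp add: e_def)
  qed (auto simp: e_def)
  have "(\<lambda>i. integral {0..T} (e i)) \<longlonglongrightarrow> integral {0..T} (\<lambda>_. 0)"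
    by (rule dominated_convergence(2)[OF _ ba eb elim0]) (rule set_lebesgue_integral_eq_integral(1)[OF ea])
  then have elim: "(\<lambda>i. integral {0..T} (e i)) \<longlonglongrightarrow> 0" by simp
  define K where "K = integral {0..T} (k R)"
  define \<delta> where "\<delta> i = norm (ws i - x T) + integral {0..T} (e i)" for i
  have "\<delta> \<longlonglongrightarrow> 0 + 0" unfolding \<delta>_def
    by (intro tendsto_add elim) (use ws(1) in \<open>simp add: LIM_zero tendsto_norm_zero\<close>)
  then have "(\<lambda>i. 3 * \<delta> i * exp (2 * K)) \<longlonglongrightarrow> 3 * 0 * exp (2 * K)" by (intro tendsto_intros) simp
  then have "(\<lambda>i. 3 * \<delta> i * exp (2 * K)) \<longlonglongrightarrow> 0" by simp
  \<comment> \<open>The bound 1 admits the Filippov construction, \<open>\<epsilon>\<close> controls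
    the initial state and \<open>\<eta>\<close> the additional cost.\<close>
  then have "\<forall>\<^sub>F i in sequentially. 3 * \<delta> i * exp (2 * K) < min 1 (min \<epsilon> \<eta>)"
    by (rule order_tendstoD) (use \<epsilon> \<eta>(1) in simp)
  then show ?thesis using evg
  proof eventually_elim
    case (elim i)
    then have small: "3 * \<delta> i * exp (2 * K) \<le> 1" by simp
    obtain y w \<rho> where y: "traj T (Hs i) t0 y w \<rho>" "y T = ws i"
      "\<And>t. t \<in> {0..T} \<Longrightarrow> norm (y t - x t) \<le> 3 * \<delta> i * exp (2 * K)"
      "integral {0..T} \<rho> \<le> integral {0..T} r + 2 * \<delta> i * exp (2 * K)"
    proof (rule filippov_trajectory[OF Hs[of i] t0 R(1) k[OF R(1)] k0[OF R(1)] va ra vr0 xv R(2) ea[of i] e0[of i], of "ws i"])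
      show "e i t = 0" if "t < t0" for t using that by (simp add: e_def)
      show "v t \<bullet> p - Hs i t (x t) p \<le> r t + e i t * (1 + norm p)" if t: "t \<in> {t0..T}" for t p
        using conj_gap_bounds(2)[OF lip0[of t i] L0[of t], of "v t" p "r t"] t t0 by (simp add: e_def)
      show "3 * (norm (ws i - x T) + integral {0..T} (e i)) * exp (2 * integral {0..T} (k R)) \<le> 1"
        using small by (simp add: \<delta>_def K_def)
    qed (auto simp: \<delta>_def K_def)
    have "value_fun T (gs i) (steiner_f (Hs i)) (steiner_l (Hs i)) (t0, y 0) \<le> gs i (y T) + ereal (integral {0..T} \<rho>)"
      by (rule value_fun_le_traj[OF t0, of w \<rho> y "{}"])
         (use y(1)[unfolded traj_def] in \<open>blast | simp only: negligible_empty\<close>)+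
    also have "\<dots> < ereal M"
    proof -
      \<comment> \<open>Nonnegativity lets the additional cost, with factor 2, be compared with the
        bound that has factor 3.\<close>
      have "0 \<le> \<delta> i * exp (2 * K)" unfolding \<delta>_def
        using integral_nonneg[OF set_lebesgue_integral_eq_integral(1)[OF ea[of i]]] e0 by simp
      then have "integral {0..T} \<rho> \<le> integral {0..T} r + \<eta>" using y(4) elim(1) by simp
      then have "gs i (ws i) + ereal (integral {0..T} \<rho>) < ereal (\<gamma> + \<eta>) + ereal (integral {0..T} r + \<eta>)"
        using elim(2) by (cases "gs i (ws i)") auto
      then show ?thesis using \<eta>(2) y(2) by simp
    qed
    finally have "value_fun T (gs i) (steiner_f (Hs i)) (steiner_l (Hs i)) (t0, y 0) < ereal M" .
    moreover have "dist (y 0) x0 < \<epsilon>" using y(3)[OF T(2)] elim(1) x0 by (simp add: dist_norm)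
    ultimately show ?case by blast
  qed
qed

theorem theorem4p13:
  fixes T :: real
    and Hs :: "nat \<Rightarrow> real \<Rightarrow> 'a::euclidean_space \<Rightarrow> 'a \<Rightarrow> real"
    and H :: "real \<Rightarrow> 'a \<Rightarrow> 'a \<Rightarrow> real"
    and c \<mu> :: "real \<Rightarrow> real"
    and k :: "real \<Rightarrow> real \<Rightarrow> real"
    and gs :: "nat \<Rightarrow> 'a \<Rightarrow> ereal"
    and g :: "'a \<Rightarrow> ereal"
  assumes T_pos: "0 < T"
    and c_int: "integrable (lebesgue_on {0..T}) c" and c_nonneg: "\<forall>t. 0 \<le> c t"
    and k_int: "\<forall>R>0. integrable (lebesgue_on {0..T}) (k R)"
    and k_nonneg: "\<forall>R>0. \<forall>t. 0 \<le> k R t"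
    and Hs_hyps: "\<forall>i. ham_hyps T c k (Hs i)"
    and H_hyps: "ham_hyps T c k H"
    and gs_proper: "\<forall>i. proper_fun (gs i) \<and> lsc (gs i)"
    and g_proper: "proper_fun g" and g_lsc: "lsc g"
    and g_epi: "epi_converges_on UNIV gs g"
    and \<mu>_int: "integrable (lebesgue_on {0..T}) \<mu>"
    and \<mu>_bound: "\<forall>t\<in>{0..T}. \<forall>i. max \<bar>Hs i t 0 0\<bar> \<bar>H t 0 0\<bar> \<le> \<mu> t"
    and H_unif: "\<forall>t\<in>{0..T}. \<forall>K. compact K \<longrightarrow>
                    uniform_limit K (\<lambda>i (x, p). Hs i t x p) (\<lambda>(x, p). H t x p) sequentially"
  shows "epi_converges_on ({0..T} \<times> UNIV)
           (\<lambda>i. value_fun T (gs i) (steiner_f (Hs i)) (steiner_l (Hs i)))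
           (value_fun T g (steiner_f H) (steiner_l H))"
proof -
  have leb: "{0..T} \<in> sets lebesgue" by simp
  note ai = absolutely_integrable_on_iff_integrable[OF leb]
  have c: "c absolutely_integrable_on {0..T}" and c0: "\<And>t. 0 \<le> c t" using c_int c_nonneg by (simp_all add: ai)
  have k: "\<And>R. 0 < R \<Longrightarrow> k R absolutely_integrable_on {0..T}" and k0: "\<And>R t. 0 < R \<Longrightarrow> 0 \<le> k R t"
    using k_int k_nonneg by (simp_all add: ai)
  have \<mu>: "\<mu> absolutely_integrable_on {0..T}" "\<And>t i. t \<in> {0..T} \<Longrightarrow> \<bar>Hs i t 0 0\<bar> \<le> \<mu> t"
    using \<mu>_int \<mu>_bound by (simp_all add: ai)
  have Hs: "\<And>i. ham_hyps T c k (Hs i)" using Hs_hyps by blast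
  have unif: "\<And>t K. t \<in> {0..T} \<Longrightarrow> compact K \<Longrightarrow>
        uniform_limit K (\<lambda>i (x, p). Hs i t x p) (\<lambda>(x, p). H t x p) sequentially" using H_unif by blast
  show ?thesis unfolding epi_converges_on_def
  proof (intro ballI conjI allI impI)
    fix z :: "real \<times> 'a" and zs
    assume z: "z \<in> {0..T} \<times> UNIV" and "\<forall>i. zs i \<in> {0..T} \<times> UNIV" and lim: "zs \<longlonglongrightarrow> z"
    then have zs: "\<And>i. zs i \<in> {0..T} \<times> UNIV" by blast
    show "value_fun T g (steiner_f H) (steiner_l H) z \<le>
        liminf (\<lambda>i. value_fun T (gs i) (steiner_f (Hs i)) (steiner_l (Hs i)) (zs i))"
      by (rule value_fun_liminf[where c = c and k = k and \<mu> = \<mu> and H = H and g = g])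
         (fact c c0 k k0 Hs H_hyps g_proper g_epi \<mu> unif zs lim z)+
  next
    fix z :: "real \<times> 'a" assume z: "z \<in> {0..T} \<times> UNIV"
    then obtain t0 x0 where z_eq: "z = (t0, x0)" and t0: "t0 \<in> {0..T}" by auto
    show "\<exists>zs. (\<forall>i. zs i \<in> {0..T} \<times> UNIV) \<and> zs \<longlonglongrightarrow> z \<and>
        limsup (\<lambda>i. value_fun T (gs i) (steiner_f (Hs i)) (steiner_l (Hs i)) (zs i))
          \<le> value_fun T g (steiner_f H) (steiner_l H) z"
    \<comment> \<open>The recovery points keep the time component of \<open>z\<close>, so only the
      state component has to be close.\<close>
    proof (rule exists_recovery_sequence[OF z])
      fix M \<epsilon> :: real
      assume V: "value_fun T g (steiner_f H) (steiner_l H) z < ereal M" and \<epsilon>: "0 < \<epsilon>"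
      have "\<forall>\<^sub>F i in sequentially. \<exists>y0. dist y0 x0 < \<epsilon> \<and>
          value_fun T (gs i) (steiner_f (Hs i)) (steiner_l (Hs i)) (t0, y0) < ereal M"
        by (rule value_fun_recovery[where c = c and k = k and \<mu> = \<mu> and H = H and g = g])
           (fact c c0 k k0 Hs H_hyps g_proper g_epi \<mu> unif t0 V[unfolded z_eq] \<epsilon>)+
      then show "\<forall>\<^sub>F i in sequentially. \<exists>z'\<in>{0..T} \<times> UNIV. dist z' z < \<epsilon> \<and>
          value_fun T (gs i) (steiner_f (Hs i)) (steiner_l (Hs i)) z' < ereal M"
        by eventually_elim (use t0 in \<open>force simp: z_eq dist_Pair_Pair\<close>)
    qed
  qed
qed

end
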